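(* For every positive integer $r$, every $\lambda\ge1$ and every one of the six models (Independent set, MAX-CUT, anti-ferromagnetic Ising, $q$-Coloring, K-SAT, NAE-K-SAT), there exists a (model dependent) $z(r)$ such that with high probability (in probability) $$\lim_{N\to\infty}N^{-1}\log Z\big(\mathbb{G}(N,r)\big)=z(r),$$ the limit being taken along $N$ with $Nr/K$ an integer.
   Context: Let $K\ge2$, $\chi=\{0,\dots,q-1\}$, $[N]=\{1,\dots,N\}$. $\mathbb{G}(N,r)$ (defined when $Nr/K\in\mathbb{Z}$) is the configuration-model random $r$-regular hypergraph: each node gets $r$ points, a uniformly random partition of the $Nr$ points into blocks of size $K$ is chosen, and each block is projected to the hyperedge formed by the owners of its points. For a hypergraph $G=([N],E)$ with node potentials $H_i$ and edge potentials $H_e:\chi^K\to\mathbb{R}\cup\{-\infty\}$, $H(x)=\sum_iH_i(x_i)+\sum_{e\in E}H_e(x_e)$ and $Z(G)=\sum_{x\in\chi^N}\lambda^{H(x)}$ with $\lambda^{-\infty}=0$. Models: Independent set ($K=2,q=2$, $H_i(1)=1,H_i(0)=0$, $H_e(1,1)=-\infty$, else $0$); MAX-CUT ($K=2,q=2$, $H_i\equiv0$, $H_e(x,y)=\mathbf 1[x\ne y]$); anti-ferromagnetic Ising ($K=2,q=2$, fixed $\beta>0,B\in\mathbb{R}$, $H_i(0)=-B,H_i(1)=B$, $H_e(x,y)=-\beta$ if $x=y$, $\beta$ otherwise); $q$-Coloring ($K=2$, $H_i\equiv0$, $H_e(x,y)=\mathbf 1[x\ne y]$); K-SAT ($q=2$,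 $H_i\equiv0$, independent uniform $a_e\in\{0,1\}^K$, $H_e(a_e)=0$, $1$ otherwise); NAE-K-SAT ($H_e(a_e)=H_e(\mathbf1-a_e)=0$, $1$ otherwise). *)

theory Defs
  imports "HOL-Probability.Probability" "HOL-Combinatorics.Multiset_Permutations"
begin

datatype model = IndSet | MaxCut | Ising real real | Coloring nat | KSAT nat | NAEKSAT nat

fun valid_model :: "model \<Rightarrow> bool" where
  "valid_model (Ising \<beta> B) = (\<beta> > 0)"
| "valid_model (Coloring q) = (q \<ge> 2)"
| "valid_model (KSAT K) = (K \<ge> 2)"
| "valid_model (NAEKSAT K) = (K \<ge> 2)"
| "valid_model _ = True"

fun arity :: "model \<Rightarrow> nat" where
  "arity (KSAT K) = K"
| "arity (NAEKSAT K) = K"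
| "arity _ = 2"

fun alphabet :: "model \<Rightarrow> nat" where
  "alphabet (Coloring q) = q"
| "alphabet _ = 2"

fun node_pot :: "model \<Rightarrow> nat \<Rightarrow> real" where
  "node_pot IndSet x = (if x = 1 then 1 else 0)"
| "node_pot (Ising \<beta> B) x = (if x = 0 then - B else B)"
| "node_pot _ x = 0"

text \<open>Edge potential H_e, given the edge label a (only used by K-SAT / NAE-K-SAT)
  and the values of the configuration on the (ordered) hyperedge.\<close>
fun edge_pot :: "model \<Rightarrow> nat list \<Rightarrow> nat list \<Rightarrow> ereal" where
  "edge_pot IndSet a xs = (if xs ! 0 = 1 \<and> xs ! 1 = 1 then - \<infinity> else 0)"
| "edge_pot MaxCut a xs = (if xs ! 0 \<noteq> xs ! 1 then 1 else 0)"
| "edge_pot (Ising \<beta> B) a xs = (if xs ! 0 = xs ! 1 then ereal (- \<beta>) else ereal \<beta>)"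
| "edge_pot (Coloring q) a xs = (if xs ! 0 \<noteq> xs ! 1 then 1 else 0)"
| "edge_pot (KSAT K) a xs = (if xs = a then 0 else 1)"
| "edge_pot (NAEKSAT K) a xs = (if xs = a \<or> xs = map (\<lambda>t. 1 - t) a then 0 else 1)"

definition hamiltonian :: "model \<Rightarrow> nat \<Rightarrow> nat list list \<Rightarrow> nat list list \<Rightarrow> (nat \<Rightarrow> nat) \<Rightarrow> ereal" where
  "hamiltonian m N es as x =
     (\<Sum>i<N. ereal (node_pot m (x i))) + (\<Sum>j<length es. edge_pot m (as ! j) (map x (es ! j)))"

definition lam_pow :: "real \<Rightarrow> ereal \<Rightarrow> real" where
  "lam_pow lam h = (if h = - \<infinity> then 0 else lam powr real_of_ereal h)"

definition partition_fn :: "model \<Rightarrow> real \<Rightarrow> nat \<Rightarrow> nat list list \<Rightarrow> nat list list \<Rightarrow> real" where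
  "partition_fn m lam N es as =
     (\<Sum>x\<in>PiE {..<N} (\<lambda>_. {..<alphabet m}). lam_pow lam (hamiltonian m N es as x))"

text \<open>Configuration model: point p in {0..<N*r} belongs to node p div r. A uniformly random
  ordering of the points, cut into consecutive blocks of size K, gives a uniformly random
  partition into blocks of size K; each block is projected to the (ordered) list of owners.\<close>
definition config_edges :: "nat \<Rightarrow> nat \<Rightarrow> nat \<Rightarrow> nat list \<Rightarrow> nat list list" where
  "config_edges K N r \<sigma> =
     map (\<lambda>j. map (\<lambda>p. p div r) (take K (drop (j * K) \<sigma>))) [0..<N * r div K]"

definition label_set :: "nat \<Rightarrow> nat \<Rightarrow> nat list list set" where
  "label_set K M = {as. length as = M \<and> (\<forall>a\<in>set as. length a = K \<and> set a \<subseteq> {0, 1})}"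

definition random_instance :: "model \<Rightarrow> nat \<Rightarrow> nat \<Rightarrow> (nat list list \<times> nat list list) pmf" where
  "random_instance m N r =
     do {
       \<sigma> \<leftarrow> pmf_of_set (permutations_of_set {0..<N * r});
       as \<leftarrow> pmf_of_set (label_set (arity m) (N * r div arity m));
       return_pmf (config_edges (arity m) N r \<sigma>, as)
     }"

end

theory Submission
  imports Defs
begin

text \<open>
  All six models have edge factors \<open>\<alpha> (1 - c J)\<close>, where \<open>J \<in> {0, 1}\<close> is a sum of products over the
  slots of the edge. Averaging \<open>ln (1 - c \<langle>J\<rangle>)\<close> over independently chosen endpoints and expanding the
  logarithm gives minus a nonnegative combination of \<open>K\<close>-th powers of averages over the available points.
  By convexity of the power, replacing an edge on the whole node set by an edge inside
  one of two parts, the part being chosen with the same weights, can only decrease the expected logarithm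
  of the partition function.

  In the configuration model the points are drawn without replacement, so the interpolation is carried
  out on the types (parts) of the slots: the types come from a uniformly random placement, the edges are
  turned one by one into edges all of whose slots copy the type of the first one, and the points are
  placed uniformly given the types. A reserve of about \<open>N powr (3 / 4)\<close> points stays unmatched, which
  makes the difference between sampling with and without replacement negligible, and by
  concentration neither part runs out of points. The mean of the logarithm is therefore superadditive up to
  \<open>O (N powr (3 / 4))\<close> for parts of comparable size, so it has a limit after division by \<open>N\<close>, and a
  bounded difference inequality transfers the limit to the logarithm itself.
\<close>

section \<open>Uniform averages and random placements\<close>

text \<open>The configuration model uses up every point, so an edge cannot be rewired in isolation:
  its pool depends on all other edges. The reserve must lie well above the square root of N, the
  scale on which the type counts fluctuate, yet below order N, because each edge given up costs a
  constant; 3/4 is a convenient exponent between 1/2 and 1. Two placements occur in each step: one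
  is read only for its types, the other supplies the points given these types. Each is compared with
  independent draws separately, and the weights with which types are drawn may differ from the
  numbers of points left. Comparable parts (factor 2) serve twice. A part that is too small could
  not spare its share of the reserve. And on balanced splits the strict concavity of
  \<open>N powr (3 / 4)\<close> lets a correction term absorb the error, so that approximate
  superadditivity becomes exact; Fekete's argument then runs by repeated halving, which keeps all
  splits balanced. Labels are drawn together with the points, so the literals of K-SAT fit into the
  same product over slots as the spins of the graph models.\<close>

definition avg :: "'a set \<Rightarrow> ('a \<Rightarrow> real) \<Rightarrow> real" where
  "avg A f = (\<Sum>a\<in>A. f a) / real (card A)"

lemma avg_cong: "A = B \<Longrightarrow> (\<And>a. a \<in> B \<Longrightarrow> f a = g a) \<Longrightarrow> avg A f = avg B g"
  unfolding avg_def by (auto intro: arg_cong2[where f = "(/)"] sum.cong)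

lemma avg_mono: "(\<And>a. a \<in> A \<Longrightarrow> f a \<le> g a) \<Longrightarrow> avg A f \<le> avg A g"
  unfolding avg_def by (intro divide_right_mono sum_mono) auto

lemma avg_const: "finite A \<Longrightarrow> A \<noteq> {} \<Longrightarrow> avg A (\<lambda>_. c) = c"
  unfolding avg_def by simp

lemma avg_zero [simp]: "avg A (\<lambda>_. 0) = 0"
  unfolding avg_def by simp

lemma avg_singleton [simp]: "avg {a} f = f a"
  unfolding avg_def by simp

lemma avg_add: "avg A (\<lambda>a. f a + g a) = avg A f + avg A g"
  unfolding avg_def by (simp add: sum.distrib add_divide_distrib)

lemma avg_diff: "avg A (\<lambda>a. f a - g a) = avg A f - avg A g"
  unfolding avg_def by (simp add: sum_subtractf diff_divide_distrib)

lemma avg_uminus: "avg A (\<lambda>a. - f a) = - avg A f"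
  unfolding avg_def by (simp add: sum_negf)

lemma avg_mult_left: "avg A (\<lambda>a. c * f a) = c * avg A f"
  unfolding avg_def by (simp add: sum_distrib_left)

lemma avg_sum: "avg A (\<lambda>a. \<Sum>i\<in>I. f i a) = (\<Sum>i\<in>I. avg A (f i))"
  unfolding avg_def by (subst sum.swap) (simp add: sum_divide_distrib)

lemma avg_nonneg: "(\<And>a. a \<in> A \<Longrightarrow> f a \<ge> 0) \<Longrightarrow> avg A f \<ge> 0"
  unfolding avg_def by (intro divide_nonneg_nonneg sum_nonneg) auto

text \<open>On an empty or infinite set the average is 0, since \<open>x / 0 = 0\<close>; there the
  bound comes from \<open>0 \<le> c\<close>.\<close>

lemma abs_avg_le:
  assumes "\<And>a. a \<in> A \<Longrightarrow> \<bar>f a\<bar> \<le> c" "0 \<le> c"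
  shows "\<bar>avg A f\<bar> \<le> c"
proof (cases "card A = 0")
  case True
  then show ?thesis using assms by (simp add: avg_def)
next
  case False
  have "\<bar>\<Sum>a\<in>A. f a\<bar> \<le> (\<Sum>a\<in>A. c)"
    using assms by (intro order_trans[OF sum_abs] sum_mono) auto
  then show ?thesis using False by (simp add: avg_def field_simps)
qed

lemma abs_avg_diff_le:
  assumes "\<And>a. a \<in> A \<Longrightarrow> \<bar>f a - g a\<bar> \<le> c" "0 \<le> c"
  shows "\<bar>avg A f - avg A g\<bar> \<le> c"
  using abs_avg_le[of A "\<lambda>a. f a - g a" c] assms by (simp add: avg_diff)

lemma avg_swap: "avg A (\<lambda>a. avg B (f a)) = avg B (\<lambda>b. avg A (\<lambda>a. f a b))"
  unfolding avg_def by (simp add: sum_divide_distrib[symmetric] sum.swap[of _ A B] mult.commute)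

lemma avg_reindex: "bij_betw h A B \<Longrightarrow> avg B f = avg A (\<lambda>a. f (h a))"
  unfolding avg_def by (simp add: sum.reindex_bij_betw bij_betw_same_card)

lemma avg_tendsto:
  "(\<And>a. a \<in> A \<Longrightarrow> (\<lambda>n. f n a) \<longlonglongrightarrow> g a) \<Longrightarrow> (\<lambda>n. avg A (f n)) \<longlonglongrightarrow> avg A g"
  unfolding avg_def divide_inverse by (intro tendsto_mult tendsto_sum tendsto_const)

lemma avg_Sigma:
  assumes "finite A" "\<And>a. a \<in> A \<Longrightarrow> finite (B a)" "\<And>a. a \<in> A \<Longrightarrow> card (B a) = k"
  shows "avg (Sigma A B) f = avg A (\<lambda>a. avg (B a) (\<lambda>b. f (a, b)))"
proof -
  have "(\<Sum>p\<in>Sigma A B. f p) = (\<Sum>a\<in>A. \<Sum>b\<in>B a. f (a, b))"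
    using assms by (subst sum.Sigma) auto
  moreover have "card (Sigma A B) = card A * k"
    using assms by (subst card_SigmaI) auto
  moreover have "avg A (\<lambda>a. avg (B a) (\<lambda>b. f (a, b))) = (\<Sum>a\<in>A. (\<Sum>b\<in>B a. f (a, b)) / k) / card A"
    unfolding avg_def using assms by (intro arg_cong2[where f = "(/)"] sum.cong) auto
  ultimately show ?thesis
    by (simp add: avg_def sum_divide_distrib[symmetric] mult.commute)
qed

text \<open>Centre \<open>h\<close> at its average over \<open>U - F\<close>: the terms in
  \<open>U - F\<close> cancel, and each of the at most \<open>k\<close> remaining ones is bounded by
  \<open>D\<close>.\<close>

lemma avg_Diff_le:
  assumes U: "finite U" "U - F \<noteq> {}" and "card (U \<inter> F) \<le> k"
    and osc: "\<And>y y'. y \<in> U \<Longrightarrow> y' \<in> U \<Longrightarrow> \<bar>h y - h y'\<bar> \<le> D"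
  shows "\<bar>avg (U - F) h - avg U h\<bar> \<le> D * k / card U"
proof -
  let ?h0 = "avg (U - F) h"
  have cU: "card U > 0" "card (U - F) > 0" using U by (auto simp: card_gt_0_iff)
  have D: "\<bar>h y - ?h0\<bar> \<le> D" if "y \<in> U" for y
  proof -
    have D0: "0 \<le> D" using osc[OF that that] by simp
    have "\<bar>avg (U - F) (\<lambda>_. h y) - ?h0\<bar> \<le> D"
      by (rule abs_avg_diff_le) (use osc[OF that] D0 in auto)
    then show ?thesis using U by (simp add: avg_const)
  qed
  have D0: "0 \<le> D" using U(2) osc by fastforce
  have "(\<Sum>y\<in>U. h y - ?h0) = (\<Sum>y\<in>U - F. h y - ?h0) + (\<Sum>y\<in>U \<inter> F. h y - ?h0)"
    using U by (subst sum.union_disjoint[symmetric]) (auto intro!: sum.cong)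
  also have "(\<Sum>y\<in>U - F. h y - ?h0) = 0"
    using cU by (simp add: sum_subtractf avg_def)
  finally have "\<bar>\<Sum>y\<in>U. h y - ?h0\<bar> \<le> (\<Sum>y\<in>U \<inter> F. \<bar>h y - ?h0\<bar>)" by simp
  also have "\<dots> \<le> (\<Sum>y\<in>U \<inter> F. D)" by (intro sum_mono D) auto
  also have "\<dots> \<le> D * k" using assms D0 by (simp add: mult.commute mult_left_mono)
  finally have "\<bar>(\<Sum>y\<in>U. h y) - card U * ?h0\<bar> \<le> D * k" by (simp add: sum_subtractf)
  moreover have "avg U h - ?h0 = ((\<Sum>y\<in>U. h y) - card U * ?h0) / card U"
    using cU by (simp add: avg_def[of U] field_simps)
  ultimately show ?thesis using cU by (simp add: abs_minus_commute[of "avg (U - F) h"] divide_right_mono)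
qed

text \<open>Law of total expectation: resampling \<open>a\<close> uniformly within its class
  preserves the uniform law. Each \<open>b\<close> is counted once per member of its class, with
  weight one over the class size.\<close>

lemma avg_class:
  assumes "finite X"
  shows "avg X (\<lambda>a. avg {b \<in> X. k b = k a} f) = avg X f"
proof -
  have "(\<Sum>a\<in>X. avg {b \<in> X. k b = k a} f) = (\<Sum>a\<in>X. \<Sum>b\<in>X. if k b = k a then f b / card {b \<in> X. k b = k a} else 0)"
    unfolding avg_def sum_divide_distrib by (intro sum.cong refl sum.inter_filter assms)
  also have "\<dots> = (\<Sum>b\<in>X. \<Sum>a\<in>X. if k a = k b then f b / card {a \<in> X. k a = k b} else 0)"
    by (subst sum.swap) (intro sum.cong, auto)
  also have "\<dots> = (\<Sum>b\<in>X. \<Sum>a\<in>{a \<in> X. k a = k b}. f b / card {a \<in> X. k a = k b})"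
    by (intro sum.cong refl sum.inter_filter[symmetric] assms)
  also have "\<dots> = (\<Sum>b\<in>X. f b)"
  proof (intro sum.cong refl)
    fix b assume "b \<in> X"
    then have "card {a \<in> X. k a = k b} > 0" using assms by (auto simp: card_gt_0_iff)
    then show "(\<Sum>a\<in>{a \<in> X. k a = k b}. f b / card {a \<in> X. k a = k b}) = f b" by simp
  qed
  finally show ?thesis by (simp add: avg_def)
qed

lemma avg_PiE_insert:
  assumes "finite B" "b \<notin> B" "\<And>x. x \<in> insert b B \<Longrightarrow> finite (C x)"
  shows "avg (PiE (insert b B) C) f = avg (PiE B C) (\<lambda>y. avg (C b) (\<lambda>w. f (y(b := w))))"
proof -
  have "bij_betw (\<lambda>(y, w). y(b := w)) (PiE B C \<times> C b) (PiE (insert b B) C)"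
  proof (rule bij_betw_byWitness[where f' = "\<lambda>g. (g(b := undefined), g b)"])
    show "\<forall>a\<in>PiE B C \<times> C b. (\<lambda>g. (g(b := undefined), g b)) (case a of (y, w) \<Rightarrow> y(b := w)) = a"
      using assms(2) by (auto simp: fun_eq_iff PiE_def extensional_def)
    show "(\<lambda>g. (g(b := undefined), g b)) ` PiE (insert b B) C \<subseteq> PiE B C \<times> C b"
      using assms(2) by (auto intro: fun_upd_in_PiE)
    show "(\<lambda>(y, w). y(b := w)) ` (PiE B C \<times> C b) \<subseteq> PiE (insert b B) C"
      by (rule image_subsetI) (clarsimp simp del: PiE_iff intro!: PiE_fun_upd)
  qed auto
  then have "avg (PiE (insert b B) C) f = avg (PiE B C \<times> C b) (\<lambda>p. f (case p of (y, w) \<Rightarrow> y(b := w)))"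
    by (rule avg_reindex)
  also have "\<dots> = avg (PiE B C) (\<lambda>y. avg (C b) (\<lambda>w. f (y(b := w))))"
    using assms by (subst avg_Sigma[where k = "card (C b)"]) (auto intro: finite_PiE)
  finally show ?thesis .
qed

lemma avg_PiE_prod:
  assumes "finite B" "\<And>b. b \<in> B \<Longrightarrow> finite (C b)"
  shows "avg (PiE B C) (\<lambda>y. \<Prod>b\<in>B. g b (y b)) = (\<Prod>b\<in>B. avg (C b) (g b))"
  using assms by (simp add: avg_def card_PiE prod_dividef prod_sum_PiE)

lemma avg_PiE_component:
  assumes "finite B" "b \<in> B" "\<And>b. b \<in> B \<Longrightarrow> finite (C b)" "\<And>b. b \<in> B \<Longrightarrow> C b \<noteq> {}"
  shows "avg (PiE B C) (\<lambda>y. g (y b)) = avg (C b) g"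
proof -
  have "avg (PiE (insert b (B - {b})) C) (\<lambda>y. g (y b)) = avg (PiE (B - {b}) C) (\<lambda>y. avg (C b) g)"
    using assms by (subst avg_PiE_insert) auto
  also have "\<dots> = avg (C b) g"
    using assms by (intro avg_const finite_PiE) (auto simp: PiE_eq_empty_iff)
  finally show ?thesis using assms(2) by (simp add: insert_absorb)
qed

lemma power_avg_le:
  assumes "finite A" "A \<noteq> {}" "\<And>a. a \<in> A \<Longrightarrow> h a \<ge> 0"
  shows "avg A h ^ k \<le> avg A (\<lambda>a. h a ^ k)"
proof -
  have "convex_on {0::real..} (\<lambda>x. x ^ k)"
    by (cases "even k") (auto intro: convex_power_odd convex_on_subset[OF convex_power_even])
  from convex_on_sum[OF assms(1,2) this, of "\<lambda>_. 1 / card A" h] assms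
  show ?thesis by (simp add: avg_def sum_divide_distrib)
qed


text \<open>Each slot receives a point and a label; only the points have to be pairwise distinct.\<close>

definition cfg :: "'s set \<Rightarrow> ('s \<Rightarrow> 'p set) \<Rightarrow> ('s \<Rightarrow> 'p \<times> nat) set" where
  "cfg S B = {\<phi> \<in> PiE S (\<lambda>s. B s \<times> {0, 1}). inj_on (\<lambda>s. fst (\<phi> s)) S}"

abbreviation used :: "('s \<Rightarrow> 'p \<times> nat) \<Rightarrow> 's set \<Rightarrow> 'p set" where
  "used \<phi> S \<equiv> (\<lambda>s. fst (\<phi> s)) ` S"

text \<open>With pools equal or disjoint, the number of points left in a pool depends only on how
  many slots share it and not on the placement. This makes slot-by-slot sampling uniform.\<close>

definition tame :: "'s set \<Rightarrow> ('s \<Rightarrow> 'p set) \<Rightarrow> bool" where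
  "tame S B \<longleftrightarrow> (\<forall>s\<in>S. finite (B s)) \<and> (\<forall>s\<in>S. \<forall>t\<in>S. B s = B t \<or> B s \<inter> B t = {})"

lemma tame_subset: "tame S B \<Longrightarrow> S' \<subseteq> S \<Longrightarrow> tame S' B"
  unfolding tame_def by blast

lemma tame_const: "finite P \<Longrightarrow> tame S (\<lambda>_. P)"
  unfolding tame_def by blast

lemma finite_cfg: "finite S \<Longrightarrow> (\<And>s. s \<in> S \<Longrightarrow> finite (B s)) \<Longrightarrow> finite (cfg S B)"
  unfolding cfg_def by (rule finite_subset[OF _ finite_PiE[of S "\<lambda>s. B s \<times> {0, 1}"]]) auto

lemma finite_cfg_tame: "finite S \<Longrightarrow> tame S B \<Longrightarrow> finite (cfg S B)"
  by (rule finite_cfg) (auto simp: tame_def)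

lemma cfg_cong: "S = S' \<Longrightarrow> (\<And>s. s \<in> S' \<Longrightarrow> B s = B' s) \<Longrightarrow> cfg S B = cfg S' B'"
  unfolding cfg_def by (metis (no_types, lifting) PiE_cong)

lemma cfg_fst: "\<phi> \<in> cfg S B \<Longrightarrow> s \<in> S \<Longrightarrow> fst (\<phi> s) \<in> B s"
  unfolding cfg_def by (auto dest!: PiE_mem)

lemma cfg_snd: "\<phi> \<in> cfg S B \<Longrightarrow> s \<in> S \<Longrightarrow> snd (\<phi> s) \<in> {0, 1}"
  unfolding cfg_def by (auto dest!: PiE_mem)

lemma cfg_PiE: "\<phi> \<in> cfg S B \<Longrightarrow> \<phi> \<in> PiE S (\<lambda>s. B s \<times> {0, 1})"
  unfolding cfg_def by auto

lemma cfg_inj: "\<phi> \<in> cfg S B \<Longrightarrow> inj_on (\<lambda>s. fst (\<phi> s)) S"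
  unfolding cfg_def by auto

lemma cfg_empty [simp]: "cfg {} B = {\<lambda>_. undefined}"
  unfolding cfg_def by auto

lemma card_unused:
  assumes "finite S" "b \<notin> S" "tame (insert b S) B" "\<phi> \<in> cfg S B"
  shows "card (B b - used \<phi> S) = card (B b) - card {s \<in> S. B s = B b}"
proof -
  have "B b \<inter> used \<phi> S = used \<phi> {s \<in> S. B s = B b}"
  proof (intro equalityI subsetI)
    fix p assume "p \<in> B b \<inter> used \<phi> S"
    then obtain s where s: "s \<in> S" "p = fst (\<phi> s)" "p \<in> B b" by auto
    then have "B s \<inter> B b \<noteq> {}" using cfg_fst[OF assms(4) s(1)] by auto
    then have "B s = B b" using assms(3) s(1) unfolding tame_def by (metis insertCI)
    then show "p \<in> used \<phi> {s \<in> S. B s = B b}" using s by auto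
  next
    fix p assume "p \<in> used \<phi> {s \<in> S. B s = B b}"
    then show "p \<in> B b \<inter> used \<phi> S" using cfg_fst[OF assms(4)] by auto
  qed
  moreover have "card (used \<phi> {s \<in> S. B s = B b}) = card {s \<in> S. B s = B b}"
    by (rule card_image) (rule inj_on_subset[OF cfg_inj[OF assms(4)]], auto)
  ultimately show ?thesis
    using assms(1,3) by (subst card_Diff_subset_Int) (simp_all add: tame_def)
qed

lemma cfg_insert_bij:
  assumes "b \<notin> S"
  shows "bij_betw (\<lambda>(\<phi>, y). \<phi>(b := y)) (Sigma (cfg S B) (\<lambda>\<phi>. (B b - used \<phi> S) \<times> {0, 1})) (cfg (insert b S) B)"
proof (rule bij_betw_byWitness[where f' = "\<lambda>g. (g(b := undefined), g b)"])
  let ?A = "Sigma (cfg S B) (\<lambda>\<phi>. (B b - used \<phi> S) \<times> {0, 1 :: nat})"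
  show "\<forall>a\<in>?A. (\<lambda>g. (g(b := undefined), g b)) (case a of (\<phi>, y) \<Rightarrow> \<phi>(b := y)) = a"
    using assms by (auto simp: fun_eq_iff cfg_def PiE_def extensional_def)
  show "\<forall>g\<in>cfg (insert b S) B. (case (g(b := undefined), g b) of (\<phi>, y) \<Rightarrow> \<phi>(b := y)) = g"
    by auto
  show "(\<lambda>(\<phi>, y). \<phi>(b := y)) ` ?A \<subseteq> cfg (insert b S) B"
  proof (rule image_subsetI)
    fix a assume "a \<in> ?A"
    then obtain \<phi> p and l :: nat where a: "a = (\<phi>, (p, l))"
      and *: "\<phi> \<in> cfg S B" "(p, l) \<in> (B b - used \<phi> S) \<times> {0, 1}" by auto
    have "inj_on (\<lambda>s. fst ((\<phi>(b := (p, l))) s)) (insert b S)"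
      using * assms cfg_inj[OF *(1)] by (auto simp: inj_on_def)
    moreover have "\<phi>(b := (p, l)) \<in> PiE (insert b S) (\<lambda>s. B s \<times> {0, 1})"
      by (rule PiE_fun_upd) (use * in \<open>auto simp: cfg_def\<close>)
    ultimately show "(case a of (\<phi>, y) \<Rightarrow> \<phi>(b := y)) \<in> cfg (insert b S) B"
      unfolding cfg_def a by simp
  qed
  show "(\<lambda>g. (g(b := undefined), g b)) ` cfg (insert b S) B \<subseteq> ?A"
  proof (rule image_subsetI)
    fix g assume g: "g \<in> cfg (insert b S) B"
    have "g(b := undefined) \<in> PiE S (\<lambda>s. B s \<times> {0, 1})"
      using assms g by (intro fun_upd_in_PiE) (auto simp: cfg_def)
    moreover have inj: "inj_on (\<lambda>s. fst (g s)) (insert b S)" using g by (rule cfg_inj)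
    then have "inj_on (\<lambda>s. fst ((g(b := undefined)) s)) S"
      using assms by (auto simp: inj_on_def)
    moreover have "used (g(b := undefined)) S = used g S" using assms by auto
    moreover have "fst (g b) \<notin> used g S" using inj assms by (auto simp: inj_on_def)
    ultimately show "(g(b := undefined), g b) \<in> ?A"
      using cfg_fst[OF g, of b] cfg_snd[OF g, of b] by (auto simp: cfg_def mem_Times_iff)
  qed
qed

lemma avg_cfg_insert:
  assumes "finite S" "b \<notin> S" "tame (insert b S) B"
  shows "avg (cfg (insert b S) B) f =
    avg (cfg S B) (\<lambda>\<phi>. avg ((B b - used \<phi> S) \<times> {0, 1}) (\<lambda>y. f (\<phi>(b := y))))"
proof -
  have "avg (cfg (insert b S) B) f = avg (Sigma (cfg S B) (\<lambda>\<phi>. (B b - used \<phi> S) \<times> {0, 1}))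
      (\<lambda>p. f (case p of (\<phi>, y) \<Rightarrow> \<phi>(b := y)))"
    by (rule avg_reindex) (rule cfg_insert_bij[OF assms(2)])
  also have "\<dots> = avg (cfg S B) (\<lambda>\<phi>. avg ((B b - used \<phi> S) \<times> {0, 1}) (\<lambda>y. f (\<phi>(b := y))))"
  proof (subst avg_Sigma[where k = "(card (B b) - card {s \<in> S. B s = B b}) * 2"])
    show "finite (cfg S B)" using assms by (auto intro: finite_cfg_tame tame_subset)
    show "finite ((B b - used \<phi> S) \<times> {0::nat, 1})" for \<phi> using assms by (auto simp: tame_def)
    show "card ((B b - used \<phi> S) \<times> {0::nat, 1}) = (card (B b) - card {s \<in> S. B s = B b}) * 2"
      if "\<phi> \<in> cfg S B" for \<phi>
      using card_unused[OF assms that] by (simp add: card_cartesian_product)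
  qed simp
  finally show ?thesis .
qed

definition feasible :: "'s set \<Rightarrow> ('s \<Rightarrow> 'p set) \<Rightarrow> bool" where
  "feasible S B \<longleftrightarrow> (\<forall>b\<in>S. card {s \<in> S. B s = B b} \<le> card (B b))"

lemma feasible_subset: "feasible S B \<Longrightarrow> S' \<subseteq> S \<Longrightarrow> finite S \<Longrightarrow> feasible S' B"
  unfolding feasible_def
proof (intro ballI)
  fix b assume *: "\<forall>b\<in>S. card {s \<in> S. B s = B b} \<le> card (B b)" "S' \<subseteq> S" "finite S" "b \<in> S'"
  have "card {s \<in> S'. B s = B b} \<le> card {s \<in> S. B s = B b}" using * by (intro card_mono) auto
  then show "card {s \<in> S'. B s = B b} \<le> card (B b)" using * by (meson order_trans subsetD)
qed

lemma feasible_const: "card S \<le> card P \<Longrightarrow> feasible S (\<lambda>_. P)"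
  unfolding feasible_def by auto

lemma unused_nonempty:
  assumes "finite S" "b \<notin> S" "tame (insert b S) B" "feasible (insert b S) B" "\<phi> \<in> cfg S B"
  shows "B b - used \<phi> S \<noteq> {}"
proof -
  have "{s \<in> insert b S. B s = B b} = insert b {s \<in> S. B s = B b}" by auto
  then have "Suc (card {s \<in> S. B s = B b}) \<le> card (B b)"
    using assms(1,2,4) unfolding feasible_def by (auto dest!: bspec[of _ _ b])
  then have "card (B b - used \<phi> S) > 0" using card_unused[OF assms(1,2,3,5)] by linarith
  then show ?thesis by (metis card.empty less_irrefl)
qed

lemma cfg_nonempty:
  assumes "finite S" "tame S B" "feasible S B"
  shows "cfg S B \<noteq> {}"
  using assms
proof (induction S rule: finite_induct)
  case empty
  then show ?case by simp
next
  case (insert b S)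
  have "tame S B" "feasible S B"
    using insert.prems insert.hyps by (auto intro: tame_subset feasible_subset)
  then obtain \<phi> where \<phi>: "\<phi> \<in> cfg S B" using insert.IH by blast
  obtain p where "p \<in> B b - used \<phi> S"
    using unused_nonempty[OF insert.hyps insert.prems \<phi>] by blast
  then have "(\<phi>, (p, 0)) \<in> Sigma (cfg S B) (\<lambda>\<phi>. (B b - used \<phi> S) \<times> {0, 1})" using \<phi> by auto
  then show ?case using cfg_insert_bij[OF insert.hyps(2), of B] bij_betwE by blast
qed

text \<open>The slots outside \<open>S0\<close> are peeled off one at a time. Given the others, each
  contributes the average of a constant, and feasibility makes that average run over a nonempty
  set.\<close>

lemma avg_cfg_marginal:
  assumes "finite S" "S0 \<subseteq> S" "tame S B" "feasible S B"
    and "\<And>\<phi> \<phi>'. (\<And>s. s \<in> S0 \<Longrightarrow> \<phi> s = \<phi>' s) \<Longrightarrow> f \<phi> = f \<phi>'"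
  shows "avg (cfg S B) f = avg (cfg S0 B) f"
proof -
  have "finite E \<Longrightarrow> S0 \<inter> E = {} \<Longrightarrow> tame (S0 \<union> E) B \<Longrightarrow> feasible (S0 \<union> E) B \<Longrightarrow>
      avg (cfg (S0 \<union> E) B) f = avg (cfg S0 B) f" for E
  proof (induction E rule: finite_induct)
    case empty
    then show ?case by simp
  next
    case (insert b E)
    have fin: "finite (S0 \<union> E)" using insert assms finite_subset by blast
    have b: "b \<notin> S0 \<union> E" using insert by auto
    have eq: "S0 \<union> insert b E = insert b (S0 \<union> E)" by auto
    note t = insert.prems(2)[unfolded eq] and fe = insert.prems(3)[unfolded eq]
    have "avg (cfg (S0 \<union> insert b E) B) f = avg (cfg (S0 \<union> E) B)
        (\<lambda>\<phi>. avg ((B b - used \<phi> (S0 \<union> E)) \<times> {0, 1}) (\<lambda>y. f (\<phi>(b := y))))"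
      unfolding eq by (rule avg_cfg_insert[OF fin b t])
    also have "\<dots> = avg (cfg (S0 \<union> E) B) f"
    proof (rule avg_cong[OF refl])
      fix \<phi> assume "\<phi> \<in> cfg (S0 \<union> E) B"
      then have ne: "B b - used \<phi> (S0 \<union> E) \<noteq> {}" by (rule unused_nonempty[OF fin b t fe])
      have "avg ((B b - used \<phi> (S0 \<union> E)) \<times> {0, 1}) (\<lambda>y. f (\<phi>(b := y))) =
          avg ((B b - used \<phi> (S0 \<union> E)) \<times> {0::nat, 1}) (\<lambda>y. f \<phi>)"
        by (intro avg_cong refl assms(5)) (use b in auto)
      also have "\<dots> = f \<phi>" using ne t by (intro avg_const) (auto simp: tame_def)
      finally show "avg ((B b - used \<phi> (S0 \<union> E)) \<times> {0, 1}) (\<lambda>y. f (\<phi>(b := y))) = f \<phi>" .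
    qed
    also have "\<dots> = avg (cfg S0 B) f"
      using insert eq by (intro insert.IH) (auto intro: tame_subset feasible_subset[OF _ _ finite.insertI[OF fin]])
    finally show ?case .
  qed
  from this[of "S - S0"] show ?thesis
    using assms by (simp add: Un_absorb1)
qed

section \<open>Sampling without replacement against independent sampling\<close>

definition overwrite :: "'s set \<Rightarrow> ('s \<Rightarrow> 'v) \<Rightarrow> ('s \<Rightarrow> 'v) \<Rightarrow> 's \<Rightarrow> 'v" where
  "overwrite E \<phi> y = (\<lambda>s. if s \<in> E then y s else \<phi> s)"

lemma overwrite_in_PiE:
  "\<phi> \<in> PiE S C \<Longrightarrow> y \<in> PiE E C' \<Longrightarrow> (\<And>s. s \<in> E \<Longrightarrow> C' s \<subseteq> C s) \<Longrightarrow> overwrite E \<phi> y \<in> PiE (S \<union> E) C"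
  unfolding overwrite_def PiE_def extensional_def Pi_def by simp blast

text \<open>The slots of \<open>E\<close> may be drawn independently from the points that
  \<open>S\<close> leaves free. For one slot, the constraint excludes at most \<open>card E\<close>
  of at least \<open>z\<close> points, which by \<open>avg_Diff_le\<close> changes the mean by at
  most \<open>D * card E / z\<close>; these errors add up over \<open>E\<close>.\<close>

lemma avg_cfg_replacement:
  fixes f :: "('s \<Rightarrow> 'p \<times> nat) \<Rightarrow> real" and z :: nat
  assumes "finite E" "finite S" "S \<inter> E = {}" "tame (S \<union> E) B"
    and z: "\<And>b. b \<in> E \<Longrightarrow> card {s \<in> S. B s = B b} + z \<le> card (B b)" "card E \<le> z" "0 < z"
    and osc: "\<And>\<phi> \<phi>'. \<phi> \<in> PiE (S \<union> E) (\<lambda>s. B s \<times> {0, 1}) \<Longrightarrow> \<phi>' \<in> PiE (S \<union> E) (\<lambda>s. B s \<times> {0, 1}) \<Longrightarrow>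
        (\<And>s. s \<notin> E \<Longrightarrow> \<phi> s = \<phi>' s) \<Longrightarrow> \<bar>f \<phi> - f \<phi>'\<bar> \<le> D" "0 \<le> D"
  shows "\<bar>avg (cfg (S \<union> E) B) f - avg (cfg S B) (\<lambda>\<phi>. avg (PiE E (\<lambda>b. (B b - used \<phi> S) \<times> {0, 1}))
      (\<lambda>y. f (overwrite E \<phi> y)))\<bar> \<le> D * (real (card E))\<^sup>2 / z"
  using assms
proof (induction E arbitrary: f rule: finite_induct)
  case empty
  then show ?case by (simp add: overwrite_def)
next
  case (insert b E)
  let ?L = "{0, 1 :: nat}"
  let ?f = "\<lambda>\<phi>. avg ((B b - used \<phi> S) \<times> ?L) (\<lambda>y. f (\<phi>(b := y)))"
  let ?g = "\<lambda>\<phi>. avg ((B b - used \<phi> (S \<union> E)) \<times> ?L) (\<lambda>y. f (\<phi>(b := y)))"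
  have eq: "S \<union> insert b E = insert b (S \<union> E)" by auto
  have fin: "finite (S \<union> E)" using insert by auto
  have b: "b \<notin> S \<union> E" "b \<notin> S" using insert by auto
  have t: "tame (insert b (S \<union> E)) B" "tame (insert b S) B"
    using insert.prems(3) by (auto intro: tame_subset)
  have 1: "avg (cfg (S \<union> insert b E) B) f = avg (cfg (S \<union> E) B) ?g"
    unfolding eq by (rule avg_cfg_insert[OF fin b(1) t(1)])
  have upd: "\<phi>(b := y) \<in> PiE (S \<union> insert b E) (\<lambda>s. B s \<times> ?L)"
    if "\<phi> \<in> PiE (S \<union> E) (\<lambda>s. B s \<times> ?L)" "y \<in> (B b - U) \<times> ?L" for \<phi> y U
    unfolding eq using that by (intro PiE_fun_upd) auto
  have osc': "\<bar>f \<phi> - f \<phi>'\<bar> \<le> D" if "\<phi> \<in> PiE (S \<union> insert b E) (\<lambda>s. B s \<times> ?L)"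
      "\<phi>' \<in> PiE (S \<union> insert b E) (\<lambda>s. B s \<times> ?L)" "\<And>s. s \<notin> insert b E \<Longrightarrow> \<phi> s = \<phi>' s" for \<phi> \<phi>'
    using insert.prems(7) that by blast
  have 2: "\<bar>avg (cfg (S \<union> E) B) ?g - avg (cfg (S \<union> E) B) ?f\<bar> \<le> D * card E / z"
  proof (rule abs_avg_diff_le)
    fix \<phi> assume \<phi>: "\<phi> \<in> cfg (S \<union> E) B"
    have "restrict \<phi> S \<in> cfg S B"
      using \<phi> unfolding cfg_def by (auto simp: inj_on_def)
    moreover have "used (restrict \<phi> S) S = used \<phi> S" by auto
    ultimately have "card (B b - used \<phi> S) = card (B b) - card {s \<in> S. B s = B b}"
      using card_unused[OF insert.prems(1) b(2) t(2), of "restrict \<phi> S"] by simp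
    then have cz: "z \<le> card (B b - used \<phi> S)" using insert.prems(4)[of b] by simp
    have cE: "card (used \<phi> E) \<le> card E" using insert.hyps(1) by (rule card_image_le)
    have finb: "finite (B b)" using t by (auto simp: tame_def)
    have "card E < z" using insert.prems(5) insert.hyps by simp
    then have "card (used \<phi> E) < card (B b - used \<phi> S)" using cz cE by linarith
    then have ne: "(B b - used \<phi> S) - used \<phi> E \<noteq> {}"
      using insert.hyps(1) finb by (metis card_mono Diff_eq_empty_iff finite_imageI not_le)
    have eqd: "(B b - used \<phi> (S \<union> E)) \<times> ?L = ((B b - used \<phi> S) \<times> ?L) - (used \<phi> E \<times> ?L)" by auto
    \<comment> \<open>The two labels double both the excluded set and the pool, so the factor 2
      cancels afterwards.\<close>
    have "\<bar>?g \<phi> - ?f \<phi>\<bar> \<le> D * (2 * card E) / card ((B b - used \<phi> S) \<times> ?L)"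
      unfolding eqd
    proof (rule avg_Diff_le)
      show "finite ((B b - used \<phi> S) \<times> ?L)" using finb by auto
      show "(B b - used \<phi> S) \<times> ?L - used \<phi> E \<times> ?L \<noteq> {}" using ne by auto
      have "card ((B b - used \<phi> S) \<times> ?L \<inter> used \<phi> E \<times> ?L) \<le> card (used \<phi> E \<times> ?L)"
        using insert.hyps(1) by (intro card_mono) auto
      also have "\<dots> \<le> 2 * card E" using cE by (simp add: card_cartesian_product)
      finally show "card ((B b - used \<phi> S) \<times> ?L \<inter> used \<phi> E \<times> ?L) \<le> 2 * card E" .
      show "\<bar>f (\<phi>(b := y)) - f (\<phi>(b := y'))\<bar> \<le> D"
        if "y \<in> (B b - used \<phi> S) \<times> ?L" "y' \<in> (B b - used \<phi> S) \<times> ?L" for y y'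
        using upd[OF cfg_PiE[OF \<phi>] that(1)] upd[OF cfg_PiE[OF \<phi>] that(2)] by (rule osc') auto
    qed
    also have "\<dots> = D * card E / card (B b - used \<phi> S)" by (simp add: card_cartesian_product)
    also have "\<dots> \<le> D * card E / z"
      using cz insert.prems(6,8) by (intro divide_left_mono mult_nonneg_nonneg) auto
    finally show "\<bar>?g \<phi> - ?f \<phi>\<bar> \<le> D * card E / z" .
  qed (use insert.prems in auto)
  have 3: "\<bar>avg (cfg (S \<union> E) B) ?f - avg (cfg S B) (\<lambda>\<phi>. avg (PiE E (\<lambda>b. (B b - used \<phi> S) \<times> ?L))
      (\<lambda>y. ?f (overwrite E \<phi> y)))\<bar> \<le> D * (real (card E))\<^sup>2 / z"
  proof (rule insert.IH)
    show "S \<inter> E = {}" "tame (S \<union> E) B" "card E \<le> z"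
      using insert by (auto intro: tame_subset)
    show "\<bar>?f \<phi> - ?f \<phi>'\<bar> \<le> D" if h: "\<phi> \<in> PiE (S \<union> E) (\<lambda>s. B s \<times> ?L)" "\<phi>' \<in> PiE (S \<union> E) (\<lambda>s. B s \<times> ?L)"
      "\<And>s. s \<notin> E \<Longrightarrow> \<phi> s = \<phi>' s" for \<phi> \<phi>'
    proof -
      have "\<phi> s = \<phi>' s" if "s \<in> S" for s using that h(3) insert.prems(2) by blast
      then have u: "used \<phi> S = used \<phi>' S" by auto
      show ?thesis unfolding u
      proof (rule abs_avg_diff_le[OF _ insert.prems(8)])
        fix y assume "y \<in> (B b - used \<phi>' S) \<times> ?L"
        then show "\<bar>f (\<phi>(b := y)) - f (\<phi>'(b := y))\<bar> \<le> D"
          using upd[OF h(1)] upd[OF h(2)] h(3) by (intro osc') auto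
      qed
    qed
  qed (use insert.prems in auto)
  have 4: "avg (PiE E (\<lambda>b. (B b - used \<phi> S) \<times> ?L)) (\<lambda>y. ?f (overwrite E \<phi> y)) =
      avg (PiE (insert b E) (\<lambda>b. (B b - used \<phi> S) \<times> ?L)) (\<lambda>y. f (overwrite (insert b E) \<phi> y))" for \<phi>
  proof -
    have "used (overwrite E \<phi> y) S = used \<phi> S" for y
      using insert.prems(2) by (auto simp: overwrite_def image_def)
    moreover have "(overwrite E \<phi> y)(b := w) = overwrite (insert b E) \<phi> (y(b := w))" for y w
      using insert.hyps by (auto simp: overwrite_def)
    moreover have "finite ((B x - used \<phi> S) \<times> ?L)" if "x \<in> insert b E" for x
      using that t by (auto simp: tame_def)
    ultimately show ?thesis using insert.hyps by (subst avg_PiE_insert) auto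
  qed
  \<comment> \<open>With m = \<open>card E\<close>, the error of the new slot and that of the
    induction hypothesis combine by m + m^2 \<le> (m + 1)^2.\<close>
  have "D * card E / z + D * (real (card E))\<^sup>2 / z = D * (real (card E) + (real (card E))\<^sup>2) / z"
    by (simp add: add_divide_distrib distrib_left)
  also have "\<dots> \<le> D * (real (card (insert b E)))\<^sup>2 / z"
    using insert.prems(8) insert.hyps by (intro divide_right_mono mult_left_mono) (auto simp: power2_eq_square algebra_simps)
  finally show ?case using 1 2 3 unfolding 4 by linarith
qed

section \<open>Concentration for random placements\<close>

lemma avg_exp_le:
  assumes "finite A" "A \<noteq> {}" "\<And>a a'. a \<in> A \<Longrightarrow> a' \<in> A \<Longrightarrow> \<bar>h a - h a'\<bar> \<le> c" "l > 0"
  shows "avg A (\<lambda>a. exp (l * (h a - avg A h))) \<le> exp (l\<^sup>2 * c\<^sup>2 / 8)"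
proof -
  let ?M = "measure_pmf (pmf_of_set A)"
  \<comment> \<open>Only the oscillation of \<open>h\<close> is bounded; its minimum supplies the
    interval of length \<open>c\<close> for Hoeffding's lemma.\<close>
  define lo where "lo = Min (h ` A)"
  obtain a0 where a0: "a0 \<in> A" "lo = h a0"
  proof -
    have "lo \<in> h ` A" unfolding lo_def using assms by (intro Min_in) auto
    then show ?thesis using that by auto
  qed
  have lo: "lo \<le> h a" "h a \<le> lo + c" if "a \<in> A" for a
    using that Min_le[of "h ` A" "h a"] assms(1) assms(3)[OF that a0(1)] a0(2) unfolding lo_def by auto
  interpret interval_bounded_random_variable ?M h lo "lo + c"
    by unfold_locales (use assms lo in \<open>auto simp: AE_measure_pmf_iff\<close>)
  have E: "measure_pmf.expectation (pmf_of_set A) k = avg A k" for k :: "'a \<Rightarrow> real"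
    using assms by (simp add: integral_pmf_of_set avg_def)
  have "ennreal (avg A (\<lambda>a. exp (l * (h a - avg A h)))) =
      nn_integral ?M (\<lambda>a. ennreal (exp (l * (h a - avg A h))))"
    unfolding E[symmetric] using assms
    by (subst nn_integral_eq_integral) (use assms in \<open>simp_all add: integrable_measure_pmf_finite\<close>)
  also have "\<dots> \<le> ennreal (exp (l\<^sup>2 * c\<^sup>2 / 8))"
    using Hoeffdings_lemma_nn_integral[OF assms(4)] by (simp add: E)
  finally show ?thesis by (subst (asm) ennreal_le_iff) auto
qed

text \<open>Bounded differences under changing one slot and under exchanging the points of two slots;
  this class of functions is stable under averaging over one slot.\<close>

definition bounded_diff :: "'s set \<Rightarrow> 'p set \<Rightarrow> (('s \<Rightarrow> 'p \<times> nat) \<Rightarrow> real) \<Rightarrow> real \<Rightarrow> bool" where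
  "bounded_diff S P f c \<longleftrightarrow> (\<forall>\<phi>\<in>cfg S (\<lambda>_. P). \<forall>\<phi>'\<in>cfg S (\<lambda>_. P).
     (\<exists>s\<in>S. \<forall>u. u \<noteq> s \<longrightarrow> \<phi> u = \<phi>' u) \<or>
     (\<exists>s\<in>S. \<exists>t\<in>S. s \<noteq> t \<and> (\<forall>u. u \<noteq> s \<longrightarrow> u \<noteq> t \<longrightarrow> \<phi> u = \<phi>' u) \<and>
        fst (\<phi> s) = fst (\<phi>' t) \<and> fst (\<phi> t) = fst (\<phi>' s))
     \<longrightarrow> \<bar>f \<phi> - f \<phi>'\<bar> \<le> c)"

lemma bounded_diffI:
  assumes "\<And>\<phi> \<phi>' s t. \<phi> \<in> cfg S (\<lambda>_. P) \<Longrightarrow> \<phi>' \<in> cfg S (\<lambda>_. P) \<Longrightarrow> s \<in> S \<Longrightarrow> t \<in> S \<Longrightarrow>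
    (\<And>u. u \<noteq> s \<Longrightarrow> u \<noteq> t \<Longrightarrow> \<phi> u = \<phi>' u) \<Longrightarrow> \<bar>f \<phi> - f \<phi>'\<bar> \<le> c"
  shows "bounded_diff S P f c"
  unfolding bounded_diff_def
proof (intro ballI impI, elim disjE bexE conjE)
  fix \<phi> \<phi>' s assume "\<phi> \<in> cfg S (\<lambda>_. P)" "\<phi>' \<in> cfg S (\<lambda>_. P)" "s \<in> S" "\<forall>u. u \<noteq> s \<longrightarrow> \<phi> u = \<phi>' u"
  then show "\<bar>f \<phi> - f \<phi>'\<bar> \<le> c" by (intro assms[of _ _ s s]) auto
next
  fix \<phi> \<phi>' s t assume "\<phi> \<in> cfg S (\<lambda>_. P)" "\<phi>' \<in> cfg S (\<lambda>_. P)" "s \<in> S" "t \<in> S"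
    "\<forall>u. u \<noteq> s \<longrightarrow> u \<noteq> t \<longrightarrow> \<phi> u = \<phi>' u"
  then show "\<bar>f \<phi> - f \<phi>'\<bar> \<le> c" by (intro assms[of _ _ s t]) auto
qed

lemma bounded_diff_move:
  assumes "bounded_diff S P f c" "\<phi> \<in> cfg S (\<lambda>_. P)" "\<phi>' \<in> cfg S (\<lambda>_. P)" "s \<in> S" "\<And>u. u \<noteq> s \<Longrightarrow> \<phi> u = \<phi>' u"
  shows "\<bar>f \<phi> - f \<phi>'\<bar> \<le> c"
  using assms unfolding bounded_diff_def by blast

lemma bounded_diff_swap:
  assumes "bounded_diff S P f c" "\<phi> \<in> cfg S (\<lambda>_. P)" "\<phi>' \<in> cfg S (\<lambda>_. P)" "s \<in> S" "t \<in> S" "s \<noteq> t"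
    "\<And>u. u \<noteq> s \<Longrightarrow> u \<noteq> t \<Longrightarrow> \<phi> u = \<phi>' u" "fst (\<phi> s) = fst (\<phi>' t)" "fst (\<phi> t) = fst (\<phi>' s)"
  shows "\<bar>f \<phi> - f \<phi>'\<bar> \<le> c"
  using assms unfolding bounded_diff_def by blast

lemma bounded_diff_uminus: "bounded_diff S P f c \<Longrightarrow> bounded_diff S P (\<lambda>\<phi>. - f \<phi>) c"
  unfolding bounded_diff_def by (simp add: abs_minus_commute)

lemma cfg_upd:
  assumes "b \<notin> S" "\<phi> \<in> cfg S B" "y \<in> (B b - used \<phi> S) \<times> {0, 1}"
  shows "\<phi>(b := y) \<in> cfg (insert b S) B"
  using bij_betw_apply[OF cfg_insert_bij[OF assms(1), of B], of "(\<phi>, y)"] assms(2,3) by simp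

text \<open>Coupling argument. If the two placements use the same points, the new slot receives the
  same value in both. If they differ at \<open>s\<close> by points p and p', the free pools differ
  too, and the coupling below produces either a change at \<open>s\<close> alone or an exchange
  between \<open>s\<close> and \<open>b\<close>. This is why \<open>bounded_diff\<close> also covers
  exchanges.\<close>

lemma bounded_diff_avg:
  assumes "finite S" "b \<notin> S" "bounded_diff (insert b S) P f c" "0 \<le> c" "finite P"
  shows "bounded_diff S P (\<lambda>\<phi>. avg ((P - used \<phi> S) \<times> {0, 1}) (\<lambda>y. f (\<phi>(b := y)))) c"
proof -
  let ?L = "{0, 1 :: nat}"
  let ?g = "\<lambda>\<phi>. avg ((P - used \<phi> S) \<times> ?L) (\<lambda>y. f (\<phi>(b := y)))"
  note upd = cfg_upd[OF assms(2), of _ "\<lambda>_. P"]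
  have move: "\<bar>?g \<phi> - ?g \<phi>'\<bar> \<le> c"
    if h: "\<phi> \<in> cfg S (\<lambda>_. P)" "\<phi>' \<in> cfg S (\<lambda>_. P)" "s \<in> S" "\<And>u. u \<noteq> s \<Longrightarrow> \<phi> u = \<phi>' u" for \<phi> \<phi>' s
  proof (cases "fst (\<phi> s) = fst (\<phi>' s)")
    case True
    then have "fst (\<phi> u) = fst (\<phi>' u)" for u using h(4) by (cases "u = s") auto
    then have u: "used \<phi> S = used \<phi>' S" by auto
    show ?thesis unfolding u
    proof (rule abs_avg_diff_le[OF _ assms(4)])
      fix y assume y: "y \<in> (P - used \<phi>' S) \<times> ?L"
      show "\<bar>f (\<phi>(b := y)) - f (\<phi>'(b := y))\<bar> \<le> c"
        by (rule bounded_diff_move[OF assms(3) upd[OF h(1)] upd[OF h(2)], where s = s])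
           (use y h u in auto)
    qed
  next
    case False
    define p p' where "p = fst (\<phi> s)" and "p' = fst (\<phi>' s)"
    define W where "W = used \<phi> (S - {s})"
    have W: "W = used \<phi>' (S - {s})" unfolding W_def using h(4) by (intro image_cong) auto
    have S: "S = insert s (S - {s})" using h(3) by auto
    have u: "used \<phi> S = insert p W" unfolding W_def p_def by (subst (1) S) (simp only: image_insert)
    have u': "used \<phi>' S = insert p' W" unfolding W p'_def by (subst (1) S) (simp only: image_insert)
    have "p \<notin> W" using inj_onD[OF cfg_inj[OF h(1)], of s] h(3) unfolding W_def p_def by auto
    moreover have "p' \<notin> W" using inj_onD[OF cfg_inj[OF h(2)], of s] h(3) unfolding W p'_def by auto
    moreover have "p \<in> P" "p' \<in> P" using cfg_fst[OF h(1,3)] cfg_fst[OF h(2,3)] by (auto simp: p_def p'_def)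
    ultimately have pp: "p \<in> P - W" "p' \<in> P - W" "p \<noteq> p'" using False by (auto simp: p_def p'_def)
    \<comment> \<open>The point p' is free for \<phi> but taken in \<phi>', and conversely for p.
      Pairing p' with p makes the extended placements differ by an exchange of the points of
      \<open>s\<close> and \<open>b\<close>.\<close>
    let ?h = "\<lambda>y :: 'b \<times> nat. (if fst y = p' then (p, snd y) else y)"
    have bij: "bij_betw ?h ((P - used \<phi> S) \<times> ?L) ((P - used \<phi>' S) \<times> ?L)"
      unfolding u u'
      by (rule bij_betw_byWitness[where f' = "\<lambda>y. (if fst y = p then (p', snd y) else y)"])
         (use pp in \<open>auto split: if_splits\<close>)
    have "?g \<phi>' = avg ((P - used \<phi> S) \<times> ?L) (\<lambda>y. f (\<phi>'(b := ?h y)))"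
      by (rule avg_reindex[OF bij])
    moreover have "\<bar>?g \<phi> - avg ((P - used \<phi> S) \<times> ?L) (\<lambda>y. f (\<phi>'(b := ?h y)))\<bar> \<le> c"
    proof (rule abs_avg_diff_le[OF _ assms(4)])
      fix y assume y: "y \<in> (P - used \<phi> S) \<times> ?L"
      have hy: "?h y \<in> (P - used \<phi>' S) \<times> ?L" using bij_betwE[OF bij] y by blast
      have bs: "b \<noteq> s" using assms(2) h(3) by auto
      show "\<bar>f (\<phi>(b := y)) - f (\<phi>'(b := ?h y))\<bar> \<le> c"
      proof (cases "fst y = p'")
        case True
        show ?thesis
          by (rule bounded_diff_swap[OF assms(3) upd[OF h(1) y] upd[OF h(2) hy], where s = s and t = b])
             (use h True bs in \<open>auto simp: p_def p'_def\<close>)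
      next
        case False
        then show ?thesis
          by (intro bounded_diff_move[OF assms(3) upd[OF h(1) y] upd[OF h(2) hy], where s = s])
             (use h bs in auto)
      qed
    qed
    ultimately show ?thesis by simp
  qed
  have swap: "\<bar>?g \<phi> - ?g \<phi>'\<bar> \<le> c"
    if h: "\<phi> \<in> cfg S (\<lambda>_. P)" "\<phi>' \<in> cfg S (\<lambda>_. P)" "s \<in> S" "t \<in> S" "s \<noteq> t"
      "\<And>u. u \<noteq> s \<Longrightarrow> u \<noteq> t \<Longrightarrow> \<phi> u = \<phi>' u" "fst (\<phi> s) = fst (\<phi>' t)" "fst (\<phi> t) = fst (\<phi>' s)" for \<phi> \<phi>' s t
  proof -
    have S: "S = insert s (insert t (S - {s, t}))" using h(3,4) by auto
    have "used \<phi> (S - {s, t}) = used \<phi>' (S - {s, t})" using h(6) by auto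
    then have u: "used \<phi> S = used \<phi>' S"
      using h(7,8) by (subst (1 2) S) auto
    show ?thesis unfolding u
    proof (rule abs_avg_diff_le[OF _ assms(4)])
      fix y assume y: "y \<in> (P - used \<phi>' S) \<times> ?L"
      show "\<bar>f (\<phi>(b := y)) - f (\<phi>'(b := y))\<bar> \<le> c"
        by (rule bounded_diff_swap[OF assms(3) upd[OF h(1)] upd[OF h(2)], where s = s and t = t])
           (use y h u assms(2) in auto)
    qed
  qed
  show ?thesis
    unfolding bounded_diff_def
  proof (intro ballI impI, elim disjE bexE conjE)
    fix \<phi> \<phi>' s assume "\<phi> \<in> cfg S (\<lambda>_. P)" "\<phi>' \<in> cfg S (\<lambda>_. P)" "s \<in> S" "\<forall>u. u \<noteq> s \<longrightarrow> \<phi> u = \<phi>' u"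
    then show "\<bar>?g \<phi> - ?g \<phi>'\<bar> \<le> c" by (intro move) auto
  next
    fix \<phi> \<phi>' s t assume "\<phi> \<in> cfg S (\<lambda>_. P)" "\<phi>' \<in> cfg S (\<lambda>_. P)" "s \<in> S" "t \<in> S" "s \<noteq> t"
      "\<forall>u. u \<noteq> s \<longrightarrow> u \<noteq> t \<longrightarrow> \<phi> u = \<phi>' u" "fst (\<phi> s) = fst (\<phi>' t)" "fst (\<phi> t) = fst (\<phi>' s)"
    then show "\<bar>?g \<phi> - ?g \<phi>'\<bar> \<le> c" by (intro swap) auto
  qed
qed

text \<open>Azuma's argument by induction: the average over the last slot is the conditional mean,
  which inherits the constant \<open>c\<close> by \<open>bounded_diff_avg\<close>, and the deviation
  from it contributes one Hoeffding factor per slot.\<close>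

lemma avg_cfg_exp_le:
  assumes "finite S" "finite P" "card S \<le> card P" "bounded_diff S P f c" "0 \<le> c" "l > 0"
  shows "avg (cfg S (\<lambda>_. P)) (\<lambda>\<phi>. exp (l * (f \<phi> - avg (cfg S (\<lambda>_. P)) f))) \<le> exp (l\<^sup>2 * c\<^sup>2 * card S / 8)"
  using assms
proof (induction S arbitrary: f rule: finite_induct)
  case empty
  then show ?case by simp
next
  case (insert b S)
  let ?C = "cfg S (\<lambda>_. P)" and ?Y = "\<lambda>\<phi>. (P - used \<phi> S) \<times> {0, 1 :: nat}"
  let ?g = "\<lambda>\<phi>. avg (?Y \<phi>) (\<lambda>y. f (\<phi>(b := y)))"
  have ins: "avg (cfg (insert b S) (\<lambda>_. P)) k = avg ?C (\<lambda>\<phi>. avg (?Y \<phi>) (\<lambda>y. k (\<phi>(b := y))))" for k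
    using insert by (intro avg_cfg_insert tame_const) auto
  define \<mu> where "\<mu> = avg ?C ?g"
  have "avg (cfg (insert b S) (\<lambda>_. P)) (\<lambda>\<phi>. exp (l * (f \<phi> - \<mu>))) =
      avg ?C (\<lambda>\<phi>. exp (l * (?g \<phi> - \<mu>)) * avg (?Y \<phi>) (\<lambda>y. exp (l * (f (\<phi>(b := y)) - ?g \<phi>))))"
    unfolding ins avg_mult_left[symmetric] mult_exp_exp
    by (intro avg_cong refl) (simp add: algebra_simps)
  also have "\<dots> \<le> avg ?C (\<lambda>\<phi>. exp (l\<^sup>2 * c\<^sup>2 / 8) * exp (l * (?g \<phi> - \<mu>)))"
  proof (rule avg_mono)
    fix \<phi> assume \<phi>: "\<phi> \<in> ?C"
    have "P - used \<phi> S \<noteq> {}"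
      using unused_nonempty[OF insert.hyps tame_const[OF insert.prems(1)] _ \<phi>] insert.prems(2)
      by (auto intro: feasible_const)
    moreover have "\<bar>f (\<phi>(b := y)) - f (\<phi>(b := y'))\<bar> \<le> c" if "y \<in> ?Y \<phi>" "y' \<in> ?Y \<phi>" for y y'
      using that \<phi> insert.hyps
      by (intro bounded_diff_move[OF insert.prems(3), where s = b] cfg_upd) auto
    ultimately have "avg (?Y \<phi>) (\<lambda>y. exp (l * (f (\<phi>(b := y)) - ?g \<phi>))) \<le> exp (l\<^sup>2 * c\<^sup>2 / 8)"
      using insert.prems by (intro avg_exp_le) auto
    then show "exp (l * (?g \<phi> - \<mu>)) * avg (?Y \<phi>) (\<lambda>y. exp (l * (f (\<phi>(b := y)) - ?g \<phi>))) \<le>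
        exp (l\<^sup>2 * c\<^sup>2 / 8) * exp (l * (?g \<phi> - \<mu>))"
      by (simp add: mult.commute)
  qed
  also have "\<dots> = exp (l\<^sup>2 * c\<^sup>2 / 8) * avg ?C (\<lambda>\<phi>. exp (l * (?g \<phi> - \<mu>)))"
    by (rule avg_mult_left)
  also have "\<dots> \<le> exp (l\<^sup>2 * c\<^sup>2 / 8) * exp (l\<^sup>2 * c\<^sup>2 * card S / 8)"
    unfolding \<mu>_def using insert
    by (intro mult_left_mono insert.IH bounded_diff_avg) auto
  also have "\<dots> = exp (l\<^sup>2 * c\<^sup>2 * card (insert b S) / 8)"
    using insert.hyps by (simp add: mult_exp_exp add_divide_distrib[symmetric] algebra_simps)
  finally show ?case unfolding \<mu>_def ins[of f] .
qed

lemma cfg_tail: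
  assumes "finite S" "finite P" "card S \<le> card P" "bounded_diff S P f c" "0 \<le> c"
    and "c\<^sup>2 * card S \<le> d" "0 < d" "0 < t"
  shows "avg (cfg S (\<lambda>_. P)) (\<lambda>\<phi>. of_bool (f \<phi> - avg (cfg S (\<lambda>_. P)) f \<ge> t)) \<le> exp (- 2 * t\<^sup>2 / d)"
proof -
  let ?C = "cfg S (\<lambda>_. P)"
  \<comment> \<open>The minimiser of - l t + l^2 d / 8, with minimum - 2 t^2 / d. A separate bound
    \<open>d\<close> stays positive even when \<open>c\<close> or \<open>card S\<close>
    vanishes.\<close>
  define l where "l = 4 * t / d"
  have l: "l > 0" using assms by (simp add: l_def)
  have "avg ?C (\<lambda>\<phi>. of_bool (f \<phi> - avg ?C f \<ge> t)) \<le> avg ?C (\<lambda>\<phi>. exp (- l * t) * exp (l * (f \<phi> - avg ?C f)))"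
    using l by (intro avg_mono) (auto simp: mult_exp_exp of_bool_def)
  also have "\<dots> \<le> exp (- l * t) * exp (l\<^sup>2 * c\<^sup>2 * card S / 8)"
    unfolding avg_mult_left using assms l by (intro mult_left_mono avg_cfg_exp_le) auto
  also have "\<dots> \<le> exp (- l * t) * exp (l\<^sup>2 * d / 8)"
    using assms(6) by (intro mult_left_mono) (auto simp: mult.assoc intro!: mult_left_mono)
  also have "\<dots> = exp (- 2 * t\<^sup>2 / d)"
    using assms(7) by (simp add: mult_exp_exp l_def power2_eq_square field_simps)
  finally show ?thesis .
qed

section \<open>Spin models on hypergraphs\<close>

text \<open>An edge is penalised by a pattern \<open>t \<in> T\<close> when each of its slots carries the spin \<open>\<theta> t b\<close>
  for its label \<open>b\<close>. The assumption \<open>soft\<close> says that no factor vanishes or that the spin 0 is always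
  harmless (independent sets).\<close>

locale spin_model =
  fixes K q r :: nat and v :: "nat \<Rightarrow> real" and \<alpha> c :: real and T :: "nat set" and \<theta> :: "nat \<Rightarrow> nat \<Rightarrow> nat"
  assumes K_pos: "0 < K" and q_pos: "0 < q" and r_pos: "0 < r" and v_pos: "\<And>k. 0 < v k"
    and \<alpha>_pos: "0 < \<alpha>" and c_nonneg: "0 \<le> c" and c_le_1: "c \<le> 1" and finite_T: "finite T"
    and \<theta>_inj: "\<And>t t' b. t \<in> T \<Longrightarrow> t' \<in> T \<Longrightarrow> b \<in> {0, 1} \<Longrightarrow> \<theta> t b = \<theta> t' b \<Longrightarrow> t = t'"
    and soft: "c < 1 \<or> (\<forall>t\<in>T. \<forall>b\<in>{0, 1}. \<theta> t b \<noteq> 0)"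
begin

definition hit :: "nat \<Rightarrow> (nat \<Rightarrow> nat) \<Rightarrow> (nat \<times> nat) \<times> nat \<Rightarrow> real" where
  "hit t x y = of_bool (x (fst (fst y)) = \<theta> t (snd y))"

definition viol :: "(nat \<Rightarrow> nat) \<Rightarrow> (nat \<times> nat \<Rightarrow> (nat \<times> nat) \<times> nat) \<Rightarrow> nat \<Rightarrow> real" where
  "viol x \<phi> i = (\<Sum>t\<in>T. \<Prod>s<K. hit t x (\<phi> (i, s)))"

definition edge_wt :: "(nat \<Rightarrow> nat) \<Rightarrow> (nat \<times> nat \<Rightarrow> (nat \<times> nat) \<times> nat) \<Rightarrow> nat \<Rightarrow> real" where
  "edge_wt x \<phi> i = \<alpha> * (1 - c * viol x \<phi> i)"

definition wt :: "nat set \<Rightarrow> nat set \<Rightarrow> (nat \<times> nat \<Rightarrow> (nat \<times> nat) \<times> nat) \<Rightarrow> (nat \<Rightarrow> nat) \<Rightarrow> real" where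
  "wt V I \<phi> x = (\<Prod>u\<in>V. v (x u)) * (\<Prod>i\<in>I. edge_wt x \<phi> i)"

definition spins :: "nat set \<Rightarrow> (nat \<Rightarrow> nat) set" where
  "spins V = PiE V (\<lambda>_. {..<q})"

definition Z :: "nat set \<Rightarrow> nat set \<Rightarrow> (nat \<times> nat \<Rightarrow> (nat \<times> nat) \<times> nat) \<Rightarrow> real" where
  "Z V I \<phi> = (\<Sum>x\<in>spins V. wt V I \<phi> x)"

definition slots :: "nat set \<Rightarrow> (nat \<times> nat) set" where
  "slots I = I \<times> {..<K}"

definition points :: "nat set \<Rightarrow> (nat \<times> nat) set" where
  "points V = V \<times> {..<r}"

definition proper :: "nat set \<Rightarrow> nat set \<Rightarrow> (nat \<times> nat \<Rightarrow> (nat \<times> nat) \<times> nat) \<Rightarrow> bool" where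
  "proper V I \<phi> \<longleftrightarrow> (\<forall>s\<in>slots I. fst (fst (\<phi> s)) \<in> V \<and> snd (\<phi> s) \<in> {0, 1})"

lemma finite_slots: "finite I \<Longrightarrow> finite (slots I)"
  by (simp add: slots_def)

lemma finite_points: "finite V \<Longrightarrow> finite (points V)"
  by (simp add: points_def)

lemma card_slots: "card (slots I) = card I * K"
  by (simp add: slots_def card_cartesian_product)

lemma card_points: "card (points V) = card V * r"
  by (simp add: points_def card_cartesian_product)

lemma slots_mono: "J \<subseteq> I \<Longrightarrow> slots J \<subseteq> slots I"
  by (auto simp: slots_def)

lemma proper_subset: "proper V I \<phi> \<Longrightarrow> J \<subseteq> I \<Longrightarrow> proper V J \<phi>"
  using slots_mono[of J I] unfolding proper_def by blast

lemma proper_PiE: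
  "\<phi> \<in> PiE S (\<lambda>s. B s \<times> {0, 1}) \<Longrightarrow> slots I \<subseteq> S \<Longrightarrow> (\<And>s. s \<in> slots I \<Longrightarrow> B s \<subseteq> points V) \<Longrightarrow> proper V I \<phi>"
  unfolding proper_def points_def by (fastforce dest: PiE_mem)

lemma proper_slot:
  "proper V I \<phi> \<Longrightarrow> i \<in> I \<Longrightarrow> s < K \<Longrightarrow> fst (fst (\<phi> (i, s))) \<in> V"
  "proper V I \<phi> \<Longrightarrow> i \<in> I \<Longrightarrow> s < K \<Longrightarrow> snd (\<phi> (i, s)) \<in> {0, 1}"
  unfolding proper_def slots_def by (auto dest: bspec[of _ _ "(i, s)"])

lemma hit_bounds: "0 \<le> hit t x y" "hit t x y \<le> 1"
  by (auto simp: hit_def)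

lemma viol_nonneg: "0 \<le> viol x \<phi> i"
  unfolding viol_def by (intro sum_nonneg prod_nonneg) (auto simp: hit_bounds)

text \<open>The first slot alone gives the bound: by \<theta>_inj its spin fits at most one pattern,
  and the remaining factors are at most 1.\<close>

lemma viol_le_1:
  assumes "proper V I \<phi>" "i \<in> I"
  shows "viol x \<phi> i \<le> 1"
proof -
  let ?y = "\<phi> (i, 0)"
  have "viol x \<phi> i \<le> (\<Sum>t\<in>T. hit t x ?y)"
    unfolding viol_def
  proof (rule sum_mono)
    fix t
    have "(\<Prod>s<K. hit t x (\<phi> (i, s))) = hit t x ?y * (\<Prod>s\<in>{..<K} - {0}. hit t x (\<phi> (i, s)))"
      using K_pos by (subst prod.remove[of _ 0]) auto
    also have "\<dots> \<le> hit t x ?y * 1"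
      by (intro mult_left_mono prod_le_1) (auto simp: hit_bounds)
    finally show "(\<Prod>s<K. hit t x (\<phi> (i, s))) \<le> hit t x ?y" by simp
  qed
  also have "\<dots> = card {t \<in> T. x (fst (fst ?y)) = \<theta> t (snd ?y)}"
    using finite_T by (simp add: hit_def of_bool_def sum.If_cases Int_def)
  also have "\<dots> \<le> 1"
  proof -
    have "card {t \<in> T. x (fst (fst ?y)) = \<theta> t (snd ?y)} \<le> Suc 0"
      using finite_T \<theta>_inj[OF _ _ proper_slot(2)[OF assms K_pos]] by (subst card_le_Suc0_iff_eq) auto
    then show ?thesis by simp
  qed
  finally show ?thesis .
qed

lemma edge_wt_nonneg: "proper V I \<phi> \<Longrightarrow> i \<in> I \<Longrightarrow> 0 \<le> edge_wt x \<phi> i"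
  unfolding edge_wt_def using viol_le_1[of V I \<phi> i x] viol_nonneg[of x \<phi> i] \<alpha>_pos c_nonneg c_le_1
  by (simp add: mult_le_one)

lemma edge_wt_le: "edge_wt x \<phi> i \<le> \<alpha>"
  unfolding edge_wt_def using viol_nonneg[of x \<phi> i] \<alpha>_pos c_nonneg by (simp add: mult_le_cancel_left1)

lemma wt_nonneg: "proper V I \<phi> \<Longrightarrow> 0 \<le> wt V I \<phi> x"
  unfolding wt_def using v_pos by (intro mult_nonneg_nonneg prod_nonneg) (auto intro: edge_wt_nonneg less_imp_le)

lemma wt_insert: "finite I \<Longrightarrow> i \<notin> I \<Longrightarrow> wt V (insert i I) \<phi> x = wt V I \<phi> x * edge_wt x \<phi> i"
  unfolding wt_def by simp

lemma edge_wt_cong: "(\<And>s. s < K \<Longrightarrow> \<phi> (i, s) = \<phi>' (i, s)) \<Longrightarrow> edge_wt x \<phi> i = edge_wt x \<phi>' i"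
  unfolding edge_wt_def viol_def by simp

lemma Z_cong:
  assumes "\<And>s. s \<in> slots I \<Longrightarrow> \<phi> s = \<phi>' s"
  shows "Z V I \<phi> = Z V I \<phi>'"
proof -
  have "edge_wt x \<phi> i = edge_wt x \<phi>' i" if "i \<in> I" for x i
    using that assms by (intro edge_wt_cong) (auto simp: slots_def)
  then show ?thesis unfolding Z_def wt_def by simp
qed

lemma Z_insert_le:
  assumes "finite I" "i \<notin> I" "proper V I \<phi>"
  shows "Z V (insert i I) \<phi> \<le> \<alpha> * Z V I \<phi>"
  unfolding Z_def sum_distrib_left
proof (rule sum_mono)
  fix x
  show "wt V (insert i I) \<phi> x \<le> \<alpha> * wt V I \<phi> x"
    unfolding wt_insert[OF assms(1,2)]
    using mult_left_mono[OF edge_wt_le wt_nonneg[OF assms(3)]] by (simp add: mult.commute)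
qed

text \<open>Resetting one coordinate is a \<open>q\<close>-to-one map. In terms of averages: one
  value of a nonnegative function is at most \<open>q\<close> times its mean over that
  coordinate.\<close>

lemma sum_spins_update:
  fixes g :: "(nat \<Rightarrow> nat) \<Rightarrow> real"
  assumes "finite V" "u \<in> V" "\<And>x. 0 \<le> g x"
  shows "(\<Sum>x\<in>spins V. g (x(u := 0))) \<le> q * (\<Sum>x\<in>spins V. g x)"
proof -
  let ?W = "V - {u}"
  have V: "insert u ?W = V" using assms(2) by auto
  have ne: "card (spins V) > 0"
    using assms(1) q_pos unfolding spins_def by (simp add: card_PiE)
  have ins: "avg (spins V) k = avg (spins ?W) (\<lambda>x. avg {..<q} (\<lambda>w. k (x(u := w))))" for k
    using avg_PiE_insert[of ?W u "\<lambda>_. {..<q}" k] assms(1) unfolding spins_def V by simp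
  have "avg (spins V) (\<lambda>x. g (x(u := 0))) = avg (spins ?W) (\<lambda>x. g (x(u := 0)))"
    unfolding ins using q_pos by (simp add: avg_const lessThan_empty_iff)
  also have "\<dots> \<le> avg (spins ?W) (\<lambda>x. q * avg {..<q} (\<lambda>w. g (x(u := w))))"
  proof (rule avg_mono)
    fix x
    have "g (x(u := 0)) \<le> (\<Sum>w<q. g (x(u := w)))"
      using assms(3) q_pos by (intro member_le_sum) auto
    then show "g (x(u := 0)) \<le> q * avg {..<q} (\<lambda>w. g (x(u := w)))"
      using q_pos by (simp add: avg_def)
  qed
  also have "\<dots> = q * avg (spins V) g" unfolding avg_mult_left ins ..
  finally show ?thesis using ne by (simp add: avg_def divide_right_mono_neg field_simps)
qed

lemma Z_insert_ge_soft:
  assumes "finite I" "i \<notin> I" "proper V (insert i I) \<phi>" "c < 1"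
  shows "\<alpha> * (1 - c) * Z V I \<phi> \<le> Z V (insert i I) \<phi>"
  unfolding Z_def sum_distrib_left
proof (rule sum_mono)
  fix x
  have "\<alpha> * (1 - c) \<le> edge_wt x \<phi> i"
    unfolding edge_wt_def using viol_le_1[OF assms(3)] \<alpha>_pos c_nonneg
    by (intro mult_left_mono) (auto simp: mult_left_le)
  moreover have "0 \<le> wt V I \<phi> x" using assms(3) by (intro wt_nonneg) (auto intro: proper_subset)
  ultimately show "\<alpha> * (1 - c) * wt V I \<phi> x \<le> wt V (insert i I) \<phi> x"
    unfolding wt_insert[OF assms(1,2)] by (metis mult.commute mult_left_mono)
qed

text \<open>In the hard-core case, an occupied node of the new edge is emptied: this creates no violation.\<close>

lemma Z_insert_ge_hard:
  assumes "finite I" "finite V" "i \<notin> I" "proper V (insert i I) \<phi>" and hard: "\<forall>t\<in>T. \<forall>b\<in>{0, 1}. \<theta> t b \<noteq> 0"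
  shows "Z V I \<phi> \<le> q * ((\<Sum>k<q. v k) / v 0) / \<alpha> * Z V (insert i I) \<phi>"
proof -
  define u where "u = fst (fst (\<phi> (i, 0)))"
  let ?\<rho> = "(\<Sum>k<q. v k) / v 0"
  have u: "u \<in> V" unfolding u_def using assms(4) K_pos by (intro proper_slot) auto
  have pI: "proper V I \<phi>" using assms(4) by (rule proper_subset) auto
  have hit_le: "hit t (x(u := 0)) (\<phi> (j, s)) \<le> hit t x (\<phi> (j, s))" if "t \<in> T" "j \<in> insert i I" "s < K" for t x j s
    using hard that proper_slot(2)[OF assms(4) that(2,3)] by (auto simp: hit_def)
  have edge: "edge_wt x \<phi> j \<le> edge_wt (x(u := 0)) \<phi> j" if "j \<in> I" for x j
    unfolding edge_wt_def viol_def using that \<alpha>_pos c_nonneg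
    by (intro mult_left_mono diff_mono sum_mono prod_mono) (auto simp: hit_bounds hit_le)
  have "edge_wt (x(u := 0)) \<phi> i = \<alpha>" for x
  proof -
    have "(\<Prod>s<K. hit t (x(u := 0)) (\<phi> (i, s))) = 0" if "t \<in> T" for t
    proof (rule prod_zero)
      show "\<exists>s\<in>{..<K}. hit t (x(u := 0)) (\<phi> (i, s)) = 0"
        using K_pos hard that proper_slot(2)[OF assms(4), of i 0] by (intro bexI[of _ 0]) (auto simp: hit_def u_def)
    qed auto
    then have "viol (x(u := 0)) \<phi> i = 0" unfolding viol_def by (intro sum.neutral) blast
    then show ?thesis by (simp add: edge_wt_def)
  qed
  then have wi: "wt V (insert i I) \<phi> (x(u := 0)) = \<alpha> * wt V I \<phi> (x(u := 0))" for x
    using wt_insert[OF assms(1,3)] by simp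
  \<comment> \<open>Emptying \<open>u\<close> can only raise the edge factors; the node factor
    changes from \<open>v (x u)\<close> to \<open>v 0\<close>, which costs at most ?\<rho>.\<close>
  have le: "wt V I \<phi> x \<le> ?\<rho> * wt V I \<phi> (x(u := 0))" if x: "x \<in> spins V" for x
  proof -
    have split: "(\<Prod>w\<in>V. v (y w)) = v (y u) * (\<Prod>w\<in>V - {u}. v (y w))" for y
      using assms(2) u by (rule prod.remove)
    have "v (x u) \<le> (\<Sum>k<q. v k)"
      using x u v_pos by (intro member_le_sum) (auto simp: spins_def less_imp_le dest!: PiE_mem[of x _ _ u])
    then have "v (x u) \<le> ?\<rho> * v 0" using v_pos[of 0] by simp
    moreover have "(\<Prod>w\<in>V - {u}. v ((x(u := 0)) w)) = (\<Prod>w\<in>V - {u}. v (x w))"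
      by (intro prod.cong) auto
    ultimately have "(\<Prod>w\<in>V. v (x w)) \<le> ?\<rho> * (\<Prod>w\<in>V. v ((x(u := 0)) w))"
      unfolding split[of x] split[of "x(u := 0)"] using v_pos
      by (simp add: mult.assoc[symmetric] mult_right_mono prod_nonneg less_imp_le)
    moreover have "(\<Prod>j\<in>I. edge_wt x \<phi> j) \<le> (\<Prod>j\<in>I. edge_wt (x(u := 0)) \<phi> j)"
      by (intro prod_mono) (auto intro: edge edge_wt_nonneg[OF pI])
    moreover have "0 \<le> ?\<rho> * (\<Prod>w\<in>V. v ((x(u := 0)) w))"
      using v_pos by (intro mult_nonneg_nonneg divide_nonneg_nonneg sum_nonneg prod_nonneg) (auto simp: less_imp_le)
    ultimately show ?thesis
      unfolding wt_def mult.assoc[symmetric]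
      by (intro mult_mono) (auto intro: prod_nonneg edge_wt_nonneg[OF pI])
  qed
  have \<rho>: "0 \<le> ?\<rho>" using v_pos by (intro divide_nonneg_nonneg sum_nonneg) (auto simp: less_imp_le)
  have "Z V I \<phi> \<le> (\<Sum>x\<in>spins V. ?\<rho> / \<alpha> * wt V (insert i I) \<phi> (x(u := 0)))"
    unfolding Z_def by (rule sum_mono) (use le \<alpha>_pos in \<open>simp add: wi\<close>)
  also have "\<dots> = ?\<rho> / \<alpha> * (\<Sum>x\<in>spins V. wt V (insert i I) \<phi> (x(u := 0)))"
    by (rule sum_distrib_left[symmetric])
  also have "\<dots> \<le> ?\<rho> / \<alpha> * (q * Z V (insert i I) \<phi>)"
    unfolding Z_def using divide_nonneg_pos[OF \<rho> \<alpha>_pos] assms(2) u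
    by (intro mult_left_mono sum_spins_update wt_nonneg assms) auto
  finally show ?thesis by (simp add: mult_ac)
qed

text \<open>Dominates the quotient of partition functions with and without one edge, in both
  directions. A sum replaces a maximum for convenience; the summand 1 ensures
  \<open>0 \<le> lip\<close>.\<close>

definition ratio :: real where
  "ratio = 1 + \<alpha> + (if c < 1 then 1 / (\<alpha> * (1 - c)) else q * ((\<Sum>k<q. v k) / v 0) / \<alpha>)"

definition lip :: real where
  "lip = ln ratio"

lemma ratio_bounds:
  shows "1 \<le> ratio" "\<alpha> \<le> ratio" "c < 1 \<Longrightarrow> 1 / (\<alpha> * (1 - c)) \<le> ratio"
    "\<not> c < 1 \<Longrightarrow> q * ((\<Sum>k<q. v k) / v 0) / \<alpha> \<le> ratio"
proof -
  have "0 \<le> q * ((\<Sum>k<q. v k) / v 0) / \<alpha>"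
    using v_pos \<alpha>_pos by (intro divide_nonneg_nonneg mult_nonneg_nonneg sum_nonneg) (auto simp: less_imp_le)
  moreover have "c < 1 \<Longrightarrow> 0 \<le> 1 / (\<alpha> * (1 - c))" using \<alpha>_pos by simp
  ultimately show "1 \<le> ratio" "\<alpha> \<le> ratio" "c < 1 \<Longrightarrow> 1 / (\<alpha> * (1 - c)) \<le> ratio"
    "\<not> c < 1 \<Longrightarrow> q * ((\<Sum>k<q. v k) / v 0) / \<alpha> \<le> ratio"
    unfolding ratio_def using \<alpha>_pos by auto
qed

lemma lip_nonneg: "0 \<le> lip"
  unfolding lip_def using ratio_bounds(1) by simp

lemma Z_nonneg: "proper V I \<phi> \<Longrightarrow> 0 \<le> Z V I \<phi>"
  unfolding Z_def by (intro sum_nonneg wt_nonneg)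

lemma Z_insert_ge:
  assumes "finite I" "finite V" "i \<notin> I" "proper V (insert i I) \<phi>"
  shows "Z V I \<phi> \<le> ratio * Z V (insert i I) \<phi>"
proof (cases "c < 1")
  case True
  have "\<alpha> * (1 - c) > 0" using True \<alpha>_pos by simp
  then have "Z V I \<phi> \<le> 1 / (\<alpha> * (1 - c)) * Z V (insert i I) \<phi>"
    using Z_insert_ge_soft[OF assms(1,3,4) True] by (simp add: field_simps)
  also have "\<dots> \<le> ratio * Z V (insert i I) \<phi>"
    using ratio_bounds(3)[OF True] Z_nonneg[OF assms(4)] by (rule mult_right_mono)
  finally show ?thesis .
next
  case False
  then have "Z V I \<phi> \<le> q * ((\<Sum>k<q. v k) / v 0) / \<alpha> * Z V (insert i I) \<phi>"
    using soft assms by (intro Z_insert_ge_hard) auto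
  also have "\<dots> \<le> ratio * Z V (insert i I) \<phi>"
    using ratio_bounds(4)[OF False] Z_nonneg[OF assms(4)] by (rule mult_right_mono)
  finally show ?thesis .
qed

section \<open>Positivity of the partition function and Lipschitz estimates for its
  logarithm\<close>

lemma Z_empty: "finite V \<Longrightarrow> Z V {} \<phi> = (\<Sum>k<q. v k) ^ card V"
  unfolding Z_def wt_def spins_def using prod_sum_PiE[of V "\<lambda>_. {..<q}" "\<lambda>_. v"] by simp

lemma sum_v_pos: "0 < (\<Sum>k<q. v k)"
  using q_pos v_pos by (intro sum_pos) auto

lemma Z_pos:
  assumes "finite I" "finite V" "proper V I \<phi>"
  shows "0 < Z V I \<phi>"
  using assms(1,3)
proof (induction I rule: finite_induct)
  case empty
  then show ?case using assms(2) sum_v_pos by (simp add: Z_empty)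
next
  case (insert i I)
  have "0 < Z V I \<phi>" using insert.prems by (intro insert.IH) (auto intro: proper_subset)
  also have "\<dots> \<le> ratio * Z V (insert i I) \<phi>" using insert assms(2) by (intro Z_insert_ge) auto
  finally show ?case using ratio_bounds(1) by (simp add: zero_less_mult_iff)
qed

lemma ln_Z_insert:
  assumes "finite I" "finite V" "i \<notin> I" "proper V (insert i I) \<phi>"
  shows "\<bar>ln (Z V (insert i I) \<phi>) - ln (Z V I \<phi>)\<bar> \<le> lip"
proof -
  have pI: "proper V I \<phi>" using assms(4) by (rule proper_subset) auto
  have pos: "0 < Z V (insert i I) \<phi>" "0 < Z V I \<phi>" "0 < ratio"
    using assms pI ratio_bounds(1) by (auto intro!: Z_pos)
  have "Z V (insert i I) \<phi> \<le> \<alpha> * Z V I \<phi>" using assms pI by (intro Z_insert_le) auto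
  also have "\<dots> \<le> ratio * Z V I \<phi>" using ratio_bounds(2) pos by (intro mult_right_mono) auto
  finally have "ln (Z V (insert i I) \<phi>) \<le> ln (ratio * Z V I \<phi>)" using pos by simp
  moreover have "ln (Z V I \<phi>) \<le> ln (ratio * Z V (insert i I) \<phi>)"
    using pos Z_insert_ge[OF assms] by simp
  ultimately show ?thesis using pos by (simp add: ln_mult lip_def abs_le_iff)
qed

lemma ln_Z_Un:
  assumes "finite J" "finite I" "finite V" "I \<inter> J = {}" "proper V (I \<union> J) \<phi>"
  shows "\<bar>ln (Z V (I \<union> J) \<phi>) - ln (Z V I \<phi>)\<bar> \<le> lip * card J"
  using assms
proof (induction J rule: finite_induct)
  case empty
  then show ?case by simp
next
  case (insert j J)
  have "\<bar>ln (Z V (insert j (I \<union> J)) \<phi>) - ln (Z V (I \<union> J) \<phi>)\<bar> \<le> lip"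
    using insert by (intro ln_Z_insert) auto
  moreover have "\<bar>ln (Z V (I \<union> J) \<phi>) - ln (Z V I \<phi>)\<bar> \<le> lip * card J"
    using insert by (intro insert.IH) (auto intro: proper_subset)
  ultimately show ?case using insert.hyps by (simp add: algebra_simps)
qed

text \<open>Both sides are compared with the system lacking edge \<open>i\<close>, on which the two
  placements agree.\<close>

lemma ln_Z_change:
  assumes "finite I" "finite V" "proper V I \<phi>" "proper V I \<phi>'" "\<And>j s. j \<noteq> i \<Longrightarrow> \<phi> (j, s) = \<phi>' (j, s)"
  shows "\<bar>ln (Z V I \<phi>) - ln (Z V I \<phi>')\<bar> \<le> 2 * lip"
proof (cases "i \<in> I")
  case True
  let ?J = "I - {i}"
  have I: "insert i ?J = I" using True by auto
  have eq: "Z V ?J \<phi> = Z V ?J \<phi>'" using assms(5) by (intro Z_cong) (auto simp: slots_def)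
  have "\<bar>ln (Z V I \<phi>) - ln (Z V ?J \<phi>)\<bar> \<le> lip" "\<bar>ln (Z V I \<phi>') - ln (Z V ?J \<phi>')\<bar> \<le> lip"
    using ln_Z_insert[of ?J V i \<phi>] ln_Z_insert[of ?J V i \<phi>'] assms unfolding I by auto
  then show ?thesis unfolding eq by linarith
next
  case False
  have "Z V I \<phi> = Z V I \<phi>'" by (rule Z_cong) (use False assms(5) in \<open>force simp: slots_def\<close>)
  then show ?thesis using lip_nonneg by simp
qed

definition size_bd :: real where
  "size_bd = \<bar>ln (\<Sum>k<q. v k)\<bar> + r * lip"

lemma size_bd_nonneg: "0 \<le> size_bd"
  unfolding size_bd_def using lip_nonneg by simp

lemma ln_Z_bound:
  assumes "finite I" "finite V" "proper V I \<phi>" "card I \<le> card V * r"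
  shows "\<bar>ln (Z V I \<phi>)\<bar> \<le> size_bd * card V"
proof -
  have "\<bar>ln (Z V I \<phi>) - ln (Z V {} \<phi>)\<bar> \<le> lip * card I"
    using ln_Z_Un[of I "{}" V \<phi>] assms by simp
  moreover have "\<bar>ln (Z V {} \<phi>)\<bar> = card V * \<bar>ln (\<Sum>k<q. v k)\<bar>"
    using assms(2) sum_v_pos by (simp add: Z_empty ln_realpow abs_mult)
  moreover have "lip * card I \<le> lip * (card V * r)"
    using assms(4) lip_nonneg by (intro mult_left_mono) (auto simp flip: of_nat_mult)
  ultimately have "\<bar>ln (Z V I \<phi>)\<bar> \<le> card V * \<bar>ln (\<Sum>k<q. v k)\<bar> + lip * (card V * r)" by linarith
  then show ?thesis by (simp add: size_bd_def algebra_simps)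
qed

lemma edge_wt_spin_cong:
  assumes "\<And>s. s < K \<Longrightarrow> x (fst (fst (\<phi> (i, s)))) = y (fst (fst (\<phi> (i, s))))"
  shows "edge_wt x \<phi> i = edge_wt y \<phi> i"
  unfolding edge_wt_def viol_def hit_def using assms by simp

lemma Z_factor:
  assumes "finite V1" "finite V2" "V1 \<inter> V2 = {}" "finite I1" "finite I2" "I1 \<inter> I2 = {}"
    and "proper V1 I1 \<phi>" "proper V2 I2 \<phi>"
  shows "Z (V1 \<union> V2) (I1 \<union> I2) \<phi> = Z V1 I1 \<phi> * Z V2 I2 \<phi>"
proof -
  have bij: "bij_betw (\<lambda>(x, y). overwrite V2 x y) (spins V1 \<times> spins V2) (spins (V1 \<union> V2))"
  proof (rule bij_betw_byWitness[where f' = "\<lambda>x. (restrict x V1, restrict x V2)"])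
    show "\<forall>a\<in>spins V1 \<times> spins V2. (\<lambda>x. (restrict x V1, restrict x V2)) (case a of (x, y) \<Rightarrow> overwrite V2 x y) = a"
      using assms(3) by (auto simp: spins_def overwrite_def fun_eq_iff PiE_def extensional_def)
    show "\<forall>x\<in>spins (V1 \<union> V2). (case (restrict x V1, restrict x V2) of (x, y) \<Rightarrow> overwrite V2 x y) = x"
      by (auto simp: spins_def overwrite_def fun_eq_iff PiE_def extensional_def)
    show "(\<lambda>(x, y). overwrite V2 x y) ` (spins V1 \<times> spins V2) \<subseteq> spins (V1 \<union> V2)"
      proof (rule image_subsetI)
      fix a assume "a \<in> spins V1 \<times> spins V2"
      then show "(case a of (x, y) \<Rightarrow> overwrite V2 x y) \<in> spins (V1 \<union> V2)"
        using overwrite_in_PiE[of "fst a" V1 "\<lambda>_. {..<q}" "snd a" V2 "\<lambda>_. {..<q}"]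
        by (simp add: spins_def case_prod_unfold mem_Times_iff)
    qed
    show "(\<lambda>x. (restrict x V1, restrict x V2)) ` spins (V1 \<union> V2) \<subseteq> spins V1 \<times> spins V2"
      unfolding spins_def by auto
  qed
  have w: "wt (V1 \<union> V2) (I1 \<union> I2) \<phi> (overwrite V2 x y) = wt V1 I1 \<phi> x * wt V2 I2 \<phi> y" for x y
  proof -
    have "(\<Prod>u\<in>V1 \<union> V2. v (overwrite V2 x y u)) = (\<Prod>u\<in>V1. v (x u)) * (\<Prod>u\<in>V2. v (y u))"
      using assms(1-3) by (subst prod.union_disjoint) (auto intro!: arg_cong2[where f = "(*)"] prod.cong simp: overwrite_def)
    moreover have "edge_wt (overwrite V2 x y) \<phi> i = edge_wt x \<phi> i" if "i \<in> I1" for i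
      using proper_slot(1)[OF assms(7) that] assms(3) by (intro edge_wt_spin_cong) (auto simp: overwrite_def)
    moreover have "edge_wt (overwrite V2 x y) \<phi> i = edge_wt y \<phi> i" if "i \<in> I2" for i
      using proper_slot(1)[OF assms(8) that] by (intro edge_wt_spin_cong) (auto simp: overwrite_def)
    ultimately show ?thesis
      unfolding wt_def using assms(4-6) by (simp add: prod.union_disjoint)
  qed
  have "Z (V1 \<union> V2) (I1 \<union> I2) \<phi> = (\<Sum>p\<in>spins V1 \<times> spins V2. wt V1 I1 \<phi> (fst p) * wt V2 I2 \<phi> (snd p))"
    unfolding Z_def by (subst sum.reindex_bij_betw[OF bij, symmetric]) (auto intro!: sum.cong simp: w)
  also have "\<dots> = Z V1 I1 \<phi> * Z V2 I2 \<phi>"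
    unfolding Z_def sum_product by (simp add: sum.cartesian_product case_prod_unfold)
  finally show ?thesis .
qed

text \<open>The expected log-partition function when the edges \<open>I\<close> draw their points
  from \<open>V\<close> without replacement. It is that of the configuration model if
  \<open>card I * K = card V * r\<close>; with fewer edges some points stay unmatched.\<close>

definition Q :: "nat set \<Rightarrow> nat set \<Rightarrow> real" where
  "Q V I = avg (cfg (slots I) (\<lambda>_. points V)) (\<lambda>\<phi>. ln (Z V I \<phi>))"

lemma proper_cfg:
  "\<phi> \<in> cfg S B \<Longrightarrow> slots I \<subseteq> S \<Longrightarrow> (\<And>s. s \<in> slots I \<Longrightarrow> B s \<subseteq> points V) \<Longrightarrow> proper V I \<phi>"
  by (rule proper_PiE[OF cfg_PiE])

lemma Q_bound:
  assumes "finite I" "finite V" "card I \<le> card V * r"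
  shows "\<bar>Q V I\<bar> \<le> size_bd * card V"
  unfolding Q_def using assms size_bd_nonneg
  by (intro abs_avg_le ln_Z_bound) (auto intro: proper_cfg)

text \<open>The uniform placement of the larger slot set restricts to the uniform placement of
  \<open>slots I\<close>. Both means thus live on one space, and \<open>ln_Z_Un\<close> applies
  pointwise.\<close>

lemma Q_Un:
  assumes "finite I" "finite J" "finite V" "I \<inter> J = {}" "card (I \<union> J) * K \<le> card V * r"
  shows "\<bar>Q V (I \<union> J) - Q V I\<bar> \<le> lip * card J"
proof -
  have "Q V I = avg (cfg (slots (I \<union> J)) (\<lambda>_. points V)) (\<lambda>\<phi>. ln (Z V I \<phi>))"
    unfolding Q_def
  proof (rule avg_cfg_marginal[symmetric])
    show "ln (Z V I \<phi>) = ln (Z V I \<phi>')" if "\<And>s. s \<in> slots I \<Longrightarrow> \<phi> s = \<phi>' s" for \<phi> \<phi>'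
      using Z_cong[OF that] by simp
    show "finite (slots (I \<union> J))" using assms by (intro finite_slots) auto
    show "slots I \<subseteq> slots (I \<union> J)" by (rule slots_mono) auto
    show "tame (slots (I \<union> J)) (\<lambda>_. points V)" using assms by (intro tame_const finite_points)
    show "feasible (slots (I \<union> J)) (\<lambda>_. points V)"
      using assms by (intro feasible_const) (simp add: card_slots card_points)
  qed
  moreover have "\<bar>avg (cfg (slots (I \<union> J)) (\<lambda>_. points V)) (\<lambda>\<phi>. ln (Z V (I \<union> J) \<phi>)) -
      avg (cfg (slots (I \<union> J)) (\<lambda>_. points V)) (\<lambda>\<phi>. ln (Z V I \<phi>))\<bar> \<le> lip * card J"
    using assms lip_nonneg by (intro abs_avg_diff_le ln_Z_Un) (auto intro: proper_cfg)
  ultimately show ?thesis unfolding Q_def[of V "I \<union> J"] by simp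
qed

end

section \<open>Invariance under relabelling of slots, points, nodes and edges\<close>

lemma cfg_relabel:
  assumes h: "bij_betw h S' S" and k: "bij_betw k P P'" and \<phi>: "\<phi> \<in> cfg S (\<lambda>_. P)"
  shows "(\<lambda>s\<in>S'. (k (fst (\<phi> (h s))), snd (\<phi> (h s)))) \<in> cfg S' (\<lambda>_. P')"
proof -
  have hS: "h s \<in> S" if "s \<in> S'" for s using h that by (rule bij_betw_apply)
  have P: "fst (\<phi> (h s)) \<in> P" "snd (\<phi> (h s)) \<in> {0, 1}" if "s \<in> S'" for s
    using cfg_fst[OF \<phi> hS[OF that]] cfg_snd[OF \<phi> hS[OF that]] by auto
  have "inj_on (\<lambda>s. k (fst (\<phi> (h s)))) S'"
  proof (rule inj_onI)
    fix s t assume st: "s \<in> S'" "t \<in> S'" "k (fst (\<phi> (h s))) = k (fst (\<phi> (h t)))"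
    then have "fst (\<phi> (h s)) = fst (\<phi> (h t))"
      using inj_onD[OF bij_betw_imp_inj_on[OF k]] P(1) by blast
    then have "h s = h t" using inj_onD[OF cfg_inj[OF \<phi>]] hS st by blast
    then show "s = t" using inj_onD[OF bij_betw_imp_inj_on[OF h]] st by blast
  qed
  then have "inj_on (\<lambda>s. fst ((\<lambda>s\<in>S'. (k (fst (\<phi> (h s))), snd (\<phi> (h s)))) s)) S'"
    by (simp add: inj_on_def)
  moreover have "(\<lambda>s\<in>S'. (k (fst (\<phi> (h s))), snd (\<phi> (h s)))) \<in> PiE S' (\<lambda>_. P' \<times> {0, 1})"
    using P bij_betw_apply[OF k] by (auto simp: restrict_PiE_iff)
  ultimately show ?thesis unfolding cfg_def by simp
qed

lemma cfg_reindex: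
  assumes h: "bij_betw h S' S" and k: "bij_betw k P P'"
  shows "bij_betw (\<lambda>\<phi>. \<lambda>s\<in>S'. (k (fst (\<phi> (h s))), snd (\<phi> (h s)))) (cfg S (\<lambda>_. P)) (cfg S' (\<lambda>_. P'))"
proof -
  let ?h = "inv_into S' h" and ?k = "inv_into P k"
  have ih: "bij_betw ?h S S'" and ik: "bij_betw ?k P' P" using h k by (auto intro: bij_betw_inv_into)
  show ?thesis
  proof (rule bij_betw_byWitness[where f' = "\<lambda>\<phi>. \<lambda>s\<in>S. (?k (fst (\<phi> (?h s))), snd (\<phi> (?h s)))"])
    show "\<forall>\<phi>\<in>cfg S (\<lambda>_. P). (\<lambda>s\<in>S. (?k (fst ((\<lambda>s\<in>S'. (k (fst (\<phi> (h s))), snd (\<phi> (h s)))) (?h s))),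
        snd ((\<lambda>s\<in>S'. (k (fst (\<phi> (h s))), snd (\<phi> (h s)))) (?h s)))) = \<phi>"
    proof
      fix \<phi> assume \<phi>: "\<phi> \<in> cfg S (\<lambda>_. P)"
      show "(\<lambda>s\<in>S. (?k (fst ((\<lambda>s\<in>S'. (k (fst (\<phi> (h s))), snd (\<phi> (h s)))) (?h s))),
          snd ((\<lambda>s\<in>S'. (k (fst (\<phi> (h s))), snd (\<phi> (h s)))) (?h s)))) = \<phi>" (is "?l = \<phi>")
      proof
        fix s
        show "?l s = \<phi> s"
          using \<phi> cfg_fst[OF \<phi>, of s] bij_betw_apply[OF ih, of s] bij_betw_inv_into_right[OF h, of s]
            bij_betw_inv_into_left[OF k, of "fst (\<phi> s)"]
          by (cases "s \<in> S") (auto simp: cfg_def PiE_def extensional_def)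
      qed
    qed
    show "\<forall>\<phi>\<in>cfg S' (\<lambda>_. P'). (\<lambda>s\<in>S'. (k (fst ((\<lambda>s\<in>S. (?k (fst (\<phi> (?h s))), snd (\<phi> (?h s)))) (h s))),
        snd ((\<lambda>s\<in>S. (?k (fst (\<phi> (?h s))), snd (\<phi> (?h s)))) (h s)))) = \<phi>"
    proof
      fix \<phi> assume \<phi>: "\<phi> \<in> cfg S' (\<lambda>_. P')"
      show "(\<lambda>s\<in>S'. (k (fst ((\<lambda>s\<in>S. (?k (fst (\<phi> (?h s))), snd (\<phi> (?h s)))) (h s))),
        snd ((\<lambda>s\<in>S. (?k (fst (\<phi> (?h s))), snd (\<phi> (?h s)))) (h s)))) = \<phi>" (is "?l = \<phi>")
      proof
        fix s
        show "?l s = \<phi> s"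
          using \<phi> cfg_fst[OF \<phi>, of s] bij_betw_apply[OF h, of s] bij_betw_inv_into_left[OF h, of s]
            bij_betw_inv_into_right[OF k, of "fst (\<phi> s)"]
          by (cases "s \<in> S'") (auto simp: cfg_def PiE_def extensional_def)
      qed
    qed
    show "(\<lambda>\<phi>. \<lambda>s\<in>S'. (k (fst (\<phi> (h s))), snd (\<phi> (h s)))) ` cfg S (\<lambda>_. P) \<subseteq> cfg S' (\<lambda>_. P')"
      using cfg_relabel[OF h k] by blast
    show "(\<lambda>\<phi>. \<lambda>s\<in>S. (?k (fst (\<phi> (?h s))), snd (\<phi> (?h s)))) ` cfg S' (\<lambda>_. P') \<subseteq> cfg S (\<lambda>_. P)"
      using cfg_relabel[OF ih ik] by blast
  qed
qed

context spin_model
begin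

lemma Z_reindex:
  assumes f: "bij_betw f I I'" and g: "bij_betw g V V'" and "proper V I \<phi>"
    and \<phi>': "\<And>i s. i \<in> I \<Longrightarrow> s < K \<Longrightarrow> fst (fst (\<phi>' (f i, s))) = g (fst (fst (\<phi> (i, s)))) \<and> snd (\<phi>' (f i, s)) = snd (\<phi> (i, s))"
  shows "Z V' I' \<phi>' = Z V I \<phi>"
proof -
  let ?R = "\<lambda>x. \<lambda>u\<in>V. x (g u)" and ?g = "inv_into V g"
  have ig: "bij_betw ?g V' V" using g by (rule bij_betw_inv_into)
  have bij: "bij_betw ?R (spins V') (spins V)"
  proof (rule bij_betw_byWitness[where f' = "\<lambda>x. \<lambda>u\<in>V'. x (?g u)"])
    show "\<forall>x\<in>spins V'. (\<lambda>u\<in>V'. ?R x (?g u)) = x"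
      using bij_betw_apply[OF ig] bij_betw_inv_into_right[OF g]
      by (auto simp: spins_def fun_eq_iff PiE_def extensional_def)
    show "\<forall>x\<in>spins V. ?R (\<lambda>u\<in>V'. x (?g u)) = x"
      using bij_betw_apply[OF g] bij_betw_inv_into_left[OF g]
      by (auto simp: spins_def fun_eq_iff PiE_def extensional_def)
    show "?R ` spins V' \<subseteq> spins V" using bij_betw_apply[OF g] by (auto simp: spins_def)
    show "(\<lambda>x. \<lambda>u\<in>V'. x (?g u)) ` spins V \<subseteq> spins V'" using bij_betw_apply[OF ig] by (auto simp: spins_def)
  qed
  have "wt V I \<phi> (?R x) = wt V' I' \<phi>' x" for x
  proof -
    have "(\<Prod>u\<in>V'. v (x u)) = (\<Prod>u\<in>V. v (x (g u)))"
      by (rule prod.reindex_bij_betw[OF g, symmetric])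
    moreover have "(\<Prod>i\<in>I'. edge_wt x \<phi>' i) = (\<Prod>i\<in>I. edge_wt x \<phi>' (f i))"
      by (rule prod.reindex_bij_betw[OF f, symmetric])
    moreover have "edge_wt x \<phi>' (f i) = edge_wt (?R x) \<phi> i" if "i \<in> I" for i
    proof -
      have "hit t x (\<phi>' (f i, s)) = hit t (?R x) (\<phi> (i, s))" if "s < K" for t s
        using \<phi>'[OF \<open>i \<in> I\<close> that] proper_slot(1)[OF assms(3) \<open>i \<in> I\<close> that] by (simp add: hit_def)
      then show ?thesis by (simp add: edge_wt_def viol_def)
    qed
    ultimately show ?thesis unfolding wt_def by simp
  qed
  then show ?thesis unfolding Z_def by (simp add: sum.reindex_bij_betw[OF bij, symmetric])
qed

text \<open>Transport along bijections of nodes and edges. It turns the edge sets that the types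
  select, and the node set of the second part, into initial segments.\<close>

lemma Q_card:
  assumes "finite V" "finite V'" "card V = card V'" "finite I" "finite I'" "card I = card I'"
  shows "Q V I = Q V' I'"
proof -
  obtain f where f: "bij_betw f I I'" using assms finite_same_card_bij by blast
  obtain g where g: "bij_betw g V V'" using assms finite_same_card_bij by blast
  let ?f = "inv_into I f"
  have jf: "bij_betw ?f I' I" using f by (rule bij_betw_inv_into)
  let ?h = "\<lambda>(i, s). (?f i, s :: nat)" and ?k = "\<lambda>(u, a). (g u, a :: nat)"
  have h: "bij_betw ?h (slots I') (slots I)"
    unfolding slots_def by (rule bij_betw_byWitness[where f' = "\<lambda>(i, s). (f i, s)"])
      (auto simp: bij_betw_apply[OF f] bij_betw_apply[OF jf] bij_betw_inv_into_right[OF f] bij_betw_inv_into_left[OF f])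
  have k: "bij_betw ?k (points V) (points V')"
    unfolding points_def by (rule bij_betw_byWitness[where f' = "\<lambda>(u, a). (inv_into V g u, a)"])
      (auto simp: bij_betw_apply[OF g] bij_betw_apply[OF bij_betw_inv_into[OF g]]
        bij_betw_inv_into_right[OF g] bij_betw_inv_into_left[OF g])
  have "Q V' I' = avg (cfg (slots I) (\<lambda>_. points V))
      (\<lambda>\<phi>. ln (Z V' I' (\<lambda>s\<in>slots I'. (?k (fst (\<phi> (?h s))), snd (\<phi> (?h s))))))"
    unfolding Q_def by (rule avg_reindex[OF cfg_reindex[OF h k]])
  also have "\<dots> = Q V I"
    unfolding Q_def
  proof (intro avg_cong refl arg_cong[where f = ln] Z_reindex[OF f g])
    fix \<phi> assume "\<phi> \<in> cfg (slots I) (\<lambda>_. points V)"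
    then show "proper V I \<phi>" by (rule proper_cfg) auto
    fix i s assume "i \<in> I" "s < K"
    then show "fst (fst ((\<lambda>s\<in>slots I'. (?k (fst (\<phi> (?h s))), snd (\<phi> (?h s)))) (f i, s))) = g (fst (fst (\<phi> (i, s)))) \<and>
        snd ((\<lambda>s\<in>slots I'. (?k (fst (\<phi> (?h s))), snd (\<phi> (?h s)))) (f i, s)) = snd (\<phi> (i, s))"
      using bij_betw_apply[OF f] bij_betw_inv_into_left[OF f] by (auto simp: slots_def case_prod_unfold)
  qed
  finally show ?thesis ..
qed

end

section \<open>Convexity of the edge functional\<close>

text \<open>The convex cone generated by products with the same nonnegative factor in every slot.
  The common factor is what turns an independent average into a power of a single average.\<close>

inductive pos_kernel :: "'b set \<Rightarrow> (('b \<Rightarrow> 'y) \<Rightarrow> real) \<Rightarrow> bool" for E where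
  prod: "(\<And>y. 0 \<le> g y) \<Longrightarrow> pos_kernel E (\<lambda>y. \<Prod>b\<in>E. g (y b))"
| zero: "pos_kernel E (\<lambda>_. 0)"
| add: "pos_kernel E f \<Longrightarrow> pos_kernel E g \<Longrightarrow> pos_kernel E (\<lambda>y. f y + g y)"
| scale: "0 \<le> a \<Longrightarrow> pos_kernel E f \<Longrightarrow> pos_kernel E (\<lambda>y. a * f y)"

lemma pos_kernel_mult:
  assumes "pos_kernel E f" "pos_kernel E g"
  shows "pos_kernel E (\<lambda>y. f y * g y)"
  using assms(1)
proof induction
  case (prod h)
  show ?case using assms(2)
  proof induction
    case (prod g)
    have "pos_kernel E (\<lambda>y. \<Prod>b\<in>E. h (y b) * g (y b))"
      using prod \<open>\<And>y. 0 \<le> h y\<close> by (intro pos_kernel.prod[of "\<lambda>z. h z * g z"]) auto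
    then show ?case by (simp add: prod.distrib)
  next
    case zero
    show ?case using pos_kernel.zero by simp
  next
    case (add f g)
    then show ?case using pos_kernel.add[OF add.IH] by (simp add: distrib_left)
  next
    case (scale a f)
    then show ?case using pos_kernel.scale[OF scale.hyps(1) scale.IH] by (simp add: mult.left_commute)
  qed
next
  case zero
  show ?case using pos_kernel.zero by simp
next
  case (add f g)
  then show ?case using pos_kernel.add[OF add.IH] by (simp add: distrib_right)
next
  case (scale a f)
  then show ?case using pos_kernel.scale[OF scale.hyps(1) scale.IH] by (simp add: mult.assoc)
qed

lemma pos_kernel_power: "pos_kernel E f \<Longrightarrow> pos_kernel E (\<lambda>y. f y ^ n)"
proof (induction n)
  case 0
  show ?case using pos_kernel.prod[of "\<lambda>_. 1" E] by simp
next
  case (Suc n)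
  then show ?case using pos_kernel_mult by fastforce
qed

lemma pos_kernel_sum: "(\<And>a. a \<in> A \<Longrightarrow> pos_kernel E (f a)) \<Longrightarrow> pos_kernel E (\<lambda>y. \<Sum>a\<in>A. f a y)"
  by (induction A rule: infinite_finite_induct) (auto intro: pos_kernel.intros)

text \<open>The product structure of the kernel turns the average over independently chosen types into
  the power of an average, and the average over a common type into an average of powers.\<close>

lemma pos_kernel_type_average_le:
  assumes "pos_kernel E f" "finite E" "b0 \<in> E" "finite W" "W \<noteq> {}" "\<And>w. w \<in> W \<Longrightarrow> finite (C (ty w))"
  shows "avg (PiE E (\<lambda>_. W)) (\<lambda>u. avg (PiE E (\<lambda>b. C (ty (u b)))) f)
       \<le> avg (PiE E (\<lambda>_. W)) (\<lambda>u. avg (PiE E (\<lambda>b. C (ty (u b0)))) f)"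
  using assms(1)
proof induction
  case (prod g)
  let ?h = "\<lambda>w. avg (C (ty w)) g"
  have "avg (PiE E (\<lambda>_. W)) (\<lambda>u. avg (PiE E (\<lambda>b. C (ty (u b)))) (\<lambda>y. \<Prod>b\<in>E. g (y b))) =
      avg (PiE E (\<lambda>_. W)) (\<lambda>u. \<Prod>b\<in>E. ?h (u b))"
    using assms by (intro avg_cong refl avg_PiE_prod) auto
  also have "\<dots> = avg W ?h ^ card E"
    using assms by (subst avg_PiE_prod) auto
  also have "\<dots> \<le> avg W (\<lambda>w. ?h w ^ card E)"
    using assms prod by (intro power_avg_le avg_nonneg) auto
  also have "\<dots> = avg (PiE E (\<lambda>_. W)) (\<lambda>u. ?h (u b0) ^ card E)"
    using assms by (subst avg_PiE_component[where g = "\<lambda>w. ?h w ^ card E"]) auto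
  also have "\<dots> = avg (PiE E (\<lambda>_. W)) (\<lambda>u. avg (PiE E (\<lambda>b. C (ty (u b0)))) (\<lambda>y. \<Prod>b\<in>E. g (y b)))"
    using assms by (intro avg_cong refl) (subst avg_PiE_prod, auto)
  finally show ?case .
next
  case zero
  then show ?case by simp
next
  case (add f g)
  then show ?case by (simp add: avg_add add_mono)
next
  case (scale a f)
  then show ?case by (simp add: avg_mult_left mult_left_mono)
qed

text \<open>The partial sums of - ln (1 - f) = \<Sum> f^k / k lie in the cone, since it is closed
  under products. The inequality for kernels passes to the limit, and the sign reverses it.\<close>

lemma pos_kernel_type_average_ln:
  assumes "pos_kernel E f" "finite E" "b0 \<in> E" "finite W" "W \<noteq> {}" "\<And>w. w \<in> W \<Longrightarrow> finite (C (ty w))"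
    and f: "\<And>y. y \<in> PiE E (\<lambda>_. \<Union>w\<in>W. C (ty w)) \<Longrightarrow> 0 \<le> f y \<and> f y < 1"
  shows "avg (PiE E (\<lambda>_. W)) (\<lambda>u. avg (PiE E (\<lambda>b. C (ty (u b0)))) (\<lambda>y. ln (1 - f y)))
       \<le> avg (PiE E (\<lambda>_. W)) (\<lambda>u. avg (PiE E (\<lambda>b. C (ty (u b)))) (\<lambda>y. ln (1 - f y)))"
proof -
  \<comment> \<open>The term for \<open>k = 0\<close> vanishes because
    \<open>1 / 0 = 0\<close>.\<close>
  define F where "F n y = (\<Sum>k<n. (1 / real k) * f y ^ k)" for n y
  have pk: "pos_kernel E (F n)" for n
    unfolding F_def by (intro pos_kernel_sum pos_kernel.scale pos_kernel_power assms(1)) auto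
  have lim: "(\<lambda>n. F n y) \<longlonglongrightarrow> - ln (1 - f y)" if "y \<in> PiE E (\<lambda>_. \<Union>w\<in>W. C (ty w))" for y
  proof -
    have "(\<lambda>n. - ((- (- f y)) ^ n) / real n) sums ln (1 + (- f y))"
      using f[OF that] by (intro Complex_Transcendental.ln_series') auto
    then have "(\<lambda>n. (1 / real n) * f y ^ n) sums - ln (1 - f y)"
      using sums_minus by fastforce
    then show ?thesis unfolding F_def sums_def .
  qed
  have sub: "y \<in> PiE E (\<lambda>_. \<Union>w\<in>W. C (ty w))"
    if "u \<in> PiE E (\<lambda>_. W)" "y \<in> PiE E (\<lambda>b. C (ty (u (h b))))" "\<And>b. b \<in> E \<Longrightarrow> h b \<in> E" for u y h
    using that by (auto simp: PiE_iff)
  have "avg (PiE E (\<lambda>_. W)) (\<lambda>u. avg (PiE E (\<lambda>b. C (ty (u b)))) (\<lambda>y. - ln (1 - f y)))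
       \<le> avg (PiE E (\<lambda>_. W)) (\<lambda>u. avg (PiE E (\<lambda>b. C (ty (u b0)))) (\<lambda>y. - ln (1 - f y)))"
  proof (rule LIMSEQ_le)
    show "(\<lambda>n. avg (PiE E (\<lambda>_. W)) (\<lambda>u. avg (PiE E (\<lambda>b. C (ty (u b)))) (F n))) \<longlonglongrightarrow>
        avg (PiE E (\<lambda>_. W)) (\<lambda>u. avg (PiE E (\<lambda>b. C (ty (u b)))) (\<lambda>y. - ln (1 - f y)))"
      by (intro avg_tendsto lim) (rule sub[where h = "\<lambda>b. b"], auto)
    show "(\<lambda>n. avg (PiE E (\<lambda>_. W)) (\<lambda>u. avg (PiE E (\<lambda>b. C (ty (u b0)))) (F n))) \<longlonglongrightarrow>
        avg (PiE E (\<lambda>_. W)) (\<lambda>u. avg (PiE E (\<lambda>b. C (ty (u b0)))) (\<lambda>y. - ln (1 - f y)))"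
      by (intro avg_tendsto lim) (rule sub[where h = "\<lambda>b. b0"], use assms(3) in auto)
    show "\<exists>N. \<forall>n\<ge>N. avg (PiE E (\<lambda>_. W)) (\<lambda>u. avg (PiE E (\<lambda>b. C (ty (u b)))) (F n))
        \<le> avg (PiE E (\<lambda>_. W)) (\<lambda>u. avg (PiE E (\<lambda>b. C (ty (u b0)))) (F n))"
      using pos_kernel_type_average_le[OF pk assms(2-5), of C ty, OF assms(6)] by blast
  qed
  then show ?thesis by (simp add: avg_uminus)
qed

context spin_model
begin

text \<open>With the other edges fixed, the partition function is an affine function of the new
  edge's violation under the Gibbs measure of the rest, so its logarithm is a constant plus ln (1 -
  f) with f in the cone.\<close>

lemma edge_interpolation:
  assumes "finite I" "i \<notin> I" "finite V" "proper V I \<phi>" "b0 \<in> slots {i}"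
    and W: "finite W" "W \<noteq> {}" "\<And>w. w \<in> W \<Longrightarrow> finite (C (ty w))" "\<And>w. w \<in> W \<Longrightarrow> C (ty w) \<noteq> {}"
      "\<And>w. w \<in> W \<Longrightarrow> C (ty w) \<subseteq> points V \<times> {0, 1}"
  defines "E \<equiv> slots {i}"
  shows "avg (PiE E (\<lambda>_. W)) (\<lambda>u. avg (PiE E (\<lambda>b. C (ty (u b0)))) (\<lambda>y. ln (Z V (insert i I) (overwrite E \<phi> y))))
       \<le> avg (PiE E (\<lambda>_. W)) (\<lambda>u. avg (PiE E (\<lambda>b. C (ty (u b)))) (\<lambda>y. ln (Z V (insert i I) (overwrite E \<phi> y))))"
proof -
  have finE: "finite E" unfolding E_def by (simp add: finite_slots)
  define Z0 where "Z0 = Z V I \<phi>"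
  have Z0: "Z0 > 0" unfolding Z0_def using assms by (intro Z_pos)
  \<comment> \<open>\<open>wt V I \<phi> x / Z0\<close> is the Gibbs probability of \<open>x\<close>
    without edge \<open>i\<close>, so \<open>f y\<close> is \<open>c\<close> times the mean
    violation.\<close>
  define f where "f y = c * (\<Sum>x\<in>spins V. wt V I \<phi> x / Z0 * (\<Sum>t\<in>T. \<Prod>b\<in>E. hit t x (y b)))" for y
  have pk: "pos_kernel E f"
    unfolding f_def using c_nonneg Z0 wt_nonneg[OF assms(4)]
    by (intro pos_kernel.scale pos_kernel_sum pos_kernel.prod) (auto simp: hit_bounds)
  let ?Y = "PiE E (\<lambda>_. \<Union>w\<in>W. C (ty w))"
  have eq: "Z V (insert i I) (overwrite E \<phi> y) = \<alpha> * Z0 * (1 - f y)" for y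
  proof -
    have w: "wt V I (overwrite E \<phi> y) x = wt V I \<phi> x" for x
      unfolding wt_def using assms(2)
      by (intro arg_cong2[where f = "(*)"] refl prod.cong edge_wt_cong)
         (auto simp: overwrite_def E_def slots_def)
    have prodE: "(\<Prod>s<K. hit t x (overwrite E \<phi> y (i, s))) = (\<Prod>b\<in>E. hit t x (y b))" for t x
    proof -
      have "bij_betw (\<lambda>s. (i, s)) {..<K} E"
        unfolding E_def slots_def by (intro bij_betw_imageI) (auto simp: inj_on_def)
      from prod.reindex_bij_betw[OF this, of "\<lambda>b. hit t x (y b)"]
      show ?thesis by (auto simp: overwrite_def E_def slots_def intro!: prod.cong)
    qed
    have "Z V (insert i I) (overwrite E \<phi> y) =
        (\<Sum>x\<in>spins V. \<alpha> * (wt V I \<phi> x - c * (wt V I \<phi> x * (\<Sum>t\<in>T. \<Prod>b\<in>E. hit t x (y b)))))"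
      unfolding Z_def wt_insert[OF assms(1,2)] w edge_wt_def viol_def prodE
      by (intro sum.cong refl) (simp add: algebra_simps)
    also have "\<dots> = \<alpha> * (Z0 - c * (\<Sum>x\<in>spins V. wt V I \<phi> x * (\<Sum>t\<in>T. \<Prod>b\<in>E. hit t x (y b))))"
      unfolding Z0_def Z_def by (simp only: sum_subtractf sum_distrib_left[symmetric])
    also have "(\<Sum>x\<in>spins V. wt V I \<phi> x * (\<Sum>t\<in>T. \<Prod>b\<in>E. hit t x (y b))) =
        Z0 * (\<Sum>x\<in>spins V. wt V I \<phi> x / Z0 * (\<Sum>t\<in>T. \<Prod>b\<in>E. hit t x (y b)))"
      using Z0 by (simp add: sum_distrib_left)
    finally show ?thesis by (simp add: f_def algebra_simps)
  qed
  have f: "0 \<le> f y \<and> f y < 1" if y: "y \<in> ?Y" for y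
  proof
    show "0 \<le> f y"
      unfolding f_def using c_nonneg Z0 wt_nonneg[OF assms(4)]
      by (intro mult_nonneg_nonneg sum_nonneg prod_nonneg divide_nonneg_nonneg) (auto simp: hit_bounds)
    have "proper V (insert i I) (overwrite E \<phi> y)"
      unfolding proper_def
    proof
      fix s assume s: "s \<in> slots (insert i I)"
      show "fst (fst (overwrite E \<phi> y s)) \<in> V \<and> snd (overwrite E \<phi> y s) \<in> {0, 1}"
      proof (cases "s \<in> E")
        case True
        then have "y s \<in> points V \<times> {0, 1}" using y W(5) by (auto dest!: PiE_mem[of y])
        then show ?thesis using True by (auto simp: overwrite_def points_def)
      next
        case False
        then have "s \<in> slots I" using s by (auto simp: E_def slots_def)
        then show ?thesis using False assms(4) by (auto simp: overwrite_def proper_def)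
      qed
    qed
    \<comment> \<open>Strictness of \<open>f y < 1\<close> comes from positivity of the partition
      function, which also covers \<open>c = 1\<close>.\<close>
    then have "0 < Z V (insert i I) (overwrite E \<phi> y)" using assms by (intro Z_pos) auto
    then show "f y < 1" unfolding eq using zero_less_mult_pos[of "\<alpha> * Z0" "1 - f y"] mult_pos_pos[OF \<alpha>_pos Z0] by linarith
  qed
  have ln_eq: "ln (Z V (insert i I) (overwrite E \<phi> y)) = ln (\<alpha> * Z0) + ln (1 - f y)" if "y \<in> ?Y" for y
    unfolding eq using f[OF that] \<alpha>_pos Z0 by (subst ln_mult) auto
  have sub: "y \<in> ?Y"
    if "u \<in> PiE E (\<lambda>_. W)" "y \<in> PiE E (\<lambda>b. C (ty (u (h b))))" "\<And>b. b \<in> E \<Longrightarrow> h b \<in> E" for u y h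
    using that by (auto simp: PiE_iff)
  have b0: "b0 \<in> E" using assms(5) by (simp add: E_def)
  have shift: "avg (PiE E (\<lambda>_. W)) (\<lambda>u. avg (PiE E (\<lambda>b. C (ty (u (h b))))) (\<lambda>y. ln (Z V (insert i I) (overwrite E \<phi> y)))) =
     ln (\<alpha> * Z0) + avg (PiE E (\<lambda>_. W)) (\<lambda>u. avg (PiE E (\<lambda>b. C (ty (u (h b))))) (\<lambda>y. ln (1 - f y)))"
    if h: "\<And>b. b \<in> E \<Longrightarrow> h b \<in> E" for h
  proof -
    have "avg (PiE E (\<lambda>b. C (ty (u (h b))))) (\<lambda>y. ln (Z V (insert i I) (overwrite E \<phi> y))) =
        ln (\<alpha> * Z0) + avg (PiE E (\<lambda>b. C (ty (u (h b))))) (\<lambda>y. ln (1 - f y))" if u: "u \<in> PiE E (\<lambda>_. W)" for u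
    proof -
      have uW: "u (h b) \<in> W" if "b \<in> E" for b using u h[OF that] by (auto dest: PiE_mem)
      have "avg (PiE E (\<lambda>b. C (ty (u (h b))))) (\<lambda>y. ln (Z V (insert i I) (overwrite E \<phi> y))) =
          avg (PiE E (\<lambda>b. C (ty (u (h b))))) (\<lambda>y. ln (\<alpha> * Z0) + ln (1 - f y))"
        by (intro avg_cong refl ln_eq sub[OF u _ h]) auto
      also have "\<dots> = ln (\<alpha> * Z0) + avg (PiE E (\<lambda>b. C (ty (u (h b))))) (\<lambda>y. ln (1 - f y))"
        unfolding avg_add using uW W(3,4) finE
        by (subst avg_const) (auto intro!: finite_PiE simp: PiE_eq_empty_iff)
      finally show ?thesis .
    qed
    then have "avg (PiE E (\<lambda>_. W)) (\<lambda>u. avg (PiE E (\<lambda>b. C (ty (u (h b))))) (\<lambda>y. ln (Z V (insert i I) (overwrite E \<phi> y)))) =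
       avg (PiE E (\<lambda>_. W)) (\<lambda>u. ln (\<alpha> * Z0) + avg (PiE E (\<lambda>b. C (ty (u (h b))))) (\<lambda>y. ln (1 - f y)))"
      by (intro avg_cong refl) auto
    also have "\<dots> = ln (\<alpha> * Z0) + avg (PiE E (\<lambda>_. W)) (\<lambda>u. avg (PiE E (\<lambda>b. C (ty (u (h b))))) (\<lambda>y. ln (1 - f y)))"
      unfolding avg_add using W(1,2) finE
      by (subst avg_const) (auto intro!: finite_PiE simp: PiE_eq_empty_iff)
    finally show ?thesis .
  qed
  show ?thesis
    using shift[of "\<lambda>_. b0"] shift[of "\<lambda>b. b"] b0
      pos_kernel_type_average_ln[OF pk finE b0 W(1,2), of C ty, OF W(3) f] by simp
qed

end

section \<open>Interpolation between one system and two parts\<close>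

text \<open>The number 6 is 3 times 2. By balance each part has at least a third of all points, so a
  reserve of 6z leaves on average at least 2z free points in each part. A fluctuation of less than z
  then still leaves z, and \<open>K \<le> z\<close> leaves room for a whole edge.\<close>

locale two_parts = spin_model +
  fixes V1 V2 :: "nat set" and n z :: nat
  assumes fin: "finite V1" "finite V2" and disj: "V1 \<inter> V2 = {}"
    and balanced: "card V1 \<le> 2 * card V2" "card V2 \<le> 2 * card V1"
    and z_ge: "K \<le> z" and reserve: "n * K + 6 * z \<le> (card V1 + card V2) * r"
begin

abbreviation V where "V \<equiv> V1 \<union> V2"
abbreviation P where "P \<equiv> points V"
abbreviation S where "S \<equiv> slots {..<n}"

definition A :: "bool \<Rightarrow> (nat \<times> nat) set" where
  "A j = points (if j then V1 else V2)"

definition side :: "(nat \<times> nat) \<times> nat \<Rightarrow> bool" where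
  "side y \<longleftrightarrow> fst (fst y) \<in> V1"

text \<open>Given the other edges, the type copied from the first slot has the distribution of the type
  of each slot that it replaces; the convexity argument needs nothing else about these weights.\<close>

definition ty :: "nat \<Rightarrow> (nat \<times> nat \<Rightarrow> (nat \<times> nat) \<times> nat) \<Rightarrow> nat \<times> nat \<Rightarrow> bool" where
  "ty k \<sigma> s = side (\<sigma> (if fst s < k then (fst s, 0) else s))"

text \<open>The conditional mean of the logarithm given the types. If a part has too few points no
  placement exists and the value is 0, which is harmless on an event of small probability.\<close>

definition F :: "(nat \<times> nat \<Rightarrow> bool) \<Rightarrow> real" where
  "F \<tau> = avg (cfg S (\<lambda>s. A (\<tau> s))) (\<lambda>\<phi>. ln (Z V {..<n} \<phi>))"

text \<open>Here \<sigma> is read only for its types; the points are drawn afresh inside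
  \<open>F\<close>. At \<open>k = 0\<close> this is the unsplit system, at \<open>k = n\<close> no
  edge crosses the parts.\<close>

definition mean_F :: "nat \<Rightarrow> real" where
  "mean_F k = avg (cfg S (\<lambda>_. P)) (\<lambda>\<sigma>. F (ty k \<sigma>))"

definition good :: "(nat \<times> nat) set \<Rightarrow> (nat \<times> nat \<Rightarrow> bool) \<Rightarrow> bool" where
  "good U \<tau> \<longleftrightarrow> (\<forall>j. card {s \<in> U. \<tau> s = j} + z \<le> card (A j))"

lemma z_pos: "0 < z"
  using z_ge K_pos by simp

lemma fin_V: "finite V" and card_V: "card V = card V1 + card V2"
  using fin disj by (auto simp: card_Un_disjoint)

lemma finite_A: "finite (A j)" and A_subset: "A j \<subseteq> P"
  using fin by (auto simp: A_def points_def)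

lemma A_disjoint: "i \<noteq> j \<Longrightarrow> A i \<inter> A j = {}"
  using disj by (auto simp: A_def points_def)

lemma tame_A: "tame U (\<lambda>s. A (\<tau> s))"
  unfolding tame_def
proof (intro conjI ballI)
  show "A (\<tau> s) = A (\<tau> t) \<or> A (\<tau> s) \<inter> A (\<tau> t) = {}" for s t
    using A_disjoint[of "\<tau> s" "\<tau> t"] by (cases "\<tau> s = \<tau> t") simp_all
qed (rule finite_A)

lemma n_le: "n \<le> card V * r"
proof -
  have "n * 1 \<le> n * K" using K_pos by (intro mult_left_mono) auto
  then have "n \<le> n * K" by simp
  also have "\<dots> \<le> card V * r" using reserve by (simp add: card_V)
  finally show ?thesis .
qed

lemma fst_in_A: "y \<in> P \<times> {0, 1} \<Longrightarrow> fst y \<in> A j \<longleftrightarrow> side y = j"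
  using disj by (cases y) (auto simp: A_def side_def points_def)

lemma proper_A: "\<phi> \<in> PiE U (\<lambda>s. A (\<tau> s) \<times> {0, 1}) \<Longrightarrow> slots I \<subseteq> U \<Longrightarrow> proper V I \<phi>"
  by (rule proper_PiE) (use A_subset in auto)

lemma F_bound: "\<bar>F \<tau>\<bar> \<le> size_bd * card V"
  unfolding F_def using fin_V n_le size_bd_nonneg
  by (intro abs_avg_le ln_Z_bound) (auto intro: proper_A[OF cfg_PiE])

lemma S_feasible: "card S \<le> card P"
  using reserve by (simp add: card_slots card_points card_V)

lemma cfg_P: "finite (cfg S (\<lambda>_. P))" "cfg S (\<lambda>_. P) \<noteq> {}"
proof -
  show "finite (cfg S (\<lambda>_. P))" using fin_V by (intro finite_cfg finite_slots finite_points) auto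
  show "cfg S (\<lambda>_. P) \<noteq> {}"
    using fin_V S_feasible by (intro cfg_nonempty finite_slots tame_const finite_points feasible_const) auto
qed

text \<open>Redrawing points and labels uniformly given the types of all slots preserves the uniform
  law, by \<open>avg_class\<close> with the type vector as class.\<close>

lemma mean_F_0: "mean_F 0 = Q V {..<n}"
proof -
  let ?k = "\<lambda>\<sigma>. \<lambda>s\<in>S. side (\<sigma> s)"
  have "mean_F 0 = avg (cfg S (\<lambda>_. P)) (\<lambda>\<sigma>. avg {\<phi> \<in> cfg S (\<lambda>_. P). ?k \<phi> = ?k \<sigma>} (\<lambda>\<phi>. ln (Z V {..<n} \<phi>)))"
    unfolding mean_F_def F_def
  proof (intro avg_cong refl)
    fix \<sigma> assume "\<sigma> \<in> cfg S (\<lambda>_. P)"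
    have iff: "fst y \<in> A (ty 0 \<sigma> s) \<longleftrightarrow> side y = side (\<sigma> s)" if "y \<in> P \<times> {0, 1}" for y s
      using fst_in_A[OF that] by (simp add: ty_def)
    show "cfg S (\<lambda>s. A (ty 0 \<sigma> s)) = {\<phi> \<in> cfg S (\<lambda>_. P). ?k \<phi> = ?k \<sigma>}"
    proof (intro equalityI subsetI)
      fix \<phi> assume \<phi>: "\<phi> \<in> cfg S (\<lambda>s. A (ty 0 \<sigma> s))"
      then have \<phi>': "\<phi> \<in> cfg S (\<lambda>_. P)" using A_subset by (fastforce simp: cfg_def PiE_iff)
      moreover have "side (\<phi> s) = side (\<sigma> s)" if "s \<in> S" for s
        using iff[of "\<phi> s" s] cfg_fst[OF \<phi> that] PiE_mem[OF cfg_PiE[OF \<phi>'] that] by auto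
      ultimately show "\<phi> \<in> {\<phi> \<in> cfg S (\<lambda>_. P). ?k \<phi> = ?k \<sigma>}" by (auto simp: fun_eq_iff)
    next
      fix \<phi> assume "\<phi> \<in> {\<phi> \<in> cfg S (\<lambda>_. P). ?k \<phi> = ?k \<sigma>}"
      then have \<phi>: "\<phi> \<in> cfg S (\<lambda>_. P)" and eq: "?k \<phi> = ?k \<sigma>" by auto
      have "side (\<phi> s) = side (\<sigma> s)" if "s \<in> S" for s using fun_cong[OF eq, of s] that by simp
      then have "\<phi> s \<in> A (ty 0 \<sigma> s) \<times> {0, 1}" if "s \<in> S" for s
        using iff[of "\<phi> s" s] PiE_mem[OF cfg_PiE[OF \<phi>] that] that by (auto simp: mem_Times_iff)
      then show "\<phi> \<in> cfg S (\<lambda>s. A (ty 0 \<sigma> s))" using \<phi> by (auto simp: cfg_def PiE_iff)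
    qed
  qed
  also have "\<dots> = Q V {..<n}"
    unfolding Q_def using fin_V by (intro avg_class finite_cfg finite_slots finite_points) auto
  finally show ?thesis .
qed

section \<open>One interpolation step: edge k starts to copy the type of its first slot\<close>

context
  fixes k :: nat
  assumes k: "k < n"
begin

abbreviation I' where "I' \<equiv> {..<n} - {k}"
abbreviation S' where "S' \<equiv> slots I'"
abbreviation E where "E \<equiv> slots {k}"

definition unused :: "(nat \<times> nat \<Rightarrow> (nat \<times> nat) \<times> nat) \<Rightarrow> bool \<Rightarrow> ((nat \<times> nat) \<times> nat) set" where
  "unused \<phi> j = (A j - used \<phi> S') \<times> {0, 1}"

text \<open>The variant of \<open>F\<close> in which the slots of edge \<open>k\<close> are drawn
  independently from what the other edges leave free. This is the form to which the convexity
  inequality applies.\<close>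

definition R :: "(nat \<times> nat \<Rightarrow> bool) \<Rightarrow> real" where
  "R \<tau> = avg (cfg S' (\<lambda>s. A (\<tau> s))) (\<lambda>\<phi>. avg (PiE E (\<lambda>b. unused \<phi> (\<tau> b)))
     (\<lambda>y. ln (Z V {..<n} (overwrite E \<phi> y))))"

lemma I_eq: "insert k I' = {..<n}"
  using k by auto

lemma S_eq: "S' \<union> E = S" and S_disj: "S' \<inter> E = {}"
  using k by (auto simp: slots_def)

lemma fin_E: "finite E" and fin_S': "finite S'" and card_E: "card E = K"
  by (auto simp: finite_slots card_slots)

lemma good_A_eq:
  assumes "good U \<tau>"
  shows "A i = A j \<longleftrightarrow> i = j"
proof
  have "card (A i) > 0" using assms z_pos unfolding good_def by (metis add_leD2 less_le_trans)
  then have "A i \<noteq> {}" by auto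
  then show "i = j" if "A i = A j" using A_disjoint[of i j] that by (metis Int_absorb)
qed auto

lemma osc_ln_Z:
  assumes "\<phi> \<in> PiE (S' \<union> E) (\<lambda>s. A (\<tau> s) \<times> {0, 1})" "\<phi>' \<in> PiE (S' \<union> E) (\<lambda>s. A (\<tau> s) \<times> {0, 1})"
    "\<And>s. s \<notin> E \<Longrightarrow> \<phi> s = \<phi>' s"
  shows "\<bar>ln (Z V {..<n} \<phi>) - ln (Z V {..<n} \<phi>')\<bar> \<le> 2 * lip"
proof (rule ln_Z_change)
  show "proper V {..<n} \<phi>" "proper V {..<n} \<phi>'"
    by (rule proper_A[OF assms(1)] proper_A[OF assms(2)], simp add: S_eq)+
  show "\<phi> (j, s) = \<phi>' (j, s)" if "j \<noteq> k" for j s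
    using that by (intro assms(3)) (auto simp: slots_def)
qed (use fin_V in auto)

lemma F_approx:
  assumes g: "good S' \<tau>"
  shows "\<bar>F \<tau> - R \<tau>\<bar> \<le> 2 * lip * K\<^sup>2 / z"
proof -
  have "\<bar>avg (cfg (S' \<union> E) (\<lambda>s. A (\<tau> s))) (\<lambda>\<phi>. ln (Z V {..<n} \<phi>)) -
      avg (cfg S' (\<lambda>s. A (\<tau> s))) (\<lambda>\<phi>. avg (PiE E (\<lambda>b. (A (\<tau> b) - used \<phi> S') \<times> {0, 1}))
      (\<lambda>y. ln (Z V {..<n} (overwrite E \<phi> y))))\<bar> \<le> 2 * lip * (real (card E))\<^sup>2 / z"
  proof (rule avg_cfg_replacement)
    show "card {s \<in> S'. A (\<tau> s) = A (\<tau> b)} + z \<le> card (A (\<tau> b))" for b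
      using g unfolding good_A_eq[OF g] good_def by auto
    show "card E \<le> z" using z_ge card_E by simp
    show "0 \<le> 2 * lip" using lip_nonneg by simp
  qed (use fin_E fin_S' S_disj tame_A osc_ln_Z z_pos in auto)
  then show ?thesis unfolding F_def R_def unused_def S_eq card_E by simp
qed

lemma unused_props:
  assumes g: "good S' \<tau>" and \<phi>: "\<phi> \<in> cfg S' (\<lambda>s. A (\<tau> s))"
  shows "finite (unused \<phi> j)" "unused \<phi> j \<noteq> {}" "unused \<phi> j \<subseteq> P \<times> {0, 1}"
proof -
  show "finite (unused \<phi> j)" "unused \<phi> j \<subseteq> P \<times> {0, 1}"
    unfolding unused_def using finite_A A_subset by auto
  have "A j \<inter> used \<phi> S' \<subseteq> used \<phi> {s \<in> S'. \<tau> s = j}"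
  proof
    fix p assume "p \<in> A j \<inter> used \<phi> S'"
    then obtain s where s: "s \<in> S'" "p = fst (\<phi> s)" "p \<in> A j" by auto
    then have "\<tau> s = j" using cfg_fst[OF \<phi> s(1)] A_disjoint[of "\<tau> s" j] by blast
    then show "p \<in> used \<phi> {s \<in> S'. \<tau> s = j}" using s by auto
  qed
  then have "card (A j \<inter> used \<phi> S') \<le> card (used \<phi> {s \<in> S'. \<tau> s = j})"
    using fin_S' by (intro card_mono) auto
  also have "\<dots> \<le> card {s \<in> S'. \<tau> s = j}" using fin_S' by (intro card_image_le) auto
  also have "\<dots> < card (A j)" using spec[OF g[unfolded good_def], of j] z_pos by linarith
  finally have "A j \<inter> used \<phi> S' \<noteq> A j" by auto
  then show "unused \<phi> j \<noteq> {}" unfolding unused_def by auto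
qed

text \<open>Compares with the system without edge \<open>k\<close>, which does not see the types on
  \<open>E\<close>. Hence altering those types moves \<open>R\<close> by a constant independent of
  the system size.\<close>

lemma R_close:
  assumes g: "good S' \<tau>"
  shows "\<bar>R \<tau> - avg (cfg S' (\<lambda>s. A (\<tau> s))) (\<lambda>\<phi>. ln (Z V I' \<phi>))\<bar> \<le> lip"
  unfolding R_def
proof (rule abs_avg_diff_le[OF _ lip_nonneg])
  fix \<phi> assume \<phi>: "\<phi> \<in> cfg S' (\<lambda>s. A (\<tau> s))"
  let ?Y = "PiE E (\<lambda>b. unused \<phi> (\<tau> b))"
  have Y: "finite ?Y" "?Y \<noteq> {}"
    using unused_props[OF g \<phi>] fin_E by (auto intro: finite_PiE simp: PiE_eq_empty_iff)
  have "\<bar>avg ?Y (\<lambda>y. ln (Z V {..<n} (overwrite E \<phi> y))) - avg ?Y (\<lambda>_. ln (Z V I' \<phi>))\<bar> \<le> lip"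
  proof (rule abs_avg_diff_le[OF _ lip_nonneg])
    fix y assume y: "y \<in> ?Y"
    have "overwrite E \<phi> y \<in> PiE (S' \<union> E) (\<lambda>s. A (\<tau> s) \<times> {0, 1})"
      using cfg_PiE[OF \<phi>] y by (rule overwrite_in_PiE) (auto simp: unused_def)
    then have "proper V (insert k I') (overwrite E \<phi> y)" by (rule proper_A) (simp only: I_eq S_eq order_refl)
    then have "\<bar>ln (Z V (insert k I') (overwrite E \<phi> y)) - ln (Z V I' (overwrite E \<phi> y))\<bar> \<le> lip"
      using fin_V by (intro ln_Z_insert) auto
    moreover have "Z V I' (overwrite E \<phi> y) = Z V I' \<phi>"
      by (rule Z_cong) (use S_disj in \<open>auto simp: overwrite_def\<close>)
    ultimately show "\<bar>ln (Z V {..<n} (overwrite E \<phi> y)) - ln (Z V I' \<phi>)\<bar> \<le> lip" unfolding I_eq by simp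
  qed
  then show "\<bar>avg ?Y (\<lambda>y. ln (Z V {..<n} (overwrite E \<phi> y))) - ln (Z V I' \<phi>)\<bar> \<le> lip"
    using Y by (simp add: avg_const)
qed

lemma R_diff:
  assumes "good S' \<tau>" "\<And>s. s \<in> S' \<Longrightarrow> \<tau> s = \<tau>' s"
  shows "\<bar>R \<tau> - R \<tau>'\<bar> \<le> 2 * lip"
proof -
  have "{s \<in> S'. \<tau> s = j} = {s \<in> S'. \<tau>' s = j}" for j using assms(2) by auto
  then have "good S' \<tau>'" using assms(1) by (simp add: good_def)
  moreover have "cfg S' (\<lambda>s. A (\<tau> s)) = cfg S' (\<lambda>s. A (\<tau>' s))" using assms(2) by (intro cfg_cong) auto
  ultimately show ?thesis using R_close[OF assms(1)] R_close[of \<tau>'] by simp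
qed

lemma ty_S': "s \<in> S' \<Longrightarrow> ty (Suc k) \<sigma> s = ty k \<sigma> s"
  by (auto simp: ty_def slots_def)

lemma ty_cong:
  assumes "\<And>s. s \<notin> E \<Longrightarrow> \<sigma> s = \<sigma>' s" "s \<in> S'"
  shows "ty k \<sigma> s = ty k \<sigma>' s"
proof -
  have "(if fst s < k then (fst s, 0) else s) \<notin> E" using assms(2) by (auto simp: slots_def)
  then show ?thesis using assms(1) by (simp add: ty_def)
qed

lemma good_cong: "(\<And>s. s \<in> S' \<Longrightarrow> \<tau> s = \<tau>' s) \<Longrightarrow> good S' \<tau> \<longleftrightarrow> good S' \<tau>'"
proof -
  assume "\<And>s. s \<in> S' \<Longrightarrow> \<tau> s = \<tau>' s"
  then have "{s \<in> S'. \<tau> s = j} = {s \<in> S'. \<tau>' s = j}" for j by auto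
  then show ?thesis by (simp add: good_def)
qed

text \<open>The gain of the step with independent points on edge \<open>k\<close>. The cutoff sees
  only types outside that edge, so it is constant while the types of the edge are averaged, and it
  keeps the gain bounded by \<open>2 * lip\<close>.\<close>

definition G :: "(nat \<times> nat \<Rightarrow> (nat \<times> nat) \<times> nat) \<Rightarrow> real" where
  "G \<sigma> = of_bool (good S' (ty k \<sigma>)) * (R (ty k \<sigma>) - R (ty (Suc k) \<sigma>))"

lemma G_bound: "\<bar>G \<sigma>\<bar> \<le> 2 * lip"
  using R_diff[of "ty k \<sigma>" "ty (Suc k) \<sigma>"] ty_S' lip_nonneg by (auto simp: G_def)

text \<open>On good types \<open>F_approx\<close> is used twice, which gives the coefficient 4;
  otherwise both values of \<open>F\<close> are bounded trivially.\<close>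

lemma F_diff_ge:
  "F (ty k \<sigma>) - F (ty (Suc k) \<sigma>) \<ge> G \<sigma> - 4 * lip * K\<^sup>2 / z - 2 * size_bd * card V * of_bool (\<not> good S' (ty k \<sigma>))"
proof (cases "good S' (ty k \<sigma>)")
  case True
  then have "good S' (ty (Suc k) \<sigma>)" using good_cong[of "ty (Suc k) \<sigma>" "ty k \<sigma>"] ty_S' by simp
  then show ?thesis using F_approx[OF True] F_approx[of "ty (Suc k) \<sigma>"] True by (simp add: G_def abs_le_iff)
next
  case False
  have "0 \<le> 4 * lip * K\<^sup>2 / z" using lip_nonneg by simp
  then show ?thesis using False F_bound[of "ty k \<sigma>"] F_bound[of "ty (Suc k) \<sigma>"]
    by (simp add: G_def abs_le_iff)
qed

lemma avg_G_edge:
  assumes \<sigma>: "\<sigma> \<in> cfg S' (\<lambda>_. P)"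
  shows "0 \<le> avg (PiE E (\<lambda>b. (P - used \<sigma> S') \<times> {0, 1})) (\<lambda>u. G (overwrite E \<sigma> u))"
proof (cases "good S' (ty k \<sigma>)")
  case False
  have "\<not> good S' (ty k (overwrite E \<sigma> u))" for u
    using False good_cong[of "ty k (overwrite E \<sigma> u)" "ty k \<sigma>"] ty_cong[of "overwrite E \<sigma> u" \<sigma>]
    by (simp add: overwrite_def)
  then show ?thesis by (simp add: G_def)
next
  case True
  let ?W = "(P - used \<sigma> S') \<times> {0, 1 :: nat}" and ?C = "cfg S' (\<lambda>s. A (ty k \<sigma> s))"
  have tS': "ty k (overwrite E \<sigma> u) s = ty k \<sigma> s" if "s \<in> S'" for u s
    using that by (intro ty_cong) (auto simp: overwrite_def)
  then have good: "good S' (ty k (overwrite E \<sigma> u))" for u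
    using True good_cong[of "ty k (overwrite E \<sigma> u)" "ty k \<sigma>"] by simp
  have cC: "cfg S' (\<lambda>s. A (ty k (overwrite E \<sigma> u) s)) = ?C" "cfg S' (\<lambda>s. A (ty (Suc k) (overwrite E \<sigma> u) s)) = ?C" for u
    using tS' ty_S' by (auto intro!: cfg_cong)
  have b0: "(k, 0) \<in> E" using K_pos by (simp add: slots_def)
  have tE: "ty k (overwrite E \<sigma> u) b = side (u b)" "ty (Suc k) (overwrite E \<sigma> u) b = side (u (k, 0))" if "b \<in> E" for u b
    using that b0 by (auto simp: ty_def overwrite_def slots_def)
  let ?f = "\<lambda>\<phi> y. ln (Z V {..<n} (overwrite E \<phi> y))"
  have "PiE E (\<lambda>b. unused \<phi> (ty k (overwrite E \<sigma> u) b)) = PiE E (\<lambda>b. unused \<phi> (side (u b)))"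
    "PiE E (\<lambda>b. unused \<phi> (ty (Suc k) (overwrite E \<sigma> u) b)) = PiE E (\<lambda>b. unused \<phi> (side (u (k, 0))))" for \<phi> u
    using tE by (auto intro!: PiE_cong)
  then have R_eq: "R (ty k (overwrite E \<sigma> u)) = avg ?C (\<lambda>\<phi>. avg (PiE E (\<lambda>b. unused \<phi> (side (u b)))) (?f \<phi>))"
    "R (ty (Suc k) (overwrite E \<sigma> u)) = avg ?C (\<lambda>\<phi>. avg (PiE E (\<lambda>b. unused \<phi> (side (u (k, 0))))) (?f \<phi>))" for u
    unfolding R_def cC by simp_all
  have "card S' < card P"
  proof -
    have "card I' = n - 1" using k by simp
    then have "card S' = (n - 1) * K" by (simp add: card_slots)
    also have "\<dots> < n * K" using k K_pos by simp
    also have "\<dots> \<le> card P" using S_feasible by (simp add: card_slots)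
    finally show ?thesis .
  qed
  then have "card (used \<sigma> S') < card P" using card_image_le[OF fin_S', of "\<lambda>s. fst (\<sigma> s)"] by linarith
  then have "P - used \<sigma> S' \<noteq> {}" using fin_S' by (metis card_mono Diff_eq_empty_iff finite_imageI not_le)
  then have W: "finite ?W" "?W \<noteq> {}" using fin_V by (auto simp: finite_points)
  have "avg (PiE E (\<lambda>_. ?W)) (\<lambda>u. R (ty (Suc k) (overwrite E \<sigma> u))) \<le> avg (PiE E (\<lambda>_. ?W)) (\<lambda>u. R (ty k (overwrite E \<sigma> u)))"
    unfolding R_eq avg_swap[of "PiE E (\<lambda>_. ?W)" ?C]
  proof (rule avg_mono)
    fix \<phi> assume \<phi>: "\<phi> \<in> ?C"
    have "proper V I' \<phi>" using cfg_PiE[OF \<phi>] by (rule proper_A) simp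
    then show "avg (PiE E (\<lambda>_. ?W)) (\<lambda>u. avg (PiE E (\<lambda>b. unused \<phi> (side (u (k, 0))))) (?f \<phi>))
        \<le> avg (PiE E (\<lambda>_. ?W)) (\<lambda>u. avg (PiE E (\<lambda>b. unused \<phi> (side (u b)))) (?f \<phi>))"
      using edge_interpolation[of I' k V \<phi> "(k, 0)" ?W "unused \<phi>" side] W fin_V b0 unused_props[OF True \<phi>]
      unfolding I_eq by blast
  qed
  moreover have "avg (PiE E (\<lambda>b. ?W)) (\<lambda>u. G (overwrite E \<sigma> u)) =
      avg (PiE E (\<lambda>_. ?W)) (\<lambda>u. R (ty k (overwrite E \<sigma> u)) - R (ty (Suc k) (overwrite E \<sigma> u)))"
    unfolding G_def using good by simp
  ultimately show ?thesis by (simp add: avg_diff)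
qed

text \<open>A second use of the replacement lemma, now for the placement that provides the types;
  the oscillation of \<open>G\<close> is at most \<open>4 * lip\<close>.\<close>

lemma avg_G: "- (4 * lip * K\<^sup>2 / z) \<le> avg (cfg S (\<lambda>_. P)) G"
proof -
  have "\<bar>avg (cfg (S' \<union> E) (\<lambda>_. P)) G - avg (cfg S' (\<lambda>_. P)) (\<lambda>\<sigma>. avg (PiE E (\<lambda>b. (P - used \<sigma> S') \<times> {0, 1}))
      (\<lambda>u. G (overwrite E \<sigma> u)))\<bar> \<le> 4 * lip * (real (card E))\<^sup>2 / z"
  proof (rule avg_cfg_replacement)
    have "card S' \<le> card S" using S_eq by (intro card_mono finite_slots) auto
    moreover have "card S + z \<le> card P" using reserve by (simp add: card_slots card_points card_V)
    ultimately show "card {s \<in> S'. P = P} + z \<le> card P" by simp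
    show "\<bar>G \<phi> - G \<phi>'\<bar> \<le> 4 * lip" for \<phi> \<phi>' using G_bound[of \<phi>] G_bound[of \<phi>'] by linarith
  qed (use fin_E fin_S' S_disj fin_V z_pos z_ge card_E lip_nonneg in \<open>auto intro: tame_const finite_points\<close>)
  moreover have "0 \<le> avg (cfg S' (\<lambda>_. P)) (\<lambda>\<sigma>. avg (PiE E (\<lambda>b. (P - used \<sigma> S') \<times> {0, 1})) (\<lambda>u. G (overwrite E \<sigma> u)))"
    by (intro avg_nonneg avg_G_edge)
  ultimately show ?thesis unfolding S_eq card_E of_nat_power by linarith
qed

lemma mean_F_step:
  "mean_F (Suc k) \<le> mean_F k + 8 * lip * K\<^sup>2 / z +
     2 * size_bd * card V * avg (cfg S (\<lambda>_. P)) (\<lambda>\<sigma>. of_bool (\<not> good S' (ty k \<sigma>)))"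
proof -
  have "avg (cfg S (\<lambda>_. P)) (\<lambda>\<sigma>. G \<sigma> - 4 * lip * K\<^sup>2 / z - 2 * size_bd * card V * of_bool (\<not> good S' (ty k \<sigma>)))
      \<le> avg (cfg S (\<lambda>_. P)) (\<lambda>\<sigma>. F (ty k \<sigma>) - F (ty (Suc k) \<sigma>))"
    by (intro avg_mono F_diff_ge)
  then show ?thesis
    unfolding avg_diff avg_mult_left avg_const[OF cfg_P] mean_F_def[symmetric] using avg_G by (simp add: algebra_simps)
qed

end

end

section \<open>Concentration of the type counts and summation of the steps\<close>

context two_parts
begin

lemma card_A: "card (A j) = card (if j then V1 else V2) * r"
  by (simp add: A_def card_points)

lemma card_A_ge: "card P \<le> 3 * card (A j)"
proof -
  have "card V \<le> 3 * card (if j then V1 else V2)" using balanced by (simp add: card_V)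
  then have "card V * r \<le> 3 * card (if j then V1 else V2) * r" by (rule mult_right_mono) simp
  then show ?thesis by (simp only: card_points card_A mult.assoc)
qed

text \<open>A copied type is still the type of a single uniformly placed slot, so the mean type
  counts do not change along the interpolation.\<close>

lemma avg_ty:
  assumes "s \<in> S"
  shows "avg (cfg S (\<lambda>_. P)) (\<lambda>\<sigma>. of_bool (ty k \<sigma> s = j)) = card (A j) / card P"
proof -
  define s0 where "s0 = (if fst s < k then (fst s, 0) else s)"
  have s0: "s0 \<in> S" using assms K_pos by (auto simp: s0_def slots_def)
  have "avg (cfg S (\<lambda>_. P)) (\<lambda>\<sigma>. of_bool (ty k \<sigma> s = j)) = avg (cfg {s0} (\<lambda>_. P)) (\<lambda>\<sigma>. of_bool (side (\<sigma> s0) = j))"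
    unfolding ty_def s0_def[symmetric]
    using s0 fin_V S_feasible by (intro avg_cfg_marginal finite_slots tame_const finite_points feasible_const) auto
  also have "\<dots> = avg (P \<times> {0, 1}) (\<lambda>y. of_bool (side y = j))"
    using avg_cfg_insert[of "{}" s0 "\<lambda>_. P"] fin_V by (simp add: tame_const finite_points)
  also have "\<dots> = card (A j \<times> {0 :: nat, 1}) / card (P \<times> {0 :: nat, 1})"
  proof -
    have "P \<times> {0, 1} \<inter> {y. side y = j} = A j \<times> {0, 1}"
    proof (intro equalityI subsetI)
      fix y assume "y \<in> P \<times> {0, 1} \<inter> {y. side y = j}"
      then show "y \<in> A j \<times> {0, 1}" using fst_in_A[of y j] by (simp add: mem_Times_iff)
    next
      fix y :: "(nat \<times> nat) \<times> nat" assume y: "y \<in> A j \<times> {0, 1}"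
      then have "y \<in> P \<times> {0, 1}" using A_subset by (auto simp: mem_Times_iff)
      then show "y \<in> P \<times> {0, 1} \<inter> {y. side y = j}" using fst_in_A[of y j] y by (simp add: mem_Times_iff)
    qed
    then show ?thesis using fin_V by (simp add: avg_def sum_of_bool_eq finite_points)
  qed
  also have "\<dots> = card (A j) / card P" by (simp add: card_cartesian_product)
  finally show ?thesis .
qed

text \<open>Through copying, one slot may determine the types of its whole edge. Altering two slots
  therefore affects only the slots of at most two edges, at most \<open>2 * K\<close> of
  them.\<close>

lemma bounded_diff_count:
  assumes "U \<subseteq> S"
  shows "bounded_diff S P (\<lambda>\<sigma>. real (card {s \<in> U. ty k \<sigma> s = j})) (2 * K)"
proof (rule bounded_diffI)
  fix \<phi> \<phi>' :: "nat \<times> nat \<Rightarrow> (nat \<times> nat) \<times> nat" and s t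
  assume *: "\<And>u. u \<noteq> s \<Longrightarrow> u \<noteq> t \<Longrightarrow> \<phi> u = \<phi>' u"
  have finU: "finite U" using assms finite_slots[of "{..<n}"] finite_subset by blast
  have le: "card {u \<in> U. ty k \<psi> u = j} \<le> card {u \<in> U. ty k \<psi>' u = j} + 2 * K"
    if eq: "\<And>u. u \<noteq> s \<Longrightarrow> u \<noteq> t \<Longrightarrow> \<psi> u = \<psi>' u" for \<psi> \<psi>' :: "nat \<times> nat \<Rightarrow> (nat \<times> nat) \<times> nat"
  proof -
    have "{u \<in> U. ty k \<psi> u = j} \<subseteq> {u \<in> U. ty k \<psi>' u = j} \<union> slots {fst s, fst t}"
    proof
      fix u assume u: "u \<in> {u \<in> U. ty k \<psi> u = j}"
      show "u \<in> {u \<in> U. ty k \<psi>' u = j} \<union> slots {fst s, fst t}"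
      proof (cases "fst u \<in> {fst s, fst t}")
        case True
        moreover have "u \<in> S" using u assms by auto
        ultimately show ?thesis by (auto simp: slots_def)
      next
        case False
        then have "\<psi> (if fst u < k then (fst u, 0) else u) = \<psi>' (if fst u < k then (fst u, 0) else u)"
          by (intro eq) auto
        then show ?thesis using u by (simp add: ty_def)
      qed
    qed
    then have "card {u \<in> U. ty k \<psi> u = j} \<le> card ({u \<in> U. ty k \<psi>' u = j} \<union> slots {fst s, fst t})"
      using finU by (intro card_mono) (auto simp: finite_slots)
    also have "\<dots> \<le> card {u \<in> U. ty k \<psi>' u = j} + card (slots {fst s, fst t})" by (rule card_Un_le)
    also have "card (slots {fst s, fst t}) \<le> 2 * K" by (simp add: card_slots card_insert_if)
    finally show ?thesis by simp
  qed
  have "card {u \<in> U. ty k \<phi> u = j} \<le> card {u \<in> U. ty k \<phi>' u = j} + 2 * K"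
    "card {u \<in> U. ty k \<phi>' u = j} \<le> card {u \<in> U. ty k \<phi> u = j} + 2 * K"
    using * by (auto intro!: le)
  then show "\<bar>real (card {s \<in> U. ty k \<phi> s = j}) - real (card {s \<in> U. ty k \<phi>' s = j})\<bar> \<le> real (2 * K)"
    by linarith
qed

text \<open>The value of \<open>cfg_tail\<close> at deviation \<open>z\<close>, with difference
  constant \<open>2 * K\<close> and \<open>card V * r\<close> points.\<close>

definition tail :: real where
  "tail = exp (- (real z)\<^sup>2 / (2 * (real K)\<^sup>2 * (card V * r)))"

lemma bad_tail:
  assumes "U \<subseteq> S"
  shows "avg (cfg S (\<lambda>_. P)) (\<lambda>\<sigma>. of_bool (\<not> good U (ty k \<sigma>))) \<le> 2 * tail"
proof -
  let ?f = "\<lambda>j \<sigma>. real (card {s \<in> U. ty k \<sigma> s = j})"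
  let ?\<mu> = "\<lambda>j. avg (cfg S (\<lambda>_. P)) (?f j)"
  have finU: "finite U" using assms finite_slots[of "{..<n}"] finite_subset by blast
  have P_pos: "0 < card P"
  proof -
    have "0 < 6 * z" using z_pos by simp
    also have "\<dots> \<le> card P" using reserve by (simp add: card_points card_V)
    finally show ?thesis .
  qed
  have cU: "real (card U) + 6 * z \<le> card P"
  proof -
    have "card U \<le> card S" using assms by (intro card_mono) (auto simp: finite_slots)
    then have "card U + 6 * z \<le> card P" using reserve by (simp add: card_slots card_points card_V)
    then show ?thesis by linarith
  qed
  have \<mu>: "?\<mu> j = card U * (card (A j) / card P)" for j
  proof -
    have "?f j \<sigma> = (\<Sum>s\<in>U. of_bool (ty k \<sigma> s = j))" for \<sigma>
      using finU by (simp add: sum_of_bool_eq Int_def)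
    then have "?\<mu> j = (\<Sum>s\<in>U. avg (cfg S (\<lambda>_. P)) (\<lambda>\<sigma>. of_bool (ty k \<sigma> s = j)))"
      by (simp only: avg_sum)
    also have "\<dots> = (\<Sum>s\<in>U. card (A j) / card P)" using assms avg_ty by (intro sum.cong) auto
    finally show ?thesis by simp
  qed
  \<comment> \<open>The mean count stays \<open>2 * z\<close> below the capacity of the part, so
    running short of \<open>z\<close> free points is a deviation of at least
    \<open>z\<close>.\<close>
  have dev: "z \<le> ?f j \<sigma> - ?\<mu> j" if "\<not> card {s \<in> U. ty k \<sigma> s = j} + z \<le> card (A j)" for j \<sigma>
  proof -
    have "2 * real z * card P \<le> 2 * real z * (3 * card (A j))"
      using card_A_ge[of j] by (intro mult_left_mono) linarith+
    also have "\<dots> = card (A j) * (6 * real z)" by simp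
    also have "\<dots> \<le> card (A j) * (real (card P) - card U)" using cU by (intro mult_left_mono) linarith+
    also have "\<dots> = (card (A j) - ?\<mu> j) * card P" unfolding \<mu> using P_pos by (simp add: field_simps)
    finally have "2 * real z \<le> card (A j) - ?\<mu> j" using P_pos by simp
    then show ?thesis using that by linarith
  qed
  have tail_j: "avg (cfg S (\<lambda>_. P)) (\<lambda>\<sigma>. of_bool (z \<le> ?f j \<sigma> - ?\<mu> j)) \<le> tail" for j
  proof -
    have "avg (cfg S (\<lambda>_. P)) (\<lambda>\<sigma>. of_bool (z \<le> ?f j \<sigma> - ?\<mu> j)) \<le> exp (- 2 * (real z)\<^sup>2 / ((real (2 * K))\<^sup>2 * card P))"
    proof (rule cfg_tail)
      show "(real (2 * K))\<^sup>2 * real (card S) \<le> (real (2 * K))\<^sup>2 * real (card P)"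
        using S_feasible by (intro mult_left_mono) auto
      show "0 < (real (2 * K))\<^sup>2 * real (card P)" using P_pos K_pos by simp
      show "bounded_diff S P (\<lambda>\<sigma>. real (card {s \<in> U. ty k \<sigma> s = j})) (real (2 * K))"
        using bounded_diff_count[OF assms] by simp
    qed (use fin_V S_feasible z_pos in \<open>auto simp: finite_slots finite_points\<close>)
    also have "\<dots> = tail" by (simp add: tail_def card_points power_mult_distrib)
    finally show ?thesis .
  qed
  have "avg (cfg S (\<lambda>_. P)) (\<lambda>\<sigma>. of_bool (\<not> good U (ty k \<sigma>))) \<le>
      avg (cfg S (\<lambda>_. P)) (\<lambda>\<sigma>. of_bool (z \<le> ?f True \<sigma> - ?\<mu> True) + of_bool (z \<le> ?f False \<sigma> - ?\<mu> False))"
  proof (rule avg_mono)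
    fix \<sigma>
    show "of_bool (\<not> good U (ty k \<sigma>)) \<le>
        (of_bool (z \<le> ?f True \<sigma> - ?\<mu> True) + of_bool (z \<le> ?f False \<sigma> - ?\<mu> False) :: real)"
    proof (cases "good U (ty k \<sigma>)")
      case False
      then obtain j where "\<not> card {s \<in> U. ty k \<sigma> s = j} + z \<le> card (A j)" unfolding good_def by blast
      then have "z \<le> ?f j \<sigma> - ?\<mu> j" by (rule dev)
      then show ?thesis by (cases j) simp_all
    qed simp
  qed
  also have "\<dots> \<le> 2 * tail" unfolding avg_add using tail_j[of True] tail_j[of False] by linarith
  finally show ?thesis .
qed

lemma mean_F_le:
  assumes "k \<le> n"
  shows "mean_F k \<le> mean_F 0 + k * (8 * lip * K\<^sup>2 / z + 4 * size_bd * card V * tail)"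
  using assms
proof (induction k)
  case 0
  then show ?case by simp
next
  case (Suc k)
  then have kn: "k < n" by simp
  have "2 * size_bd * card V * avg (cfg S (\<lambda>_. P)) (\<lambda>\<sigma>. of_bool (\<not> good (slots ({..<n} - {k})) (ty k \<sigma>)))
      \<le> 2 * size_bd * card V * (2 * tail)"
    using size_bd_nonneg by (intro mult_left_mono bad_tail slots_mono) auto
  then have "mean_F (Suc k) \<le> mean_F k + 8 * lip * K\<^sup>2 / z + 2 * size_bd * card V * (2 * tail)"
    using mean_F_step[OF kn] by linarith
  moreover have "mean_F k \<le> mean_F 0 + k * (8 * lip * K\<^sup>2 / z + 4 * size_bd * card V * tail)"
    using Suc by simp
  ultimately show ?case by (simp add: distrib_right)
qed

text \<open>All slots of an edge share a type, so the partition function factorises, and each factor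
  is averaged over a uniform placement in its part. \<open>good\<close> keeps the edge counts below
  \<open>M1\<close> and \<open>M2\<close>; restoring the missing edges costs \<open>lip\<close>
  each.\<close>

lemma F_split:
  assumes \<tau>: "\<And>i s. i < n \<Longrightarrow> s < K \<Longrightarrow> \<tau> (i, s) = t i" and g: "good S \<tau>"
    and M: "M1 * K = card V1 * r" "M2 * K = card V2 * r"
  shows "Q V1 {..<M1} + Q V2 {..<M2} - lip * (real M1 + real M2 - real n) \<le> F \<tau>"
proof -
  define I where "I j = {i. i < n \<and> t i = j}" for j
  define W where "W j = (if j then V1 else V2)" for j
  define MM where "MM j = (if j then M1 else M2)" for j
  have finI: "finite (I j)" for j by (simp add: I_def)
  have finW: "finite (W j)" for j using fin by (simp add: W_def)
  have A_W: "A j = points (W j)" for j by (simp add: A_def W_def)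
  have MMW: "MM j * K = card (W j) * r" for j using M by (simp add: MM_def W_def)
  have Iun: "I True \<union> I False = {..<n}" "I True \<inter> I False = {}" by (auto simp: I_def)
  have slots_I: "slots (I j) = {s \<in> S. \<tau> s = j}" for j
    using \<tau> by (auto simp: slots_def I_def)
  have I_le: "card (I j) \<le> MM j" for j
  proof -
    have "card (I j) * K \<le> card (A j)" using spec[OF g[unfolded good_def], of j] slots_I[of j, symmetric]
      by (simp add: card_slots)
    also have "\<dots> = MM j * K" by (simp add: A_W card_points MMW)
    finally show ?thesis using K_pos by simp
  qed
  have feas: "feasible S (\<lambda>s. A (\<tau> s))"
    unfolding feasible_def
  proof
    fix b
    have "A i = A j \<longleftrightarrow> i = j" for i j
    proof
      have "0 < card (A i)" using spec[OF g[unfolded good_def], of i] z_pos by linarith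
      then have "A i \<noteq> {}" by auto
      then show "i = j" if "A i = A j" using A_disjoint[of i j] that by (metis Int_absorb)
    qed simp
    then show "card {s \<in> S. A (\<tau> s) = A (\<tau> b)} \<le> card (A (\<tau> b))"
      using spec[OF g[unfolded good_def], of "\<tau> b"] by simp
  qed
  have W_proper: "proper (W j) (I j) \<phi>" if "\<phi> \<in> cfg S (\<lambda>s. A (\<tau> s))" for \<phi> j
    using that
  proof (rule proper_cfg)
    show "slots (I j) \<subseteq> S" using slots_I by auto
    show "A (\<tau> s) \<subseteq> points (W j)" if "s \<in> slots (I j)" for s
      using that unfolding slots_I by (simp add: A_W)
  qed
  have "F \<tau> = avg (cfg S (\<lambda>s. A (\<tau> s))) (\<lambda>\<phi>. ln (Z (W True) (I True) \<phi>) + ln (Z (W False) (I False) \<phi>))"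
    unfolding F_def
  proof (intro avg_cong refl)
    fix \<phi> assume \<phi>: "\<phi> \<in> cfg S (\<lambda>s. A (\<tau> s))"
    have "Z (W True \<union> W False) (I True \<union> I False) \<phi> = Z (W True) (I True) \<phi> * Z (W False) (I False) \<phi>"
      using disj by (intro Z_factor finW finI Iun(2) W_proper[OF \<phi>]) (simp add: W_def)
    then have "Z V {..<n} \<phi> = Z (W True) (I True) \<phi> * Z (W False) (I False) \<phi>"
      unfolding Iun(1) by (simp add: W_def)
    then show "ln (Z V {..<n} \<phi>) = ln (Z (W True) (I True) \<phi>) + ln (Z (W False) (I False) \<phi>)"
      using Z_pos[OF finI finW W_proper[OF \<phi>], of True] Z_pos[OF finI finW W_proper[OF \<phi>], of False]
      by (simp add: ln_mult)
  qed
  also have "\<dots> = Q (W True) (I True) + Q (W False) (I False)"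
  proof -
    have "avg (cfg S (\<lambda>s. A (\<tau> s))) (\<lambda>\<phi>. ln (Z (W j) (I j) \<phi>)) = Q (W j) (I j)" for j
    proof -
      have "avg (cfg S (\<lambda>s. A (\<tau> s))) (\<lambda>\<phi>. ln (Z (W j) (I j) \<phi>)) =
          avg (cfg (slots (I j)) (\<lambda>s. A (\<tau> s))) (\<lambda>\<phi>. ln (Z (W j) (I j) \<phi>))"
      proof (rule avg_cfg_marginal[OF _ _ tame_A feas])
        show "slots (I j) \<subseteq> S" using slots_I by auto
        show "ln (Z (W j) (I j) \<phi>) = ln (Z (W j) (I j) \<phi>')" if "\<And>s. s \<in> slots (I j) \<Longrightarrow> \<phi> s = \<phi>' s" for \<phi> \<phi>'
          using Z_cong[OF that] by simp
      qed (simp add: finite_slots)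
      also have "cfg (slots (I j)) (\<lambda>s. A (\<tau> s)) = cfg (slots (I j)) (\<lambda>_. points (W j))"
        by (rule cfg_cong[OF refl]) (auto simp: slots_I A_W)
      finally show ?thesis by (simp add: Q_def)
    qed
    then show ?thesis by (simp add: avg_add)
  qed
  finally have F_eq: "F \<tau> = Q (W True) (I True) + Q (W False) (I False)" .
  have Q_ge: "Q (W j) {..<MM j} - lip * (real (MM j) - real (card (I j))) \<le> Q (W j) (I j)" for j
  proof -
    let ?m = "card (I j)"
    have un: "{..<?m} \<union> {?m..<MM j} = {..<MM j}" using I_le[of j] by auto
    have "\<bar>Q (W j) ({..<?m} \<union> {?m..<MM j}) - Q (W j) {..<?m}\<bar> \<le> lip * card {?m..<MM j}"
      by (rule Q_Un) (use finW un MMW[of j] in auto)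
    moreover have "Q (W j) {..<?m} = Q (W j) (I j)" using finW finI by (intro Q_card) auto
    ultimately show ?thesis using I_le[of j] unfolding un by (simp add: of_nat_diff abs_le_iff)
  qed
  have "card (I True) + card (I False) = n"
    using Iun finI by (metis card_Un_disjoint card_lessThan)
  then have "real n = card (I True) + card (I False)" by simp
  then show ?thesis using Q_ge[of True] Q_ge[of False] F_eq
    by (simp add: W_def MM_def algebra_simps)
qed

lemma mean_F_n_ge:
  assumes M: "M1 * K = card V1 * r" "M2 * K = card V2 * r" and "n \<le> M1 + M2"
  shows "Q V1 {..<M1} + Q V2 {..<M2} - lip * (real M1 + real M2 - real n) - 4 * size_bd * card V * tail \<le> mean_F n"
proof -
  let ?L = "Q V1 {..<M1} + Q V2 {..<M2} - lip * (real M1 + real M2 - real n)"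
  have M_le: "M1 \<le> card V1 * r" "M2 \<le> card V2 * r"
    using M K_pos by (metis le_square mult.right_neutral mult_le_mono2 Suc_leI One_nat_def)+
  have pt: "?L - 2 * size_bd * card V * of_bool (\<not> good S (ty n \<sigma>)) \<le> F (ty n \<sigma>)" for \<sigma>
  proof (cases "good S (ty n \<sigma>)")
    case True
    have "?L \<le> F (ty n \<sigma>)"
      by (rule F_split[OF _ True M, where t = "\<lambda>i. side (\<sigma> (i, 0))"]) (simp add: ty_def)
    then show ?thesis using True by simp
  next
    case False
    have "\<bar>Q V1 {..<M1}\<bar> \<le> size_bd * card V1" "\<bar>Q V2 {..<M2}\<bar> \<le> size_bd * card V2"
      using fin M_le by (auto intro!: Q_bound)
    moreover have "0 \<le> lip * (real M1 + real M2 - real n)"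
      using assms(3) lip_nonneg by (intro mult_nonneg_nonneg) linarith+
    ultimately show ?thesis using False F_bound[of "ty n \<sigma>"]
      by (simp add: card_V algebra_simps abs_le_iff)
  qed
  have "avg (cfg S (\<lambda>_. P)) (\<lambda>\<sigma>. ?L - 2 * size_bd * card V * of_bool (\<not> good S (ty n \<sigma>))) \<le> mean_F n"
    unfolding mean_F_def by (intro avg_mono pt)
  moreover have "2 * size_bd * card V * avg (cfg S (\<lambda>_. P)) (\<lambda>\<sigma>. of_bool (\<not> good S (ty n \<sigma>))) \<le> 2 * size_bd * card V * (2 * tail)"
    using size_bd_nonneg by (intro mult_left_mono bad_tail) auto
  ultimately show ?thesis unfolding avg_diff avg_mult_left avg_const[OF cfg_P] by linarith
qed

text \<open>The reserve edges are paid for twice, once when removed from the whole system and once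
  when restored in the parts. The \<open>n\<close> steps contribute one tail term each, and the
  final split contributes one more.\<close>

lemma Q_superadditive_bound:
  assumes M: "M1 * K = card V1 * r" "M2 * K = card V2 * r" and "n \<le> M1 + M2"
  shows "Q V1 {..<M1} + Q V2 {..<M2} \<le> Q V {..<M1 + M2} + 2 * lip * (real M1 + real M2 - real n) +
    n * (8 * lip * K\<^sup>2 / z) + (real n + 1) * (4 * size_bd * card V * tail)"
proof -
  have "\<bar>Q V ({..<n} \<union> {n..<M1 + M2}) - Q V {..<n}\<bar> \<le> lip * card {n..<M1 + M2}"
    using M fin_V assms(3) by (intro Q_Un) (auto simp: ivl_disj_un_one card_V distrib_right)
  moreover have "{..<n} \<union> {n..<M1 + M2} = {..<M1 + M2}" using assms(3) by auto
  ultimately have "Q V {..<n} \<le> Q V {..<M1 + M2} + lip * (real M1 + real M2 - real n)"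
    using assms(3) by (simp add: of_nat_diff abs_le_iff)
  moreover have "n * (8 * lip * K\<^sup>2 / z + 4 * size_bd * card V * tail) + 4 * size_bd * card V * tail =
      n * (8 * lip * K\<^sup>2 / z) + (real n + 1) * (4 * size_bd * card V * tail)"
    by (simp add: algebra_simps)
  ultimately show ?thesis using mean_F_n_ge[OF assms] mean_F_le[of n] unfolding mean_F_0 by simp
qed

end

text \<open>The fourth power is chosen because y will be at least of order N^(1/2): its fourth power
  N^2 beats the number of steps times the trivial bound. The constant is 256 = 4^4.\<close>

lemma exp_minus_le_power4: "0 < y \<Longrightarrow> exp (- y) \<le> 256 / (y :: real) ^ 4"
proof -
  assume y: "0 < y"
  have "y / 4 \<le> exp (y / 4)" using exp_ge_add_one_self[of "y / 4"] by linarith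
  then have "(y / 4) ^ 4 \<le> exp (y / 4) ^ 4" using y by (intro power_mono) auto
  also have "\<dots> = exp y" by (simp add: exp_of_nat_mult[symmetric])
  finally have "y ^ 4 / 256 \<le> exp y" by (simp add: power_divide)
  then show ?thesis using y by (simp add: exp_minus field_simps)
qed

section \<open>Choice of the reserve and approximate superadditivity\<close>

context spin_model
begin

definition mean_log :: "nat \<Rightarrow> real" where
  "mean_log N = Q {..<N} {..<N * r div K}"

lemma mean_log_bound: "\<bar>mean_log N\<bar> \<le> size_bd * N"
proof -
  have "N * r div K \<le> N * r" by (rule div_le_dividend)
  then show ?thesis unfolding mean_log_def using Q_bound[of "{..<N * r div K}" "{..<N}"] by simp
qed

text \<open>With z of order N^(3/4), the reserve costs order N^(3/4), the replacement errors at most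
  order n / z, hence N^(1/4), and the tail decays at least like exp (- const N^(1/2)).\<close>

lemma mean_log_superadditive:
  "\<exists>C\<ge>0. \<forall>N1 N2. 0 < N1 \<longrightarrow> N1 \<le> 2 * N2 \<longrightarrow> N2 \<le> 2 * N1 \<longrightarrow> K dvd N1 * r \<longrightarrow> K dvd N2 * r \<longrightarrow>
     mean_log N1 + mean_log N2 \<le> mean_log (N1 + N2) + C * real (N1 + N2) powr (3 / 4)"
proof -
  define D where "D = (2 * (real K)\<^sup>2 * r) ^ 4"
  \<comment> \<open>One summand for each source of error: small N, the reserve, the replacement
    steps, and the tail.\<close>
  define C where "C = 12 * size_bd * K * (K + 2) + 12 * lip * (K + 2) + 8 * r * lip * K\<^sup>2 + (real r + 1) * 4 * size_bd * 256 * D"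
  have C_terms: "0 \<le> 12 * size_bd * K * (K + 2)" "0 \<le> 12 * lip * (K + 2)" "0 \<le> 8 * r * lip * K\<^sup>2"
    "0 \<le> (real r + 1) * 4 * size_bd * 256 * D"
    using size_bd_nonneg lip_nonneg by (auto simp: D_def)
  have "mean_log N1 + mean_log N2 \<le> mean_log (N1 + N2) + C * real (N1 + N2) powr (3 / 4)"
    if h: "0 < N1" "N1 \<le> 2 * N2" "N2 \<le> 2 * N1" "K dvd N1 * r" "K dvd N2 * r" for N1 N2
  proof -
    define N where "N = N1 + N2"
    define M1 where "M1 = N1 * r div K"
    define M2 where "M2 = N2 * r div K"
    define p where "p = real N powr (3 / 4)"
    define z where "z = nat \<lceil>p\<rceil> + K"
    have M: "M1 * K = N1 * r" "M2 * K = N2 * r" using h by (auto simp: M1_def M2_def)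
    then have "(M1 + M2) * K = N * r" by (simp add: N_def distrib_right)
    then have MM: "N * r div K = M1 + M2" using K_pos by (metis nonzero_mult_div_cancel_right less_numeral_extra(3))
    have N1: "1 \<le> real N" using h(1) by (simp add: N_def)
    then have p1: "1 \<le> p" unfolding p_def by (simp add: ge_one_powr_ge_zero)
    have zp: "p \<le> real z" "real z \<le> (real K + 2) * p"
    proof -
      show "p \<le> real z" unfolding z_def using p1 by linarith
      have "real z \<le> p + 1 + K" unfolding z_def using p1 by simp
      also have "\<dots> \<le> p + p + K * p" using p1 mult_left_mono[OF p1, of "real K"] by simp
      finally show "real z \<le> (real K + 2) * p" by (simp add: algebra_simps)
    qed
    have z_pos: "0 < real z" using zp p1 by linarith
    show ?thesis
    proof (cases "6 * z \<le> M1 + M2")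
      \<comment> \<open>Too few edges for the reserve: then N is at most a constant times p, and the
        trivial linear bound suffices.\<close>
      case False
      have "N \<le> N * r" using r_pos by simp
      also have "\<dots> = (M1 + M2) * K" using M by (simp add: N_def distrib_right)
      also have "\<dots> \<le> 6 * z * K" using False by (intro mult_right_mono) auto
      finally have "real N \<le> 6 * real z * K" by (metis of_nat_le_iff of_nat_mult of_nat_numeral)
      also have "\<dots> \<le> 6 * ((real K + 2) * p) * K" using zp by (intro mult_right_mono mult_left_mono) auto
      finally have "2 * size_bd * real N \<le> 2 * size_bd * (6 * ((real K + 2) * p) * K)"
        using size_bd_nonneg by (intro mult_left_mono) auto
      also have "\<dots> = 12 * size_bd * K * (K + 2) * p" by (simp add: algebra_simps)
      also have "\<dots> \<le> C * p" unfolding C_def using C_terms p1 by (intro mult_right_mono) linarith+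
      finally have "2 * size_bd * real N \<le> C * p" .
      then show ?thesis
        using mean_log_bound[of N1] mean_log_bound[of N2] mean_log_bound[of N]
        unfolding N_def[symmetric] p_def[symmetric] by (simp add: N_def algebra_simps abs_le_iff)
    next
      case True
      \<comment> \<open>Dropping \<open>6 * z\<close> edges frees \<open>6 * z * K\<close> points,
        at least the required reserve.\<close>
      define n where "n = M1 + M2 - 6 * z"
      have nM: "n + 6 * z = M1 + M2" using True by (simp add: n_def)
      interpret two_parts K q r v \<alpha> c T \<theta> "{..<N1}" "{N1..<N1 + N2}" n z
      proof unfold_locales
        have "n * K + 6 * z \<le> (n + 6 * z) * K" using K_pos by (simp add: distrib_right)
        also have "\<dots> = (card {..<N1} + card {N1..<N1 + N2}) * r"
          unfolding nM using M by (simp add: distrib_right)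
        finally show "n * K + 6 * z \<le> (card {..<N1} + card {N1..<N1 + N2}) * r" .
      qed (use h in \<open>auto simp: z_def\<close>)
      have V: "{..<N1} \<union> {N1..<N1 + N2} = {..<N}" by (auto simp: N_def)
      have nN: "real n \<le> N * r"
      proof -
        have "n \<le> (M1 + M2) * 1" using nM by simp
        also have "\<dots> \<le> (M1 + M2) * K" using K_pos by (intro mult_left_mono) auto
        also have "\<dots> = N * r" using M by (simp add: N_def distrib_right)
        finally show ?thesis by (metis of_nat_le_iff of_nat_mult)
      qed
      have "Q {N1..<N1 + N2} {..<M2} = mean_log N2"
        unfolding mean_log_def M2_def by (rule Q_card) auto
      then have main: "mean_log N1 + mean_log N2 \<le> mean_log N + 2 * lip * (real M1 + real M2 - real n) +
          n * (8 * lip * K\<^sup>2 / z) + (real n + 1) * (4 * size_bd * N * tail)"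
        using Q_superadditive_bound[of M1 M2] M nM unfolding V mean_log_def M1_def[symmetric] MM by simp
      have "2 * lip * (real M1 + real M2 - real n) = 2 * lip * (6 * real z)"
        using nM by (metis add_diff_cancel_left' of_nat_add of_nat_mult of_nat_numeral)
      also have "\<dots> \<le> 2 * lip * (6 * ((real K + 2) * p))" using zp lip_nonneg by (intro mult_left_mono) auto
      finally have e1: "2 * lip * (real M1 + real M2 - real n) \<le> 12 * lip * (K + 2) * p"
        by (simp add: algebra_simps)
      have "real N / p = real N powr (1 - 3 / 4)"
        using N1 unfolding p_def by (subst powr_diff) auto
      also have "\<dots> \<le> p" unfolding p_def using N1 by (intro powr_mono) auto
      finally have Np: "real N / p \<le> p" .
      have "n * (8 * lip * K\<^sup>2 / z) \<le> (N * r) * (8 * lip * K\<^sup>2 / p)"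
        using nN zp p1 lip_nonneg by (intro mult_mono divide_left_mono) auto
      also have "\<dots> = 8 * r * lip * K\<^sup>2 * (real N / p)" by simp
      also have "\<dots> \<le> 8 * r * lip * K\<^sup>2 * p" using Np C_terms(3) by (rule mult_left_mono)
      finally have e2: "n * (8 * lip * K\<^sup>2 / z) \<le> 8 * r * lip * K\<^sup>2 * p" .
      define y where "y = (real z)\<^sup>2 / (2 * (real K)\<^sup>2 * (real N * r))"
      have y_pos: "0 < y" using z_pos N1 K_pos r_pos unfolding y_def by simp
      have "p ^ 4 = p powr real 4" using p1 by (subst powr_realpow) auto
      also have "\<dots> = real N powr real 3" by (simp add: p_def powr_powr)
      also have "\<dots> = real N ^ 3" using N1 by (subst powr_realpow) auto
      finally have p4: "p ^ 4 = real N ^ 3" .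
      have "p\<^sup>2 \<le> (real z)\<^sup>2" using zp p1 by (intro power_mono) auto
      then have "p\<^sup>2 / real N / (2 * (real K)\<^sup>2 * r) \<le> (real z)\<^sup>2 / real N / (2 * (real K)\<^sup>2 * r)"
        by (intro divide_right_mono) auto
      also have "\<dots> = y" by (simp add: y_def field_simps)
      finally have "(p\<^sup>2 / real N / (2 * (real K)\<^sup>2 * r)) ^ 4 \<le> y ^ 4" by (intro power_mono) auto
      moreover have "(p\<^sup>2 / real N / (2 * (real K)\<^sup>2 * r)) ^ 4 = (real N)\<^sup>2 / D"
      proof -
        have "(p\<^sup>2 / real N) ^ 4 = (p ^ 4)\<^sup>2 / real N ^ 4" by (simp add: power_divide power_mult[symmetric])
        then have "(p\<^sup>2 / real N) ^ 4 = (real N)\<^sup>2"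
          using N1 unfolding p4 by (simp add: field_simps power_mult[symmetric] power_add[symmetric])
        then show ?thesis by (simp only: power_divide[of "p\<^sup>2 / real N"] D_def)
      qed
      ultimately have y4: "(real N)\<^sup>2 / D \<le> y ^ 4" by simp
      have D_pos: "0 < D" using K_pos r_pos by (simp add: D_def)
      have "tail = exp (- y)" unfolding tail_def y_def V by simp
      also have "\<dots> \<le> 256 / y ^ 4" using y_pos by (rule exp_minus_le_power4)
      also have "\<dots> \<le> 256 / ((real N)\<^sup>2 / D)" using y4 D_pos N1 y_pos by (intro divide_left_mono) auto
      finally have tl: "tail \<le> 256 * D / (real N)\<^sup>2" by simp
      \<comment> \<open>The quadratic decay of the tail bound cancels the two factors of order N,
        leaving a constant.\<close>
      have "(real n + 1) * (4 * size_bd * N * tail) \<le> (real N * (real r + 1)) * (4 * size_bd * N * (256 * D / (real N)\<^sup>2))"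
        using nN N1 tl size_bd_nonneg by (intro mult_mono mult_left_mono) (auto simp: algebra_simps tail_def)
      also have "\<dots> = (real r + 1) * 4 * size_bd * 256 * D" using N1 by (simp add: power2_eq_square)
      also have "\<dots> \<le> (real r + 1) * 4 * size_bd * 256 * D * p" using C_terms(4) p1 by (simp add: mult_le_cancel_left1)
      finally have e3: "(real n + 1) * (4 * size_bd * N * tail) \<le> (real r + 1) * 4 * size_bd * 256 * D * p" .
      have "12 * lip * (K + 2) * p + 8 * r * lip * K\<^sup>2 * p + (real r + 1) * 4 * size_bd * 256 * D * p =
          (12 * lip * (K + 2) + 8 * r * lip * K\<^sup>2 + (real r + 1) * 4 * size_bd * 256 * D) * p"
        by (simp add: distrib_right)
      also have "\<dots> \<le> C * p" unfolding C_def using C_terms p1 by (intro mult_right_mono) linarith+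
      finally show ?thesis using main e1 e2 e3 unfolding N_def[symmetric] p_def[symmetric] by linarith
    qed
  qed
  moreover have "0 \<le> C" unfolding C_def using C_terms by linarith
  ultimately show ?thesis by blast
qed

end

section \<open>Existence of the limit\<close>

text \<open>Each part is at most 2/3 of the total N, so x^(3/4) = x x^(-1/4) \<ge> x (2N/3)^(-1/4).
  The gain is that (3/2)^(1/4) exceeds 1.\<close>

lemma powr_three_quarters_balanced:
  fixes N1 N2 :: real
  assumes "0 < N1" "0 < N2" "N1 \<le> 2 * N2" "N2 \<le> 2 * N1"
  shows "(3 / 2) powr (1 / 4) * (N1 + N2) powr (3 / 4) \<le> N1 powr (3 / 4) + N2 powr (3 / 4)"
proof -
  let ?N = "N1 + N2"
  have part: "(3 / 2) powr (1 / 4) * (x * ?N powr (- 1 / 4)) \<le> x powr (3 / 4)" if x: "0 < x" "3 * x \<le> 2 * ?N" for x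
  proof -
    have "(3 / 2 :: real) powr (1 / 4) = (2 / 3) powr (- 1 / 4)"
      by (simp add: powr_minus powr_divide field_simps)
    then have "(3 / 2) powr (1 / 4) * ?N powr (- 1 / 4) = (2 / 3 * ?N) powr (- 1 / 4)"
      using assms by (simp only: powr_mult)
    also have "\<dots> \<le> x powr (- 1 / 4)" using x by (intro powr_mono2') auto
    finally have "x * ((3 / 2) powr (1 / 4) * ?N powr (- 1 / 4)) \<le> x * x powr (- 1 / 4)"
      using x by (intro mult_left_mono) auto
    also have "\<dots> = x powr (1 + - 1 / 4)" using x by (simp only: powr_add) simp
    finally show ?thesis by (simp add: mult_ac)
  qed
  have "?N powr (3 / 4) = ?N powr (1 + - 1 / 4)" by simp
  also have "\<dots> = N1 * ?N powr (- 1 / 4) + N2 * ?N powr (- 1 / 4)"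
    using assms by (simp only: powr_add) (simp add: distrib_right)
  finally show ?thesis using part[of N1] part[of N2] assms by (simp add: distrib_left)
qed

text \<open>Adding a short remainder to a long multiple would be unbalanced. Instead k is halved
  repeatedly and s is carried along in one half only, so its cost \<open>3 * B * n\<close> is paid
  just once, at the bottom.\<close>

lemma balanced_superadditive_multiple:
  fixes b :: "nat \<Rightarrow> real" and B :: real
  assumes add: "\<And>x y. D x \<Longrightarrow> D y \<Longrightarrow> D (x + y)" and "D n" "D s" "s < n"
    and bd: "\<And>N. \<bar>b N\<bar> \<le> B * N"
    and super: "\<And>x y. 0 < x \<Longrightarrow> x \<le> 2 * y \<Longrightarrow> y \<le> 2 * x \<Longrightarrow> D x \<Longrightarrow> D y \<Longrightarrow> b x + b y \<le> b (x + y)"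
    and "0 < k"
  shows "k * b n \<le> b (k * n) \<and> k * b n - 3 * B * n \<le> b (k * n + s)"
  using \<open>0 < k\<close>
proof (induction k rule: less_induct)
  case (less k)
  have Dk: "D (j * n)" if "0 < j" for j
    using that by (induction j rule: nat_induct_non_zero) (auto intro: add assms(2))
  have B: "0 \<le> B" using order_trans[OF abs_ge_zero bd[of 1]] by simp
  show ?case
  proof (cases "k = 1")
    case True
    \<comment> \<open>The origin of the 3: \<open>b n\<close> is at most \<open>B * n\<close> and,
      since \<open>s < n\<close>, \<open>b (n + s)\<close> is at least
      \<open>- 2 * B * n\<close>.\<close>
    have "B * real (n + s) \<le> B * (2 * real n)" using assms(4) B by (intro mult_left_mono) auto
    then show ?thesis using True bd[of n] bd[of "n + s"] by (simp add: abs_le_iff)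
  next
    case False
    \<comment> \<open>The remainder joins the smaller half \<open>k2\<close>; since
      \<open>k2 + 1 \<le> 2 * k1\<close>, the split stays balanced with it.\<close>
    define k1 where "k1 = (k + 1) div 2"
    define k2 where "k2 = k div 2"
    have k: "k1 + k2 = k" "0 < k1" "0 < k2" "k1 < k" "k2 < k" "k1 \<le> 2 * k2" "k2 + 1 \<le> 2 * k1"
      using False less.prems unfolding k1_def k2_def by auto
    have kn: "k * n = k1 * n + k2 * n" "real k = real k1 + real k2" using k(1) by (auto simp: distrib_right[symmetric])
    have n: "0 < n" using assms(4) by simp
    have le1: "k1 * n \<le> 2 * (k2 * n)" using mult_right_mono[OF k(6), of n] by simp
    have le2: "k2 * n + n \<le> 2 * (k1 * n)" using mult_right_mono[OF k(7), of n] by simp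
    have "b (k1 * n) + b (k2 * n) \<le> b (k1 * n + k2 * n)"
      by (intro super Dk) (use n k(2,3) le1 le2 in \<open>linarith | simp\<close>)+
    moreover have "b (k1 * n) + b (k2 * n + s) \<le> b (k1 * n + (k2 * n + s))"
      by (intro super Dk add) (use n k(2,3) le1 le2 assms(3,4) in \<open>linarith | simp\<close>)+
    moreover have "k1 * b n \<le> b (k1 * n)" "k2 * b n \<le> b (k2 * n)" "k2 * b n - 3 * B * n \<le> b (k2 * n + s)"
      using less.IH[of k1] less.IH[of k2] k by auto
    ultimately show ?thesis unfolding kn by (simp add: algebra_simps)
  qed
qed

text \<open>Subtracting \<open>E * N powr (3 / 4)\<close> makes the sequence exactly superadditive
  on balanced pairs and is negligible after division by N. The limit is then the supremum of the
  corrected ratios over admissible n.\<close>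

lemma balanced_superadditive_limit:
  fixes a :: "nat \<Rightarrow> real" and B C :: real
  assumes D0: "D m" "0 < m" and add: "\<And>x y. D x \<Longrightarrow> D y \<Longrightarrow> D (x + y)"
    and diff: "\<And>x y. D (x + y) \<Longrightarrow> D x \<Longrightarrow> D y"
    and bd: "\<And>N. \<bar>a N\<bar> \<le> B * N" and C: "0 \<le> C"
    and super: "\<And>x y. 0 < x \<Longrightarrow> x \<le> 2 * y \<Longrightarrow> y \<le> 2 * x \<Longrightarrow> D x \<Longrightarrow> D y \<Longrightarrow>
      a x + a y \<le> a (x + y) + C * real (x + y) powr (3 / 4)"
  shows "\<exists>l. \<forall>\<epsilon>>0. \<exists>N0. \<forall>N\<ge>N0. D N \<longrightarrow> \<bar>a N / N - l\<bar> \<le> \<epsilon>"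
proof -
  define \<eta> :: real where "\<eta> = (3 / 2) powr (1 / 4) - 1"
  have \<eta>: "0 < \<eta>" unfolding \<eta>_def using powr_less_mono[of 0 "1 / 4" "3 / 2 :: real"] by simp
  \<comment> \<open>Chosen so that the concavity gain \<eta> times \<open>E\<close> pays exactly for
    the error constant \<open>C\<close>.\<close>
  define E where "E = C / \<eta>"
  have E: "0 \<le> E" "E * \<eta> = C" using C \<eta> by (auto simp: E_def)
  define b where "b N = a N - E * real N powr (3 / 4)" for N
  define B' where "B' = B + E"
  have bd': "\<bar>b N\<bar> \<le> B' * N" for N
  proof -
    have "real N powr (3 / 4) \<le> real N"
    proof (cases "N = 0")
      case False
      then have "real N powr (3 / 4) \<le> real N powr 1" by (intro powr_mono) auto
      then show ?thesis by simp
    qed simp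
    then have "E * real N powr (3 / 4) \<le> E * N" using E by (intro mult_left_mono)
    moreover have "0 \<le> E * real N powr (3 / 4)" using E by simp
    ultimately show ?thesis using bd[of N] by (simp add: b_def B'_def distrib_right abs_le_iff)
  qed
  have B': "0 \<le> B'" using order_trans[OF abs_ge_zero bd'[of 1]] by simp
  have super': "b x + b y \<le> b (x + y)" if h: "0 < x" "x \<le> 2 * y" "y \<le> 2 * x" "D x" "D y" for x y
  proof -
    have "(1 + \<eta>) * real (x + y) powr (3 / 4) \<le> real x powr (3 / 4) + real y powr (3 / 4)"
      using powr_three_quarters_balanced[of x y] h unfolding \<eta>_def by simp
    then have "E * ((1 + \<eta>) * real (x + y) powr (3 / 4)) \<le> E * (real x powr (3 / 4) + real y powr (3 / 4))"
      using E by (intro mult_left_mono)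
    moreover have "E * ((1 + \<eta>) * real (x + y) powr (3 / 4)) = (E + C) * real (x + y) powr (3 / 4)"
      unfolding E(2)[symmetric] by (simp add: algebra_simps)
    ultimately show ?thesis using super[OF h] unfolding b_def distrib_left distrib_right by linarith
  qed
  let ?R = "{b n / n | n. 0 < n \<and> D n}"
  define l where "l = Sup ?R"
  have up: "b n / n \<le> B'" if "0 < n" for n using bd'[of n] that by (simp add: divide_le_eq abs_le_iff)
  have bdd: "bdd_above ?R" using up by (intro bdd_aboveI[of _ B']) auto
  have ne: "?R \<noteq> {}" using D0 by auto
  have le_l: "b n / n \<le> l" if "0 < n" "D n" for n
    unfolding l_def using that bdd by (intro cSup_upper) auto
  show ?thesis
  proof (intro exI[of _ l] allI impI)
    fix \<epsilon> :: real assume \<epsilon>: "\<epsilon> > 0"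
    have "l - \<epsilon> / 4 < Sup ?R" using \<epsilon> by (simp add: l_def)
    then obtain n where n: "0 < n" "D n" "l - \<epsilon> / 4 < b n / n"
      using less_cSup_iff[OF ne bdd] by auto
    have lim1: "((\<lambda>N. 4 * B' * n / real N) \<longlongrightarrow> 0) sequentially"
      by (rule tendsto_divide_0[OF tendsto_const filterlim_at_top_imp_at_infinity[OF filterlim_real_sequentially]])
    have lim2: "((\<lambda>N. E * real N powr (- 1 / 4)) \<longlongrightarrow> 0) sequentially"
      using tendsto_mult_left[OF tendsto_neg_powr[OF _ filterlim_real_sequentially], of "- 1 / 4" E] by simp
    have "eventually (\<lambda>N. 4 * B' * n / real N < \<epsilon> / 4 \<and> E * real N powr (- 1 / 4) < \<epsilon> / 4 \<and> n \<le> N) sequentially"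
      using \<epsilon> by (intro eventually_conj order_tendstoD(2)[OF lim1] order_tendstoD(2)[OF lim2] eventually_ge_at_top) auto
    then obtain N0 where N0: "\<And>N. N \<ge> N0 \<Longrightarrow> 4 * B' * n / real N < \<epsilon> / 4 \<and> E * real N powr (- 1 / 4) < \<epsilon> / 4 \<and> n \<le> N"
      unfolding eventually_sequentially by blast
    show "\<exists>N0. \<forall>N\<ge>N0. D N \<longrightarrow> \<bar>a N / N - l\<bar> \<le> \<epsilon>"
    proof (intro exI[of _ N0] allI impI)
      fix N assume "N0 \<le> N" and DN: "D N"
      note N = N0[OF \<open>N0 \<le> N\<close>]
      have N_pos: "0 < N" using N n by simp
      define k where "k = N div n"
      define s where "s = N mod n"
      have Nks: "N = k * n + s" and s: "s < n" and k: "0 < k"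
        using n N unfolding k_def s_def by (auto simp: div_greater_zero_iff)
      have Dk: "D (k * n)" using k by (induction k rule: nat_induct_non_zero) (auto intro: add n)
      have Ds: "D s" using diff[of "k * n" s] Dk DN Nks by simp
      have "k * b n - 3 * B' * n \<le> b N"
        using balanced_superadditive_multiple[of D n s b B' k, OF add n(2) Ds s bd' super' k] Nks by simp
      \<comment> \<open>Replacing \<open>k * n\<close> by \<open>N\<close> ignores fewer than
        \<open>n\<close> nodes at a rate of at most \<open>B'\<close>; with the earlier loss this
        makes \<open>4 * B' * n\<close>.\<close>
      moreover have "real k * b n \<ge> N * (b n / n) - B' * n"
      proof -
        have "real N * (b n / n) = k * b n + s * (b n / n)" using n unfolding Nks by (simp add: field_simps)
        moreover have "s * (b n / n) \<le> s * B'" using up[OF n(1)] by (intro mult_left_mono) auto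
        moreover have "s * B' \<le> n * B'" using s B' by (intro mult_right_mono) auto
        ultimately show ?thesis by (simp add: mult.commute)
      qed
      ultimately have "N * (b n / n) - 4 * B' * n \<le> b N" by linarith
      then have "(N * (b n / n) - 4 * B' * n) / N \<le> b N / N" by (intro divide_right_mono) auto
      then have "b n / n - 4 * B' * n / N \<le> b N / N" using N_pos by (simp add: diff_divide_distrib)
      moreover have "b N / N \<le> l" using le_l N_pos DN by simp
      moreover have "a N / N = b N / N + E * real N powr (- 1 / 4)"
      proof -
        have "real N powr (- 1 / 4) = real N powr (3 / 4 - 1)" by simp
        also have "\<dots> = real N powr (3 / 4) / N" using N_pos by (simp only: powr_diff) simp
        finally have "E * real N powr (- 1 / 4) = E * real N powr (3 / 4) / N" by (simp only: times_divide_eq_right)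
        then show ?thesis by (simp add: b_def diff_divide_distrib)
      qed
      moreover have "0 \<le> E * real N powr (- 1 / 4)" using E by simp
      ultimately show "\<bar>a N / N - l\<bar> \<le> \<epsilon>" using N n(3) \<epsilon> by (simp add: abs_le_iff)
    qed
  qed
qed

section \<open>Concentration around the mean and the limit in probability\<close>

context spin_model
begin

lemma mean_log_limit:
  "\<exists>l. \<forall>\<epsilon>>0. \<exists>N0. \<forall>N\<ge>N0. K dvd N * r \<longrightarrow> \<bar>mean_log N / N - l\<bar> \<le> \<epsilon>"
proof -
  obtain C where C: "0 \<le> C" "\<And>N1 N2. 0 < N1 \<Longrightarrow> N1 \<le> 2 * N2 \<Longrightarrow> N2 \<le> 2 * N1 \<Longrightarrow> K dvd N1 * r \<Longrightarrow> K dvd N2 * r \<Longrightarrow>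
     mean_log N1 + mean_log N2 \<le> mean_log (N1 + N2) + C * real (N1 + N2) powr (3 / 4)"
    using mean_log_superadditive by blast
  show ?thesis
  proof (rule balanced_superadditive_limit[where m = K and D = "\<lambda>N. K dvd N * r"])
    show "K dvd y * r" if "K dvd (x + y) * r" "K dvd x * r" for x y
      using that by (simp add: distrib_right dvd_add_right_iff)
  qed (use K_pos mean_log_bound C in \<open>auto simp: distrib_right\<close>)
qed

lemma bounded_diff_ln_Z:
  assumes "finite I" "finite V"
  shows "bounded_diff (slots I) (points V) (\<lambda>\<phi>. ln (Z V I \<phi>)) (4 * lip)"
proof (rule bounded_diffI)
  fix \<phi> \<phi>' s t
  assume \<phi>: "\<phi> \<in> cfg (slots I) (\<lambda>_. points V)" "\<phi>' \<in> cfg (slots I) (\<lambda>_. points V)"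
    and eq: "\<And>u. u \<noteq> s \<Longrightarrow> u \<noteq> t \<Longrightarrow> \<phi> u = \<phi>' u"
  \<comment> \<open>Passing from \<phi> to \<phi>' through \<psi> alters one edge at a time, first
    that of \<open>s\<close>, then that of \<open>t\<close>.\<close>
  define \<psi> where "\<psi> u = (if fst u = fst s then \<phi>' u else \<phi> u)" for u
  have p: "proper V I \<phi>" "proper V I \<phi>'" using \<phi> by (auto intro: proper_cfg)
  then have p\<psi>: "proper V I \<psi>" by (auto simp: proper_def \<psi>_def)
  have "\<bar>ln (Z V I \<phi>) - ln (Z V I \<psi>)\<bar> \<le> 2 * lip"
    by (rule ln_Z_change[OF assms p(1) p\<psi>, where i = "fst s"]) (simp add: \<psi>_def)
  moreover have "\<bar>ln (Z V I \<psi>) - ln (Z V I \<phi>')\<bar> \<le> 2 * lip"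
  proof (rule ln_Z_change[OF assms p\<psi> p(2), where i = "fst t"])
    show "\<psi> (j, u) = \<phi>' (j, u)" if "j \<noteq> fst t" for j u
      using that eq[of "(j, u)"] by (cases s; cases t) (auto simp: \<psi>_def)
  qed
  ultimately show "\<bar>ln (Z V I \<phi>) - ln (Z V I \<phi>')\<bar> \<le> 4 * lip" by linarith
qed

lemma ln_Z_tail:
  assumes "finite I" "finite V" "card I * K \<le> card V * r" "0 < t"
  shows "avg (cfg (slots I) (\<lambda>_. points V)) (\<lambda>\<phi>. of_bool (t \<le> \<bar>ln (Z V I \<phi>) - Q V I\<bar>))
     \<le> 2 * exp (- 2 * t\<^sup>2 / (16 * lip\<^sup>2 * (card V * r) + 1))"
proof -
  let ?C = "cfg (slots I) (\<lambda>_. points V)"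
  \<comment> \<open>The summand 1 keeps the denominator positive, also when \<open>V\<close> is
    empty.\<close>
  let ?d = "16 * lip\<^sup>2 * (card V * r) + 1"
  let ?f = "\<lambda>\<phi>. ln (Z V I \<phi>)"
  have tail: "avg ?C (\<lambda>\<phi>. of_bool (t \<le> f \<phi> - avg ?C f)) \<le> exp (- 2 * t\<^sup>2 / ?d)"
    if "bounded_diff (slots I) (points V) f (4 * lip)" for f
  proof (rule cfg_tail[OF _ _ _ that])
    have "(4 * lip)\<^sup>2 * card (slots I) \<le> 16 * lip\<^sup>2 * (card V * r)"
      using assms(3) unfolding card_slots power_mult_distrib
      by (intro mult_mono) (auto simp flip: of_nat_mult)
    then show "(4 * lip)\<^sup>2 * card (slots I) \<le> ?d" by simp
    show "0 < ?d" by (intro add_nonneg_pos) auto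
  qed (use assms lip_nonneg in \<open>auto simp: finite_slots finite_points card_slots card_points\<close>)
  have "avg ?C (\<lambda>\<phi>. of_bool (t \<le> \<bar>?f \<phi> - Q V I\<bar>)) \<le>
      avg ?C (\<lambda>\<phi>. of_bool (t \<le> ?f \<phi> - avg ?C ?f) + of_bool (t \<le> - ?f \<phi> - avg ?C (\<lambda>\<phi>. - ?f \<phi>)))"
    unfolding avg_uminus Q_def by (intro avg_mono) (auto simp: of_bool_def)
  also have "\<dots> \<le> 2 * exp (- 2 * t\<^sup>2 / ?d)"
    unfolding avg_add
    using tail[OF bounded_diff_ln_Z[OF assms(1,2)]] tail[OF bounded_diff_uminus[OF bounded_diff_ln_Z[OF assms(1,2)]]]
    by linarith
  finally show ?thesis .
qed

lemma ln_Z_limit: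
  "\<exists>l. \<forall>\<epsilon>>0. \<forall>\<delta>>0. \<exists>N0. \<forall>N\<ge>N0. K dvd N * r \<longrightarrow>
     avg (cfg (slots {..<N * r div K}) (\<lambda>_. points {..<N}))
       (\<lambda>\<phi>. of_bool (\<bar>ln (Z {..<N} {..<N * r div K} \<phi>) / N - l\<bar> > \<epsilon>)) < \<delta>"
proof -
  obtain l where l: "\<And>\<epsilon>. \<epsilon> > 0 \<Longrightarrow> \<exists>N0. \<forall>N\<ge>N0. K dvd N * r \<longrightarrow> \<bar>mean_log N / N - l\<bar> \<le> \<epsilon>"
    using mean_log_limit by blast
  show ?thesis
  proof (intro exI[of _ l] allI impI)
    fix \<epsilon> \<delta> :: real assume \<epsilon>: "\<epsilon> > 0" and \<delta>: "\<delta> > 0"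
    obtain N1 where N1: "\<And>N. N \<ge> N1 \<Longrightarrow> K dvd N * r \<Longrightarrow> \<bar>mean_log N / N - l\<bar> \<le> \<epsilon> / 2"
      using l[of "\<epsilon> / 2"] \<epsilon> by auto
    \<comment> \<open>Then \<open>w * N\<close> dominates the variance term of
      \<open>ln_Z_tail\<close> for \<open>N \<ge> 1\<close>, and the exponent becomes linear in
      \<open>N\<close>.\<close>
    define w where "w = 16 * lip\<^sup>2 * r + 1"
    have w: "w > 0" unfolding w_def by (intro add_nonneg_pos) auto
    have "filterlim (\<lambda>N. (\<epsilon>\<^sup>2 / (2 * w)) * real N) at_top sequentially"
      using \<epsilon> w by (intro filterlim_tendsto_pos_mult_at_top[OF tendsto_const _ filterlim_real_sequentially]) simp
    then have "filterlim (\<lambda>N. - ((\<epsilon>\<^sup>2 / (2 * w)) * real N)) at_bot sequentially"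
      by (simp add: filterlim_uminus_at_bot)
    then have "((\<lambda>N. exp (- ((\<epsilon>\<^sup>2 / (2 * w)) * real N))) \<longlongrightarrow> 0) sequentially"
      by (rule filterlim_compose[OF exp_at_bot])
    then have "eventually (\<lambda>N. exp (- ((\<epsilon>\<^sup>2 / (2 * w)) * real N)) < \<delta> / 2) sequentially"
      using \<delta> by (intro order_tendstoD(2)[where y = 0]) auto
    then obtain N2 where N2: "\<And>N. N \<ge> N2 \<Longrightarrow> exp (- ((\<epsilon>\<^sup>2 / (2 * w)) * real N)) < \<delta> / 2"
      unfolding eventually_sequentially by blast
    show "\<exists>N0. \<forall>N\<ge>N0. K dvd N * r \<longrightarrow> avg (cfg (slots {..<N * r div K}) (\<lambda>_. points {..<N}))
       (\<lambda>\<phi>. of_bool (\<bar>ln (Z {..<N} {..<N * r div K} \<phi>) / N - l\<bar> > \<epsilon>)) < \<delta>"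
    proof (intro exI[of _ "max 1 (max N1 N2)"] allI impI)
      fix N assume "max 1 (max N1 N2) \<le> N" and dvd: "K dvd N * r"
      then have N: "1 \<le> N" "N1 \<le> N" "N2 \<le> N" by auto
      let ?I = "{..<N * r div K}"
      let ?C = "cfg (slots ?I) (\<lambda>_. points {..<N})"
      have "avg ?C (\<lambda>\<phi>. of_bool (\<bar>ln (Z {..<N} ?I \<phi>) / N - l\<bar> > \<epsilon>)) \<le>
          avg ?C (\<lambda>\<phi>. of_bool (\<epsilon> / 2 * N \<le> \<bar>ln (Z {..<N} ?I \<phi>) - Q {..<N} ?I\<bar>))"
      proof (intro avg_mono)
        fix \<phi>
        have "\<epsilon> / 2 * N \<le> \<bar>ln (Z {..<N} ?I \<phi>) - mean_log N\<bar>" if "\<bar>ln (Z {..<N} ?I \<phi>) / N - l\<bar> > \<epsilon>"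
        proof -
          have "\<epsilon> / 2 \<le> \<bar>ln (Z {..<N} ?I \<phi>) / N - mean_log N / N\<bar>"
            using that N1[OF N(2) dvd] by linarith
          also have "\<dots> = \<bar>ln (Z {..<N} ?I \<phi>) - mean_log N\<bar> / N"
            by (simp add: diff_divide_distrib[symmetric])
          finally show ?thesis using N by (simp add: field_simps)
        qed
        then show "of_bool (\<bar>ln (Z {..<N} ?I \<phi>) / N - l\<bar> > \<epsilon>) \<le>
            (of_bool (\<epsilon> / 2 * N \<le> \<bar>ln (Z {..<N} ?I \<phi>) - Q {..<N} ?I\<bar>) :: real)"
          by (simp add: mean_log_def)
      qed
      also have "\<dots> \<le> 2 * exp (- 2 * (\<epsilon> / 2 * N)\<^sup>2 / (16 * lip\<^sup>2 * (card {..<N} * r) + 1))"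
        using \<epsilon> N by (intro ln_Z_tail) auto
      also have "\<dots> \<le> 2 * exp (- ((\<epsilon>\<^sup>2 / (2 * w)) * real N))"
      proof -
        have "16 * lip\<^sup>2 * (real N * r) + 1 \<le> w * N" unfolding w_def using N by (simp add: algebra_simps)
        then have "2 * (\<epsilon> / 2 * N)\<^sup>2 / (w * N) \<le> 2 * (\<epsilon> / 2 * N)\<^sup>2 / (16 * lip\<^sup>2 * (real N * r) + 1)"
          using w N by (intro divide_left_mono mult_pos_pos add_nonneg_pos) auto
        moreover have "2 * (\<epsilon> / 2 * N)\<^sup>2 / (w * N) = (\<epsilon>\<^sup>2 / (2 * w)) * real N"
          using w N by (simp add: power2_eq_square field_simps)
        ultimately show ?thesis by simp
      qed
      also have "\<dots> < \<delta>" using N2[OF N(3)] by simp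
      finally show "avg ?C (\<lambda>\<phi>. of_bool (\<bar>ln (Z {..<N} ?I \<phi>) / N - l\<bar> > \<epsilon>)) < \<delta>" .
    qed
  qed
qed

end

section \<open>The six models\<close>

fun bad_patterns :: "model \<Rightarrow> nat set" where
  "bad_patterns IndSet = {1}"
| "bad_patterns (Coloring q) = {..<q}"
| "bad_patterns (KSAT K) = {0}"
| "bad_patterns _ = {0, 1}"

text \<open>In the graph models a pattern is a common spin; in K-SAT it is the violating assignment
  given by the labels, and in NAE-K-SAT pattern 1 is the complementary assignment.\<close>

fun bad_value :: "model \<Rightarrow> nat \<Rightarrow> nat \<Rightarrow> nat" where
  "bad_value (KSAT K) t b = b"
| "bad_value (NAEKSAT K) t b = (if t = 0 then b else 1 - b)"
| "bad_value _ t b = t"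

fun top_weight :: "model \<Rightarrow> real \<Rightarrow> real" where
  "top_weight IndSet lam = 1"
| "top_weight (Ising \<beta> B) lam = lam powr \<beta>"
| "top_weight _ lam = lam"

text \<open>Solves weight of a violated edge = \<open>top_weight\<close> times (1 -
  \<open>weight_drop\<close>); that weight is 0 for independent sets,
  \<open>lam powr (- \<beta>)\<close> for Ising and 1 otherwise.\<close>

fun weight_drop :: "model \<Rightarrow> real \<Rightarrow> real" where
  "weight_drop IndSet lam = 1"
| "weight_drop (Ising \<beta> B) lam = 1 - lam powr (- 2 * \<beta>)"
| "weight_drop _ lam = 1 - 1 / lam"

text \<open>\<open>lam \<ge> 1\<close> makes the drop nonnegative, which is the repulsive sign the
  convexity argument requires. The drop equals 1 only for independent sets, whose single pattern
  asks for spin 1, so spin 0 is harmless.\<close>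

lemma spin_model_of_model:
  assumes "r > 0" "lam \<ge> 1" "valid_model m"
  shows "spin_model (arity m) (alphabet m) r (\<lambda>k. lam powr node_pot m k) (top_weight m lam)
    (weight_drop m lam) (bad_patterns m) (bad_value m)"
proof
  show "0 < arity m" "0 < alphabet m" using assms by (cases m; simp)+
  show "0 < lam powr node_pot m k" for k using assms by simp
  show "0 < top_weight m lam" using assms by (cases m) auto
  have "lam powr (- (2 * \<beta>)) \<le> 1" if "\<beta> > 0" for \<beta>
    using powr_mono[of "- (2 * \<beta>)" 0 lam] that assms by simp
  then show "0 \<le> weight_drop m lam" using assms by (cases m) auto
  show "weight_drop m lam \<le> 1" using assms by (cases m) auto
  show "finite (bad_patterns m)" by (cases m) auto
  show "t = t'" if "t \<in> bad_patterns m" "t' \<in> bad_patterns m" "b \<in> {0, 1}" "bad_value m t b = bad_value m t' b" for t t' b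
    using that by (cases m) (auto split: if_splits)
  show "weight_drop m lam < 1 \<or> (\<forall>t\<in>bad_patterns m. \<forall>b\<in>{0, 1}. bad_value m t b \<noteq> 0)"
    using assms by (cases m) auto
qed (use assms in auto)

lemma prod_of_bool: "(\<Prod>s<n :: nat. of_bool (p s)) = (of_bool (\<forall>s<n. p s) :: real)"
  by (induction n) (auto simp: less_Suc_eq)

text \<open>The sum over patterns is the indicator of a violated edge, because at most one pattern
  can be met.\<close>

lemma lam_pow_edge_pot:
  assumes "lam \<ge> 1" "valid_model m" "length xs = arity m" "length a = arity m"
    and a: "set a \<subseteq> {0, 1}" and xs: "set xs \<subseteq> {..<alphabet m}"
  shows "lam_pow lam (edge_pot m a xs) = top_weight m lam *
    (1 - weight_drop m lam * (\<Sum>t\<in>bad_patterns m. \<Prod>s<arity m. of_bool (xs ! s = bad_value m t (a ! s))))"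
proof -
  have lam: "lam > 0" using assms by simp
  have two: "(\<forall>s<2. p s) \<longleftrightarrow> p 0 \<and> p (1 :: nat)" for p
    by (auto simp: numeral_2_eq_2 less_Suc_eq)
  have const: "(\<Sum>t\<in>A. of_bool (xs ! 0 = t \<and> xs ! Suc 0 = t)) = (of_bool (xs ! 0 = xs ! Suc 0) :: real)"
    if "finite A" "xs ! 0 \<in> A" for A
  proof -
    have "(\<Sum>t\<in>A. of_bool (xs ! 0 = t \<and> xs ! Suc 0 = t)) = (\<Sum>t\<in>A. if t = xs ! 0 then of_bool (xs ! 0 = xs ! Suc 0) else 0 :: real)"
      by (intro sum.cong) auto
    then show ?thesis using that by simp
  qed
  have x0: "xs ! 0 < alphabet m"
  proof -
    have "0 < length xs" using assms(2,3) by (cases m) auto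
    then show ?thesis using xs nth_mem by blast
  qed
  have sum01: "(\<Sum>t\<in>{0, 1}. f t) = f 0 + (f 1 :: real)" for f :: "nat \<Rightarrow> real" by simp
  show ?thesis
  proof (cases m)
    case IndSet
    then show ?thesis using lam by (simp add: prod_of_bool two lam_pow_def zero_ereal_def)
  next
    case MaxCut
    have "xs ! 0 \<in> {0, 1}" using x0 MaxCut by auto
    then have "(\<Sum>t\<in>bad_patterns m. \<Prod>s<arity m. of_bool (xs ! s = bad_value m t (a ! s))) = (of_bool (xs ! 0 = xs ! Suc 0) :: real)"
      using MaxCut const[of "{0, 1}"] by (simp add: prod_of_bool two)
    then show ?thesis using MaxCut lam by (simp add: lam_pow_def field_simps)
  next
    case (Ising \<beta> B)
    have "xs ! 0 \<in> {0, 1}" using x0 Ising by auto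
    then have "(\<Sum>t\<in>bad_patterns m. \<Prod>s<arity m. of_bool (xs ! s = bad_value m t (a ! s))) = (of_bool (xs ! 0 = xs ! Suc 0) :: real)"
      using Ising const[of "{0, 1}"] by (simp add: prod_of_bool two)
    moreover have "lam powr \<beta> * lam powr - (2 * \<beta>) = lam powr - \<beta>" by (simp flip: powr_add)
    ultimately show ?thesis using Ising lam by (simp add: lam_pow_def)
  next
    case (Coloring q)
    then have "(\<Sum>t\<in>bad_patterns m. \<Prod>s<arity m. of_bool (xs ! s = bad_value m t (a ! s))) = (of_bool (xs ! 0 = xs ! Suc 0) :: real)"
      using const[of "{..<q}"] x0 by (simp add: prod_of_bool two)
    then show ?thesis using Coloring lam by (simp add: lam_pow_def field_simps)
  next
    case (KSAT K)
    then have "(\<forall>s<K. xs ! s = a ! s) \<longleftrightarrow> xs = a" using assms(3,4) by (auto simp: list_eq_iff_nth_eq)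
    then show ?thesis using KSAT lam by (simp add: prod_of_bool lam_pow_def field_simps)
  next
    case (NAEKSAT K)
    let ?a = "map (\<lambda>t. 1 - t) a"
    have eq: "(\<forall>s<K. xs ! s = a ! s) \<longleftrightarrow> xs = a" "(\<forall>s<K. xs ! s = 1 - a ! s) \<longleftrightarrow> xs = ?a"
      using NAEKSAT assms(3,4) by (auto simp: list_eq_iff_nth_eq)
    have "a ! 0 \<in> {0, 1}" using a NAEKSAT assms(2,4) by (intro subsetD[OF a] nth_mem) auto
    \<comment> \<open>The two forbidden assignments differ in the first entry, so their indicators
      add up to that of the union.\<close>
    then have "a ! 0 \<noteq> ?a ! 0" using NAEKSAT assms(2,4) by (auto simp: nth_map)
    then have "a \<noteq> ?a" by metis
    then have "(\<Sum>t\<in>bad_patterns m. \<Prod>s<arity m. of_bool (xs ! s = bad_value m t (a ! s))) = (of_bool (xs = a \<or> xs = ?a) :: real)"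
      unfolding NAEKSAT bad_patterns.simps arity.simps prod_of_bool sum01 bad_value.simps
      by (simp only: one_neq_zero refl if_True if_False eq) auto
    then show ?thesis using NAEKSAT lam by (simp add: lam_pow_def field_simps)
  qed
qed

lemma lam_pow_add:
  assumes "lam > 0" "a \<noteq> \<infinity>" "b \<noteq> \<infinity>"
  shows "lam_pow lam (a + b) = lam_pow lam a * lam_pow lam b"
  using assms by (cases a; cases b) (auto simp: lam_pow_def powr_add)

text \<open>Being different from \<infinity> is carried through the induction because
  \<open>lam_pow_add\<close> asks for it on the partial sum.\<close>

lemma lam_pow_sum:
  assumes "lam > 0" "\<And>i. i \<in> A \<Longrightarrow> f i \<noteq> \<infinity>"
  shows "lam_pow lam (\<Sum>i\<in>A. f i) = (\<Prod>i\<in>A. lam_pow lam (f i)) \<and> (\<Sum>i\<in>A. f i) \<noteq> \<infinity>"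
  using assms(2)
proof (induction A rule: infinite_finite_induct)
  case (insert x F)
  then show ?case using assms(1) by (auto simp: lam_pow_add)
qed (use assms(1) in \<open>auto simp: lam_pow_def zero_ereal_def\<close>)

lemma edge_pot_not_inf: "edge_pot m a xs \<noteq> \<infinity>"
  by (cases m) (auto simp: zero_ereal_def one_ereal_def)

section \<open>The configuration model as a uniform placement\<close>

definition instance_cfg :: "nat \<Rightarrow> nat \<Rightarrow> nat \<Rightarrow> nat list \<times> nat list list \<Rightarrow> nat \<times> nat \<Rightarrow> (nat \<times> nat) \<times> nat" where
  "instance_cfg K M r = (\<lambda>(\<sigma>, as). \<lambda>(i, s)\<in>{..<M} \<times> {..<K}.
     ((\<sigma> ! (i * K + s) div r, \<sigma> ! (i * K + s) mod r), as ! i ! s))"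

lemma slot_index:
  assumes "i < M" "s < (K :: nat)"
  shows "i * K + s < M * K" "(i * K + s) div K = i" "(i * K + s) mod K = s"
proof -
  have "i * K + s < Suc i * K" using assms(2) by simp
  also have "\<dots> \<le> M * K" using assms(1) by (intro mult_right_mono) auto
  finally show "i * K + s < M * K" .
qed (use assms in auto)

text \<open>Since \<open>M * K = N * r\<close>, the slots exhaust all points, so an ordering of the
  points with labels is the same as a placement. The inverse reads position \<open>p\<close> as slot
  \<open>(p div K, p mod K)\<close> and recovers a point from its owner and copy number.\<close>

lemma instance_cfg_bij:
  assumes "0 < K" "0 < r" "M * K = N * r"
  shows "bij_betw (instance_cfg K M r) (permutations_of_set {0..<N * r} \<times> label_set K M)
    (cfg ({..<M} \<times> {..<K}) (\<lambda>_. {..<N} \<times> {..<r}))"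
proof (rule bij_betw_byWitness[where f' = "\<lambda>\<phi>. (map (\<lambda>p. fst (fst (\<phi> (p div K, p mod K))) * r + snd (fst (\<phi> (p div K, p mod K)))) [0..<N * r],
     map (\<lambda>i. map (\<lambda>s. snd (\<phi> (i, s))) [0..<K]) [0..<M])"])
  let ?S = "{..<M} \<times> {..<K}" and ?A = "permutations_of_set {0..<N * r} \<times> label_set K M"
  let ?\<Phi> = "cfg ?S (\<lambda>_. {..<N} \<times> {..<r})"
  let ?\<sigma> = "\<lambda>\<phi>. map (\<lambda>p. fst (fst (\<phi> (p div K, p mod K))) * r + snd (fst (\<phi> (p div K, p mod K)))) [0..<N * r]"
  let ?as = "\<lambda>\<phi>. map (\<lambda>i. map (\<lambda>s. snd (\<phi> (i, s))) [0..<K]) [0..<M]"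
  have pS: "(p div K, p mod K) \<in> ?S" if "p < N * r" for p
    using that less_mult_imp_div_less[of p M K] assms(1) unfolding assms(3) by simp
  have len: "length \<sigma> = N * r" if "\<sigma> \<in> permutations_of_set {0..<N * r}" for \<sigma>
    using length_finite_permutations_of_set[OF that] by simp
  have lab: "length as = M" "\<And>i. i < M \<Longrightarrow> length (as ! i) = K"
    "\<And>i s. i < M \<Longrightarrow> s < K \<Longrightarrow> as ! i ! s \<in> {0, 1}" if "as \<in> label_set K M" for as
  proof -
    show l: "length as = M" using that by (simp add: label_set_def)
    show lK: "length (as ! i) = K" if "i < M" for i
      using \<open>as \<in> label_set K M\<close> that l by (auto simp: label_set_def)
    show "as ! i ! s \<in> {0, 1}" if "i < M" "s < K" for i s
    proof -
      have "as ! i \<in> set as" "as ! i ! s \<in> set (as ! i)" using that l lK by auto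
      then show ?thesis using \<open>as \<in> label_set K M\<close> by (auto simp: label_set_def)
    qed
  qed
  show "\<forall>a\<in>?A. (?\<sigma> (instance_cfg K M r a), ?as (instance_cfg K M r a)) = a"
  proof
    fix a assume "a \<in> ?A"
    then obtain \<sigma> as where a: "a = (\<sigma>, as)" "\<sigma> \<in> permutations_of_set {0..<N * r}" "as \<in> label_set K M" by auto
    have "?\<sigma> (instance_cfg K M r a) = \<sigma>"
      using pS len[OF a(2)] by (auto simp: a(1) instance_cfg_def list_eq_iff_nth_eq)
    moreover have "?as (instance_cfg K M r a) = as"
      using lab[OF a(3)] by (auto simp: a(1) instance_cfg_def list_eq_iff_nth_eq)
    ultimately show "(?\<sigma> (instance_cfg K M r a), ?as (instance_cfg K M r a)) = a" by (simp add: a(1))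
  qed
  have dec: "(u * r + b) div r = u" "(u * r + b) mod r = b" if "b < r" for u b using that by auto
  have val: "fst (fst (\<phi> s)) < N" "snd (fst (\<phi> s)) < r" "snd (\<phi> s) \<in> {0, 1}" if "\<phi> \<in> ?\<Phi>" "s \<in> ?S" for \<phi> s
    using cfg_fst[OF that] cfg_snd[OF that] by auto
  show "\<forall>\<phi>\<in>?\<Phi>. instance_cfg K M r (?\<sigma> \<phi>, ?as \<phi>) = \<phi>"
  proof
    fix \<phi> assume \<phi>: "\<phi> \<in> ?\<Phi>"
    show "instance_cfg K M r (?\<sigma> \<phi>, ?as \<phi>) = \<phi>"
    proof
      fix x :: "nat \<times> nat"
      obtain i s where x: "x = (i, s)" by (cases x)
      show "instance_cfg K M r (?\<sigma> \<phi>, ?as \<phi>) x = \<phi> x"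
      proof (cases "x \<in> ?S")
        case True
        then have i_s: "i < M" "s < K" by (auto simp: x)
        note idx = slot_index[OF i_s]
        have "?\<sigma> \<phi> ! (i * K + s) = fst (fst (\<phi> (i, s))) * r + snd (fst (\<phi> (i, s)))"
          using idx assms(3) by simp
        then show ?thesis using True i_s val(2)[OF \<phi> True] by (simp add: instance_cfg_def x dec)
      next
        case False
        then have "\<phi> x = undefined" by (rule PiE_arb[OF cfg_PiE[OF \<phi>]])
        then show ?thesis using False by (simp add: instance_cfg_def)
      qed
    qed
  qed
  show "instance_cfg K M r ` ?A \<subseteq> ?\<Phi>"
  proof (rule image_subsetI)
    fix a assume "a \<in> ?A"
    then obtain \<sigma> as where a: "a = (\<sigma>, as)" "\<sigma> \<in> permutations_of_set {0..<N * r}" "as \<in> label_set K M" by auto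
    have \<sigma>: "set \<sigma> = {0..<N * r}" "distinct \<sigma>" using a(2) by (auto simp: permutations_of_set_def)
    have nth: "\<sigma> ! (i * K + s) < N * r" if "i < M" "s < K" for i s
    proof -
      have "i * K + s < length \<sigma>" using slot_index(1)[OF that] len[OF a(2)] assms(3) by simp
      then have "\<sigma> ! (i * K + s) \<in> set \<sigma>" by (rule nth_mem)
      then show ?thesis using \<sigma>(1) by simp
    qed
    have "instance_cfg K M r a \<in> PiE ?S (\<lambda>_. ({..<N} \<times> {..<r}) \<times> {0, 1})"
      unfolding a(1) instance_cfg_def case_prod_conv restrict_PiE_iff
      using nth assms(2) lab(3)[OF a(3)] by (auto simp del: insert_iff simp: less_mult_imp_div_less)
    moreover have "inj_on (\<lambda>x. fst (instance_cfg K M r a x)) ?S"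
    proof (rule inj_onI)
      fix x y assume xy: "x \<in> ?S" "y \<in> ?S" "fst (instance_cfg K M r a x) = fst (instance_cfg K M r a y)"
      obtain i s where x: "x = (i, s)" "i < M" "s < K" using xy(1) by auto
      obtain j t where y: "y = (j, t)" "j < M" "t < K" using xy(2) by auto
      have "\<sigma> ! (i * K + s) = \<sigma> ! (j * K + t)"
        using xy(3) x y by (simp add: a(1) instance_cfg_def) (metis div_mult_mod_eq)
      then have "i * K + s = j * K + t"
        using \<sigma>(2) slot_index(1)[OF x(2,3)] slot_index(1)[OF y(2,3)] len[OF a(2)] assms(3)
        by (simp add: nth_eq_iff_index_eq)
      then show "x = y" using slot_index(2,3)[OF x(2,3)] slot_index(2,3)[OF y(2,3)] x(1) y(1) by metis
    qed
    ultimately show "instance_cfg K M r a \<in> ?\<Phi>" unfolding cfg_def by simp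
  qed
  show "(\<lambda>\<phi>. (?\<sigma> \<phi>, ?as \<phi>)) ` ?\<Phi> \<subseteq> ?A"
  proof (rule image_subsetI)
    fix \<phi> assume \<phi>: "\<phi> \<in> ?\<Phi>"
    let ?g = "\<lambda>p. fst (fst (\<phi> (p div K, p mod K))) * r + snd (fst (\<phi> (p div K, p mod K)))"
    have "inj_on ?g {0..<N * r}"
    proof (rule inj_onI)
      fix p p' assume p: "p \<in> {0..<N * r}" "p' \<in> {0..<N * r}" "?g p = ?g p'"
      have "fst (\<phi> (p div K, p mod K)) = fst (\<phi> (p' div K, p' mod K))"
        using p(3) dec val(2)[OF \<phi> pS, of p] val(2)[OF \<phi> pS, of p'] p(1,2)
        by (metis atLeastLessThan_iff prod.expand)
      then have "(p div K, p mod K) = (p' div K, p' mod K)"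
        using inj_onD[OF cfg_inj[OF \<phi>]] pS p(1,2) by (metis (no_types, lifting) atLeastLessThan_iff)
      then show "p = p'" by (metis div_mult_mod_eq prod.inject)
    qed
    moreover have "?g ` {0..<N * r} \<subseteq> {0..<N * r}"
    proof (rule image_subsetI)
      fix p assume "p \<in> {0..<N * r}"
      then have "(p div K, p mod K) \<in> ?S" using pS by simp
      then show "?g p \<in> {0..<N * r}" using slot_index(1) val[OF \<phi>] by (metis atLeastLessThan_iff zero_le)
    qed
    ultimately have "?g ` {0..<N * r} = {0..<N * r}" by (intro endo_inj_surj) auto
    then have "?\<sigma> \<phi> \<in> permutations_of_set {0..<N * r}"
      using \<open>inj_on ?g {0..<N * r}\<close> by (auto simp: permutations_of_set_def distinct_map)
    moreover have "?as \<phi> \<in> label_set K M"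
      using val(3)[OF \<phi>] by (fastforce simp: label_set_def)
    ultimately show "(?\<sigma> \<phi>, ?as \<phi>) \<in> ?A" by blast
  qed
qed

lemma finite_label_set: "finite (label_set K M)"
proof -
  have "label_set K M = {as. set as \<subseteq> {a. set a \<subseteq> {0, 1} \<and> length a = K} \<and> length as = M}"
    unfolding label_set_def by auto
  then show ?thesis by (simp add: finite_lists_length_eq)
qed

lemma prob_random_instance:
  fixes m r N
  defines "A \<equiv> permutations_of_set {0..<N * r} \<times> label_set (arity m) (N * r div arity m)"
  shows "measure_pmf.prob (random_instance m N r) X =
    avg A (\<lambda>(\<sigma>, as). of_bool ((config_edges (arity m) N r \<sigma>, as) \<in> X))"
proof -
  let ?P = "permutations_of_set {0..<N * r}" and ?L = "label_set (arity m) (N * r div arity m)"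
  let ?g = "\<lambda>(\<sigma>, as). (config_edges (arity m) N r \<sigma>, as)"
  have neL: "replicate (N * r div arity m) (replicate (arity m) 0) \<in> ?L"
    by (auto simp: label_set_def)
  have ne: "?P \<noteq> {}" "?L \<noteq> {}" using neL by (auto simp: permutations_of_set_empty_iff)
  have fin: "finite ?P" "finite ?L" by (auto simp: finite_label_set)
  have pair: "pair_pmf (pmf_of_set ?P) (pmf_of_set ?L) = pmf_of_set A"
  proof (rule pmf_eqI)
    have A: "A \<noteq> {}" "finite A" using ne fin by (auto simp: A_def)
    show "pmf (pair_pmf (pmf_of_set ?P) (pmf_of_set ?L)) a = pmf (pmf_of_set A) a" for a
    proof (cases a)
      case (Pair \<sigma> as)
      then show ?thesis
        unfolding Pair pmf_pair pmf_of_set[OF ne(1) fin(1)] pmf_of_set[OF ne(2) fin(2)] pmf_of_set[OF A]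
        by (simp add: A_def card_cartesian_product indicator_def)
    qed
  qed
  have "random_instance m N r = map_pmf ?g (pair_pmf (pmf_of_set ?P) (pmf_of_set ?L))"
    unfolding random_instance_def pair_pmf_def by (simp add: map_bind_pmf map_pmf_def bind_assoc_pmf bind_return_pmf)
  then have "measure_pmf.prob (random_instance m N r) X = measure_pmf.prob (pmf_of_set A) (?g -` X)"
    unfolding pair by simp
  also have "\<dots> = card (A \<inter> ?g -` X) / card A"
    using ne fin by (intro measure_pmf_of_set) (auto simp: A_def)
  also have "\<dots> = avg A (\<lambda>(\<sigma>, as). of_bool ((config_edges (arity m) N r \<sigma>, as) \<in> X))"
  proof -
    have "(\<Sum>a\<in>A. case a of (\<sigma>, as) \<Rightarrow> of_bool ((config_edges (arity m) N r \<sigma>, as) \<in> X)) =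
        (\<Sum>a\<in>A. of_bool (?g a \<in> X) :: real)" by (intro sum.cong) auto
    also have "\<dots> = card (A \<inter> {a. ?g a \<in> X})" using fin by (simp add: sum_of_bool_eq A_def)
    finally show ?thesis by (simp add: avg_def vimage_def)
  qed
  finally show ?thesis .
qed

lemma partition_fn_eq_Z:
  assumes "r > 0" "lam \<ge> 1" "valid_model m" "M * arity m = N * r"
    and \<sigma>: "\<sigma> \<in> permutations_of_set {0..<N * r}" and as: "as \<in> label_set (arity m) M"
  shows "partition_fn m lam N (config_edges (arity m) N r \<sigma>) as =
    spin_model.Z (arity m) (alphabet m) (\<lambda>k. lam powr node_pot m k) (top_weight m lam)
      (weight_drop m lam) (bad_patterns m) (bad_value m) {..<N} {..<M} (instance_cfg (arity m) M r (\<sigma>, as))"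
proof -
  interpret spin_model "arity m" "alphabet m" r "\<lambda>k. lam powr node_pot m k" "top_weight m lam"
    "weight_drop m lam" "bad_patterns m" "bad_value m"
    using assms(1-3) by (rule spin_model_of_model)
  let ?K = "arity m" and ?\<phi> = "instance_cfg (arity m) M r (\<sigma>, as)"
  let ?es = "config_edges ?K N r \<sigma>"
  have lam: "lam > 0" using assms by simp
  have M: "N * r div ?K = M" using K_pos by (metis assms(4) nonzero_mult_div_cancel_right less_numeral_extra(3))
  have len_es: "length ?es = M" by (simp add: config_edges_def M)
  have len: "length \<sigma> = M * ?K" using length_finite_permutations_of_set[OF \<sigma>] assms(4) by simp
  have set\<sigma>: "set \<sigma> = {0..<N * r}" using \<sigma> by (auto simp: permutations_of_set_def)
  have node: "\<sigma> ! (i * ?K + s) div r < N" if "i < M" "s < ?K" for i s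
  proof -
    have "\<sigma> ! (i * ?K + s) \<in> set \<sigma>" using slot_index(1)[OF that] len by (intro nth_mem) simp
    then show ?thesis using set\<sigma> by (simp add: less_mult_imp_div_less)
  qed
  have es: "?es ! i = map (\<lambda>s. \<sigma> ! (i * ?K + s) div r) [0..<?K]" if "i < M" for i
  proof -
    have "i * ?K + ?K \<le> length \<sigma>" using slot_index(1)[OF that, of "?K - 1" ?K] K_pos len by linarith
    then have "map (\<lambda>p. p div r) (take ?K (drop (i * ?K) \<sigma>)) = map (\<lambda>s. \<sigma> ! (i * ?K + s) div r) [0..<?K]"
      by (auto simp: list_eq_iff_nth_eq min_def)
    then show ?thesis using that by (simp add: config_edges_def M)
  qed
  have edge: "lam_pow lam (edge_pot m (as ! i) (map x (?es ! i))) = edge_wt x ?\<phi> i"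
    if x: "x \<in> spins {..<N}" and i: "i < M" for x i
  proof -
    have a: "as ! i \<in> set as" using as i by (auto simp: label_set_def)
    have "lam_pow lam (edge_pot m (as ! i) (map x (?es ! i))) = top_weight m lam * (1 - weight_drop m lam *
        (\<Sum>t\<in>bad_patterns m. \<Prod>s<?K. of_bool (map x (?es ! i) ! s = bad_value m t (as ! i ! s))))"
    proof (rule lam_pow_edge_pot[OF assms(2,3)])
      show "set (map x (?es ! i)) \<subseteq> {..<alphabet m}"
        using x node[OF i] by (auto simp: es[OF i] spins_def dest!: PiE_mem[of x])
    qed (use a as in \<open>auto simp: es[OF i] label_set_def\<close>)
    also have "\<dots> = edge_wt x ?\<phi> i"
      unfolding edge_wt_def viol_def hit_def
      by (intro arg_cong2[where f = "(*)"] arg_cong2[where f = "(-)"] sum.cong prod.cong refl)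
         (use i in \<open>auto simp: es[OF i] instance_cfg_def\<close>)
    finally show ?thesis .
  qed
  have "lam_pow lam (hamiltonian m N ?es as x) = wt {..<N} {..<M} ?\<phi> x" if x: "x \<in> spins {..<N}" for x
  proof -
    have 1: "lam_pow lam (\<Sum>i<N. ereal (node_pot m (x i))) = (\<Prod>i<N. lam_pow lam (ereal (node_pot m (x i)))) \<and>
        (\<Sum>i<N. ereal (node_pot m (x i))) \<noteq> \<infinity>"
      by (rule lam_pow_sum[OF lam]) auto
    have 2: "lam_pow lam (\<Sum>j<M. edge_pot m (as ! j) (map x (?es ! j))) =
        (\<Prod>j<M. lam_pow lam (edge_pot m (as ! j) (map x (?es ! j)))) \<and>
        (\<Sum>j<M. edge_pot m (as ! j) (map x (?es ! j))) \<noteq> \<infinity>"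
      by (rule lam_pow_sum[OF lam]) (rule edge_pot_not_inf)
    have "lam_pow lam (hamiltonian m N ?es as x) =
        (\<Prod>i<N. lam_pow lam (ereal (node_pot m (x i)))) * (\<Prod>j<M. lam_pow lam (edge_pot m (as ! j) (map x (?es ! j))))"
      unfolding hamiltonian_def len_es 
      by (simp only: lam_pow_add[OF lam conjunct2[OF 1] conjunct2[OF 2]] conjunct1[OF 1] conjunct1[OF 2])
    also have "\<dots> = wt {..<N} {..<M} ?\<phi> x"
      unfolding wt_def by (intro arg_cong2[where f = "(*)"] prod.cong refl) (simp_all add: edge[OF x], simp add: lam_pow_def)
    finally show ?thesis .
  qed
  then show ?thesis unfolding partition_fn_def Z_def spins_def by (intro sum.cong) auto
qed

theorem theorem4:
  fixes m :: model and r :: nat and lam :: real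
  assumes "r > 0" and "lam \<ge> 1" and "valid_model m"
  shows "\<exists>z::real. \<forall>\<epsilon>>0. \<forall>\<delta>>0. \<exists>N0. \<forall>N\<ge>N0. arity m dvd N * r \<longrightarrow>
           measure_pmf.prob (random_instance m N r)
             {(es, as). \<bar>ln (partition_fn m lam N es as) / real N - z\<bar> > \<epsilon>} < \<delta>"
proof -
  interpret spin_model "arity m" "alphabet m" r "\<lambda>k. lam powr node_pot m k" "top_weight m lam"
    "weight_drop m lam" "bad_patterns m" "bad_value m"
    using assms by (rule spin_model_of_model)
  have "measure_pmf.prob (random_instance m N r) {(es, as). \<bar>ln (partition_fn m lam N es as) / real N - z\<bar> > \<epsilon>} =
      avg (cfg (slots {..<N * r div arity m}) (\<lambda>_. points {..<N}))
       (\<lambda>\<phi>. of_bool (\<bar>ln (Z {..<N} {..<N * r div arity m} \<phi>) / N - z\<bar> > \<epsilon>))"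
    if dvd: "arity m dvd N * r" for N z \<epsilon>
  proof -
    let ?M = "N * r div arity m"
    let ?A = "permutations_of_set {0..<N * r} \<times> label_set (arity m) ?M"
    have M: "?M * arity m = N * r" using dvd by simp
    have "avg (cfg (slots {..<?M}) (\<lambda>_. points {..<N})) (\<lambda>\<phi>. of_bool (\<bar>ln (Z {..<N} {..<?M} \<phi>) / N - z\<bar> > \<epsilon>)) =
        avg ?A (\<lambda>a. of_bool (\<bar>ln (Z {..<N} {..<?M} (instance_cfg (arity m) ?M r a)) / N - z\<bar> > \<epsilon>))"
      using instance_cfg_bij[OF K_pos r_pos M] unfolding slots_def points_def by (rule avg_reindex)
    also have "\<dots> = measure_pmf.prob (random_instance m N r) {(es, as). \<bar>ln (partition_fn m lam N es as) / real N - z\<bar> > \<epsilon>}"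
      unfolding prob_random_instance using partition_fn_eq_Z[OF assms M] by (intro avg_cong refl) auto
    finally show ?thesis ..
  qed
  then show ?thesis using ln_Z_limit by simp
qed

end
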